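(* Let $G$ be a finite group and suppose $\chi\in\mathrm{Irr}(G)$ satisfies $\bar\chi\chi=(1_U)^G$ where $U\subseteq G$ is a regular intersection in $G$. Let $V\subseteq G$ be a complete intersection in $G$. Then the following are equivalent: (1) $\chi$ vanishes off the union of the $G$-conjugates of $V$; (2) $U$ is conjugate in $G$ to a subgroup of $V$. Furthermore, if $V$ is a maximal subgroup of $G$, then either (1) and (2) hold, or $\chi|_V$ is irreducible.
   Context: All groups are finite and characters are complex; $\mathrm{Irr}(G)$ is the set of irreducible characters of $G$. $(1_U)^G$ is the permutation character of $G$ on the cosets of $U$. Complete intersection: a subgroup $V\subseteq G$ is a complete intersection (in $G$) if (1) $G$ is $p$-solvable for each prime $p$ dividing $|G:V|$; and (2) there exist maximal subgroups $M_i\subset G$ (a finite family) with $V=\bigcap_i M_i$ and $|G:V|=\prod_i|G:M_i|$. $G$ itself is regarded as the complete intersection of the empty family. The module $X_M$: if $M$ is a maximal subgroup of $G$ and $G$ is $p$-solvable for a prime $p$ dividing $|G:M|$, then $G/\mathrm{Core}_G(M)$ has a unique minimal normal subgroup, denoted $X_M$; it is an elementary abelian $p$-group and is regarded as a simple right $\mathbb F_pG$-module via conjugation. For an abelian group $X$ acted on by $G$, $X^*$ denotes the dual module, i.e. $\mathrm{Irr}(X)$ with $G$-action $\lambda^g(x^g)=\lambda(x)$. Regular intersection: a subgroup $U\subseteq G$ is a regular intersection (in $G$) if there exist maximal subgroups $M_i\subset G$ (a finite, possibly empty, family; the empty intersection is $G$) such that (1) $G$ is $p$-solvable for each prime $p$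 dividing $|G:U|$; (2) $U=\bigcap_iM_i$; (3) for any $i\neq j$, $X_{M_i}$ is isomorphic neither to $X_{M_j}$ nor to $X_{M_j}^*$ as $G$-module. *)

theory Defs
  imports
    "HOL-Algebra.Coset"
    "HOL-Computational_Algebra.Primes"
    "Jordan_Normal_Form.VS_Connect"
begin

section \<open>Groups\<close>

text \<open>The convention is \<open>x\<^sup>g = g\<^sup>-\<^sup>1 x g\<close>, a right action.\<close>

definition conj_elt :: "('a, 'b) monoid_scheme \<Rightarrow> 'a \<Rightarrow> 'a \<Rightarrow> 'a"
  where "conj_elt G x g = inv\<^bsub>G\<^esub> g \<otimes>\<^bsub>G\<^esub> x \<otimes>\<^bsub>G\<^esub> g"

definition conj_set :: "('a, 'b) monoid_scheme \<Rightarrow> 'a set \<Rightarrow> 'a \<Rightarrow> 'a set"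
  where "conj_set G H g = (\<lambda>x. conj_elt G x g) ` H"

definition index :: "('a, 'b) monoid_scheme \<Rightarrow> 'a set \<Rightarrow> nat"
  where "index G H = card (rcosets\<^bsub>G\<^esub> H)"

definition core :: "('a, 'b) monoid_scheme \<Rightarrow> 'a set \<Rightarrow> 'a set"
  where "core G H = (\<Inter>g\<in>carrier G. conj_set G H g)"

definition maximal_subgroup :: "('a, 'b) monoid_scheme \<Rightarrow> 'a set \<Rightarrow> bool"
  where "maximal_subgroup G M \<longleftrightarrow>
    subgroup M G \<and> M \<noteq> carrier G \<and>
    (\<forall>H. subgroup H G \<and> M \<subseteq> H \<longrightarrow> H = M \<or> H = carrier G)"

definition minimal_normal_subgroup :: "('a, 'b) monoid_scheme \<Rightarrow> 'a set \<Rightarrow> bool"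
  where "minimal_normal_subgroup G N \<longleftrightarrow>
    N \<lhd> G \<and> N \<noteq> {\<one>\<^bsub>G\<^esub>} \<and>
    (\<forall>K. K \<lhd> G \<and> K \<subseteq> N \<longrightarrow> K = {\<one>\<^bsub>G\<^esub>} \<or> K = N)"

text \<open>A finite group is \<open>p\<close>-solvable if it has a normal series each of whose factors is
  a \<open>p\<close>-group or a group of order prime to \<open>p\<close>.\<close>

definition p_solvable :: "('a, 'b) monoid_scheme \<Rightarrow> nat \<Rightarrow> bool"
  where "p_solvable G p \<longleftrightarrow>
    (\<exists>(N :: nat \<Rightarrow> 'a set) r. N 0 = {\<one>\<^bsub>G\<^esub>} \<and> N r = carrier G \<and> (\<forall>i\<le>r. N i \<lhd> G) \<and>
      (\<forall>i<r. N i \<subseteq> N (Suc i) \<and>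
        ((\<exists>k. Coset.order (G\<lparr>carrier := N (Suc i)\<rparr> Mod N i) = p ^ k) \<or>
         coprime p (Coset.order (G\<lparr>carrier := N (Suc i)\<rparr> Mod N i)))))"


section \<open>Complex characters\<close>

definition mat_trace :: "'a :: comm_monoid_add mat \<Rightarrow> 'a"
  where "mat_trace A = (\<Sum>i<dim_row A. A $$ (i, i))"

definition representation :: "('a, 'b) monoid_scheme \<Rightarrow> nat \<Rightarrow> ('a \<Rightarrow> complex mat) \<Rightarrow> bool"
  where "representation G n \<rho> \<longleftrightarrow> \<rho> \<in> hom G (units_of (ring_mat TYPE(complex) n ()))"

definition irreducible_representation ::
    "('a, 'b) monoid_scheme \<Rightarrow> nat \<Rightarrow> ('a \<Rightarrow> complex mat) \<Rightarrow> bool"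
  where "irreducible_representation G n \<rho> \<longleftrightarrow>
    representation G n \<rho> \<and> n > 0 \<and>
    (\<forall>W. VectorSpace.subspace class_ring W (module_vec TYPE(complex) n) \<and>
         (\<forall>g\<in>carrier G. \<forall>w\<in>W. \<rho> g *\<^sub>v w \<in> W)
       \<longrightarrow> W = {0\<^sub>v n} \<or> W = carrier_vec n)"

text \<open>Characters are normalised to be \<open>undefined\<close> off the carrier, so that equality of
  characters is equality of HOL functions; restricting a character to a subgroup \<open>V\<close> is
  \<open>restrict \<chi> V\<close>.\<close>

definition character :: "('a, 'b) monoid_scheme \<Rightarrow> ('a \<Rightarrow> complex mat) \<Rightarrow> 'a \<Rightarrow> complex"
  where "character G \<rho> = (\<lambda>g\<in>carrier G. mat_trace (\<rho> g))"

definition Irr :: "('a, 'b) monoid_scheme \<Rightarrow> ('a \<Rightarrow> complex) set"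
  where "Irr G = {character G \<rho> | n \<rho>. irreducible_representation G n \<rho>}"

text \<open>\<open>G\<close> acts on the right cosets \<open>U x\<close> by right multiplication; the permutation character
  counts fixed points.\<close>

definition perm_character :: "('a, 'b) monoid_scheme \<Rightarrow> 'a set \<Rightarrow> 'a \<Rightarrow> complex"
  where "perm_character G U = (\<lambda>g\<in>carrier G. of_nat (card {C \<in> rcosets\<^bsub>G\<^esub> U. C #>\<^bsub>G\<^esub> g = C}))"


section \<open>Modules\<close>

text \<open>A right \<open>G\<close>-module is given by a group \<open>A\<close> (written multiplicatively) and an action map
  \<open>\<alpha>\<close>, with \<open>\<alpha> x g\<close> standing for \<open>x\<^sup>g\<close>. For elementary abelian \<open>p\<close>-groups, isomorphisms of
  groups are the same as isomorphisms of vector spaces over the field with \<open>p\<close> elements, so the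
  following is isomorphism over the group algebra.\<close>

definition module_isomorphic ::
    "('a, 'b) monoid_scheme \<Rightarrow> ('x, 'c) monoid_scheme \<Rightarrow> ('x \<Rightarrow> 'a \<Rightarrow> 'x) \<Rightarrow>
     ('y, 'd) monoid_scheme \<Rightarrow> ('y \<Rightarrow> 'a \<Rightarrow> 'y) \<Rightarrow> bool"
  where "module_isomorphic G A \<alpha> B \<beta> \<longleftrightarrow>
    (\<exists>f \<in> iso A B. \<forall>x\<in>carrier A. \<forall>g\<in>carrier G. f (\<alpha> x g) = \<beta> (f x) g)"

text \<open>The dual of an abelian group: its irreducible (that is, linear) characters under
  pointwise multiplication.\<close>

definition dual_group :: "('x, 'c) monoid_scheme \<Rightarrow> ('x \<Rightarrow> complex) monoid"
  where "dual_group A = \<lparr>carrier = Irr A,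
    monoid.mult = (\<lambda>\<kappa> \<kappa>'. \<lambda>x\<in>carrier A. \<kappa> x * \<kappa>' x),
    one = (\<lambda>x\<in>carrier A. 1)\<rparr>"

text \<open>\<open>\<kappa>\<^sup>g (x\<^sup>g) = \<kappa> x\<close>, solved for \<open>\<kappa>\<^sup>g\<close>.\<close>

definition dual_action ::
    "('a, 'b) monoid_scheme \<Rightarrow> ('x, 'c) monoid_scheme \<Rightarrow> ('x \<Rightarrow> 'a \<Rightarrow> 'x) \<Rightarrow>
     ('x \<Rightarrow> complex) \<Rightarrow> 'a \<Rightarrow> ('x \<Rightarrow> complex)"
  where "dual_action G A \<alpha> \<kappa> g = (\<lambda>x\<in>carrier A. \<kappa> (\<alpha> x (inv\<^bsub>G\<^esub> g)))"

text \<open>The unique minimal normal subgroup of \<open>G / Core(M)\<close>. It exists when \<open>M\<close> is maximal and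
  \<open>G\<close> is \<open>p\<close>-solvable for some prime \<open>p\<close> dividing the index of \<open>M\<close>; it is only used then.\<close>

definition X_group :: "('a, 'b) monoid_scheme \<Rightarrow> 'a set \<Rightarrow> 'a set monoid"
  where "X_group G M =
    (G Mod core G M)\<lparr>carrier := (THE K. minimal_normal_subgroup (G Mod core G M) K)\<rparr>"

definition X_action :: "('a, 'b) monoid_scheme \<Rightarrow> 'a set \<Rightarrow> 'a set \<Rightarrow> 'a \<Rightarrow> 'a set"
  where "X_action G M x g = conj_elt (G Mod core G M) x (core G M #>\<^bsub>G\<^esub> g)"


section \<open>Complete and regular intersections\<close>

text \<open>Intersecting with \<open>carrier G\<close> makes the intersection of the empty family equal to \<open>G\<close>.\<close>

definition family_inter :: "('a, 'b) monoid_scheme \<Rightarrow> nat set \<Rightarrow> (nat \<Rightarrow> 'a set) \<Rightarrow> 'a set"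
  where "family_inter G I M = carrier G \<inter> (\<Inter>i\<in>I. M i)"

definition complete_intersection :: "('a, 'b) monoid_scheme \<Rightarrow> 'a set \<Rightarrow> bool"
  where "complete_intersection G V \<longleftrightarrow>
    subgroup V G \<and>
    (\<forall>p. prime p \<and> p dvd index G V \<longrightarrow> p_solvable G p) \<and>
    (\<exists>I M. finite I \<and> (\<forall>i\<in>I. maximal_subgroup G (M i)) \<and>
       V = family_inter G I M \<and>
       index G V = (\<Prod>i\<in>I. index G (M i)))"

definition regular_intersection :: "('a, 'b) monoid_scheme \<Rightarrow> 'a set \<Rightarrow> bool"
  where "regular_intersection G U \<longleftrightarrow>
    subgroup U G \<and>
    (\<exists>I M. finite I \<and> (\<forall>i\<in>I. maximal_subgroup G (M i)) \<and>
       (\<forall>p. prime p \<and> p dvd index G U \<longrightarrow> p_solvable G p) \<and>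
       U = family_inter G I M \<and>
       (\<forall>i\<in>I. \<forall>j\<in>I. i \<noteq> j \<longrightarrow>
          \<not> module_isomorphic G (X_group G (M i)) (X_action G (M i))
              (X_group G (M j)) (X_action G (M j)) \<and>
          \<not> module_isomorphic G (X_group G (M i)) (X_action G (M i))
              (dual_group (X_group G (M j)))
              (dual_action G (X_group G (M j)) (X_action G (M j)))))"


definition vanishes_off_conjugates ::
    "('a, 'b) monoid_scheme \<Rightarrow> ('a \<Rightarrow> complex) \<Rightarrow> 'a set \<Rightarrow> bool"
  where "vanishes_off_conjugates G \<chi> V \<longleftrightarrow>
    (\<forall>g \<in> carrier G - (\<Union>x\<in>carrier G. conj_set G V x). \<chi> g = 0)"

definition conjugate_to_subgroup_of ::
    "('a, 'b) monoid_scheme \<Rightarrow> 'a set \<Rightarrow> 'a set \<Rightarrow> bool"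
  where "conjugate_to_subgroup_of G U V \<longleftrightarrow>
    (\<exists>x\<in>carrier G. subgroup (conj_set G U x) (G\<lparr>carrier := V\<rparr>))"

end

theory Submission
  imports Defs "HOL-Algebra.Zassenhaus" "HOL-Algebra.Group_Action"
    "HOL-Library.Function_Algebras" "Jordan_Normal_Form.Schur_Decomposition"
begin

text \<open>
  Since \<open>\<bar>\<chi>\<bar>\<^sup>2\<close> is the permutation character on the cosets of \<open>U\<close>, the character \<open>\<chi>\<close> is nonzero
  exactly at the elements that have a conjugate in \<open>U\<close>. Hence \<open>\<chi>\<close> vanishes off the conjugates of
  \<open>V\<close> if and only if \<open>U\<close> is covered by the conjugates of \<open>V\<close>, and the first assertion says that \<open>U\<close>
  is then contained in a single one of them (\<open>regular_covered_by_complete_intersection\<close>).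

  Let \<open>V\<close> be the intersection of maximal subgroups \<open>M\<^sub>i\<close> with index the product of their indices.
  Then \<open>G\<close> is transitive on the product of the coset spaces \<open>G / M\<^sub>i\<close>, so conjugates of the single
  \<open>M\<^sub>i\<close> containing \<open>U\<close> can be replaced by conjugates under one common element
  (\<open>complete_intersection_common_coset\<close>). This reduces the question to one maximal subgroup \<open>M\<close>, where
  everything follows from a dichotomy: either \<open>U\<close> lies in a conjugate of \<open>M\<close>, or \<open>U M = G\<close>
  (\<open>unlinked_intersection_dichotomy\<close>). In the second case \<open>U\<close> is transitive on \<open>G / M\<close>, so by
  Jordan's counting argument some element of \<open>U\<close> has no conjugate in \<open>M\<close>, and \<open>U\<close> is not covered.
  Moreover \<open>M\<close> is then transitive on \<open>G / U\<close>, the sum of \<open>\<bar>\<chi>\<bar>\<^sup>2\<close> over \<open>M\<close> is the order of \<open>M\<close>, and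
  the restriction of \<open>\<chi>\<close> to \<open>M\<close> is irreducible. This is the last assertion of the theorem.

  The dichotomy is proved by climbing a chief series. Let \<open>N\<close> be normal and contained in all maximal
  subgroups in question, and let \<open>K / N\<close> be a chief factor. A maximal subgroup \<open>M\<^sub>j\<close> that does not
  contain \<open>K\<close> complements \<open>K / N\<close>, and \<open>K / N\<close> is then isomorphic to the module \<open>X\<close> of \<open>M\<^sub>j\<close>
  (\<open>chief_linked_imp_module_isomorphic\<close>). By the regularity of \<open>U\<close> this happens for at most one of the
  maximal subgroups that define \<open>U\<close>. If \<open>M\<^sub>j\<close> and \<open>M\<close> both fail to contain \<open>K\<close>, there are two
  possibilities. If they have the same core, they are conjugate, by the vanishing of the first
  cohomology of a \<open>p\<close>-solvable group on a faithful simple module in characteristic \<open>p\<close>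
  (\<open>maximal_same_core_conjugate\<close>). If not, then \<open>M\<close> and \<open>M\<^sub>j\<close> cut out two complements in a sum of two
  copies of \<open>K / N\<close>, and \<open>M\<close> may be replaced by the maximal subgroup \<open>K (M \<inter> M\<^sub>j)\<close>, which belongs to
  the diagonal and contains \<open>K\<close> (\<open>diagonal_maximal_subgroup\<close>). In every case the chief factor \<open>K / N\<close> is
  disposed of, and one continues above \<open>K\<close>.
\<close>


section \<open>Orders of subgroups\<close>

locale finite_group = group +
  assumes finite_carrier [simp]: "finite (carrier G)"

text \<open>The fibres of the multiplication map from \<open>H \<times> K\<close> to \<open>H K\<close> are in bijection with \<open>H \<inter> K\<close>.\<close>

lemma (in group) card_set_mult:
  assumes H: "subgroup H G" and K: "subgroup K G" and fin: "finite H" "finite K"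
  shows "card (H <#> K) * card (H \<inter> K) = card H * card K"
proof -
  have Hc: "H \<subseteq> carrier G" and Kc: "K \<subseteq> carrier G"
    using H K subgroup.subset by auto
  define F where "F z = {p \<in> H \<times> K. fst p \<otimes> snd p = z}" for z
  have fib: "card (F z) = card (H \<inter> K)" if z: "z \<in> H <#> K" for z
  proof -
    obtain h k where hk: "h \<in> H" "k \<in> K" "z = h \<otimes> k"
      using z by (auto simp: set_mult_def)
    have hkc: "h \<in> carrier G" "k \<in> carrier G" using hk Hc Kc by auto
    have "bij_betw (\<lambda>x. (h \<otimes> x, inv x \<otimes> k)) (H \<inter> K) (F z)"
    proof (rule bij_betw_byWitness[where f' = "\<lambda>p. inv h \<otimes> fst p"])
      show "\<forall>x\<in>H \<inter> K. inv h \<otimes> fst (h \<otimes> x, inv x \<otimes> k) = x"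
        using Hc hkc by (auto simp: m_assoc[symmetric])
      show "\<forall>p\<in>F z. (h \<otimes> (inv h \<otimes> fst p), inv (inv h \<otimes> fst p) \<otimes> k) = p"
      proof
        fix p assume p: "p \<in> F z"
        obtain a b where ab: "p = (a, b)" by (cases p)
        have abm: "a \<in> H" "b \<in> K" "a \<otimes> b = h \<otimes> k" using p ab hk by (auto simp: F_def)
        have abc: "a \<in> carrier G" "b \<in> carrier G" using abm Hc Kc by auto
        have "inv (inv h \<otimes> a) \<otimes> k = inv a \<otimes> (h \<otimes> k)"
          using abc hkc by (simp add: inv_mult_group m_assoc)
        also have "\<dots> = b" using abc by (simp flip: abm(3) add: m_assoc[symmetric])
        finally show "(h \<otimes> (inv h \<otimes> fst p), inv (inv h \<otimes> fst p) \<otimes> k) = p"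
          using ab abc hkc by (simp add: m_assoc[symmetric])
      qed
      show "(\<lambda>x. (h \<otimes> x, inv x \<otimes> k)) ` (H \<inter> K) \<subseteq> F z"
      proof (clarsimp simp: F_def)
        fix x assume x: "x \<in> H" "x \<in> K"
        have "h \<otimes> x \<otimes> (inv x \<otimes> k) = h \<otimes> k"
          by (smt (verit) Hc hkc inv_closed m_assoc m_closed r_inv r_one subsetD x(1))
        then show "h \<otimes> x \<in> H \<and> inv x \<otimes> k \<in> K \<and> h \<otimes> x \<otimes> (inv x \<otimes> k) = z"
          using x hk H K by (simp add: subgroup.m_closed subgroup.m_inv_closed)
      qed
      show "(\<lambda>p. inv h \<otimes> fst p) ` F z \<subseteq> H \<inter> K"
      proof
        fix y assume "y \<in> (\<lambda>p. inv h \<otimes> fst p) ` F z"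
        then obtain a b where ab: "a \<in> H" "b \<in> K" "a \<otimes> b = h \<otimes> k" "y = inv h \<otimes> a"
          using hk by (auto simp: F_def)
        have abc: "a \<in> carrier G" "b \<in> carrier G" using ab Hc Kc by auto
        have "inv h \<otimes> a = inv h \<otimes> (a \<otimes> b) \<otimes> inv b"
          using abc hkc by (simp add: m_assoc)
        also have "\<dots> = k \<otimes> inv b"
          using abc hkc by (simp add: ab(3) m_assoc[symmetric])
        finally have "y = k \<otimes> inv b" using ab by simp
        moreover have "inv h \<otimes> a \<in> H" "k \<otimes> inv b \<in> K"
          using ab hk H K by (auto intro!: subgroup.m_closed subgroup.m_inv_closed)
        ultimately show "y \<in> H \<inter> K" using ab(4) by auto
      qed
    qed
    then show ?thesis by (simp add: bij_betw_same_card)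
  qed
  have "card H * card K = card (H \<times> K)" by (simp add: card_cartesian_product)
  also have "H \<times> K = (\<Union>z\<in>H <#> K. F z)"
    by (auto simp: F_def set_mult_def) blast
  also have "card \<dots> = (\<Sum>z\<in>H <#> K. card (F z))"
  proof (rule card_UN_disjoint)
    show "finite (H <#> K)" using fin by (simp add: set_mult_def)
    show "\<forall>z\<in>H <#> K. finite (F z)" using fin by (simp add: F_def)
  qed (auto simp: F_def)
  also have "\<dots> = card (H <#> K) * card (H \<inter> K)" by (simp add: fib)
  finally show ?thesis by simp
qed

context finite_group
begin

lemma finite_subset_carrier [simp]: "H \<subseteq> carrier G \<Longrightarrow> finite H"
  using finite_carrier finite_subset by blast

lemma finite_subgroup: "subgroup H G \<Longrightarrow> finite H"
  using subgroup.subset[of H G] by auto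

lemma card_subgroup_pos: "subgroup H G \<Longrightarrow> card H > 0"
  using finite_subgroup subgroup.one_closed by (metis card_gt_0_iff empty_iff)

lemma card_subgroup_dvd:
  assumes "subgroup H G" "subgroup K G" "H \<subseteq> K"
  shows "card H dvd card K"
proof -
  interpret K: group "G\<lparr>carrier := K\<rparr>"
    using assms subgroup_imp_group by blast
  have "subgroup H (G\<lparr>carrier := K\<rparr>)"
    using assms subgroup_incl by blast
  from K.lagrange[OF this] have "card (rcosets\<^bsub>G\<lparr>carrier := K\<rparr>\<^esub> H) * card H = card K"
    by (simp add: Coset.order_def)
  then show ?thesis using dvd_triv_right by metis
qed

lemma index_mult_card: "subgroup H G \<Longrightarrow> index G H * card H = card (carrier G)"
  using lagrange[of H] by (simp add: index_def Coset.order_def)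

lemma subgroup_eqI_card:
  assumes "subgroup K G" "H \<subseteq> K" "card K \<le> card H"
  shows "H = K"
  using assms finite_subgroup card_seteq by blast

end


section \<open>Products, cores and chief factors\<close>

context group
begin

lemma inv_cancel [simp]:
  assumes "x \<in> carrier G" "y \<in> carrier G"
  shows "inv x \<otimes> (x \<otimes> y) = y" "x \<otimes> (inv x \<otimes> y) = y"
  using assms by (simp_all flip: m_assoc)

lemma dedekind_modular_law:
  assumes "subgroup H G" "A \<subseteq> H" "B \<subseteq> carrier G"
  shows "(A <#> B) \<inter> H = A <#> (B \<inter> H)"
proof -
  have Hc: "H \<subseteq> carrier G" using assms subgroup.subset by blast
  have "b \<in> H" if "a \<in> A" "b \<in> B" "a \<otimes> b \<in> H" for a b
  proof -
    have "inv a \<otimes> (a \<otimes> b) \<in> H"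
      using assms that by (meson subgroup.m_closed subgroup.m_inv_closed subsetD)
    moreover have "a \<in> carrier G" "b \<in> carrier G" using that assms Hc by auto
    ultimately show ?thesis by simp
  qed
  then show ?thesis
    using assms by (auto simp: set_mult_def subgroup.m_closed[OF assms(1)] subset_eq)
qed

lemma normal_set_mult:
  assumes "N \<lhd> G" "K \<lhd> G"
  shows "N <#> K \<lhd> G"
proof (rule normal_invI)
  show "subgroup (N <#> K) G"
    using assms mult_norm_subgroup normal_imp_subgroup by blast
  fix x h assume x: "x \<in> carrier G" and "h \<in> N <#> K"
  then obtain n k where nk: "n \<in> N" "k \<in> K" "h = n \<otimes> k"
    by (auto simp: set_mult_def)
  have c: "n \<in> carrier G" "k \<in> carrier G"
    using nk assms normal_imp_subgroup subgroup.mem_carrier by metis+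
  have "x \<otimes> h \<otimes> inv x = (x \<otimes> n \<otimes> inv x) \<otimes> (x \<otimes> k \<otimes> inv x)"
    using x c nk by (simp add: m_assoc)
  then show "x \<otimes> h \<otimes> inv x \<in> N <#> K"
    using nk x assms by (auto simp: set_mult_def dest: normal_invE(2))
qed

lemma set_mult_subset_left:
  assumes "A \<subseteq> carrier G" "subgroup B G"
  shows "A \<subseteq> A <#> B"
  using assms subgroup.one_closed[OF assms(2)] by (force simp: set_mult_def)

lemma set_mult_subset_right:
  assumes "subgroup A G" "B \<subseteq> carrier G"
  shows "B \<subseteq> A <#> B"
  using assms subgroup.one_closed[OF assms(1)] by (force simp: set_mult_def)

lemma set_mult_subset_subgroup:
  assumes "subgroup H G" "A \<subseteq> H" "B \<subseteq> H"
  shows "A <#> B \<subseteq> H"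
  using assms by (auto simp: set_mult_def intro: subgroup.m_closed)

lemma set_mult_absorb:
  assumes "subgroup H G" "A \<subseteq> H" "\<one> \<in> A"
  shows "A <#> H = H" "H <#> A = H"
proof -
  have "H \<subseteq> A <#> H" "H \<subseteq> H <#> A"
    using assms(3) subgroup.subset[OF assms(1)] by (force simp: set_mult_def)+
  then show "A <#> H = H" "H <#> A = H"
    using set_mult_subset_subgroup[OF assms(1)] assms(2) by blast+
qed

lemma subgroup_r_coset_eq_iff:
  assumes "subgroup H G" "x \<in> carrier G" "y \<in> carrier G"
  shows "H #> x = H #> y \<longleftrightarrow> x \<otimes> inv y \<in> H"
proof -
  interpret H: subgroup H G by fact
  show ?thesis
    using H.rcos_module[OF is_group assms(3,2)] repr_independence[of x H y] rcos_self[OF assms(2) assms(1)] assms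
    by auto
qed

lemma conj_elt_closed [simp]:
  "x \<in> carrier G \<Longrightarrow> g \<in> carrier G \<Longrightarrow> conj_elt G x g \<in> carrier G"
  by (simp add: conj_elt_def)

lemma mem_conj_set_iff:
  assumes "H \<subseteq> carrier G" "g \<in> carrier G" "x \<in> carrier G"
  shows "x \<in> conj_set G H g \<longleftrightarrow> g \<otimes> x \<otimes> inv g \<in> H"
proof
  assume "x \<in> conj_set G H g"
  then obtain h where h: "h \<in> H" "x = inv g \<otimes> h \<otimes> g"
    by (auto simp: conj_set_def conj_elt_def)
  have "h \<in> carrier G" using h assms by auto
  then have "g \<otimes> x \<otimes> inv g = h"
    using assms h by (simp add: m_assoc)
  then show "g \<otimes> x \<otimes> inv g \<in> H" using h by simp
next
  assume "g \<otimes> x \<otimes> inv g \<in> H"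
  moreover have "x = conj_elt G (g \<otimes> x \<otimes> inv g) g"
    using assms by (simp add: conj_elt_def m_assoc)
  ultimately show "x \<in> conj_set G H g" by (auto simp: conj_set_def)
qed

lemma conj_set_carrier:
  assumes "H \<subseteq> carrier G" "g \<in> carrier G"
  shows "conj_set G H g \<subseteq> carrier G"
  using assms by (auto simp: conj_set_def)

lemma core_mem_iff:
  assumes "M \<subseteq> carrier G"
  shows "x \<in> core G M \<longleftrightarrow> x \<in> carrier G \<and> (\<forall>g\<in>carrier G. g \<otimes> x \<otimes> inv g \<in> M)"
proof
  assume x: "x \<in> core G M"
  then have *: "\<And>g. g \<in> carrier G \<Longrightarrow> x \<in> conj_set G M g" by (simp add: core_def)
  then have "x \<in> carrier G" using conj_set_carrier[OF assms one_closed] one_closed by auto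
  then show "x \<in> carrier G \<and> (\<forall>g\<in>carrier G. g \<otimes> x \<otimes> inv g \<in> M)"
    using * mem_conj_set_iff[OF assms] by simp
next
  assume "x \<in> carrier G \<and> (\<forall>g\<in>carrier G. g \<otimes> x \<otimes> inv g \<in> M)"
  then show "x \<in> core G M" using mem_conj_set_iff[OF assms] by (simp add: core_def)
qed

lemma core_subset:
  assumes "M \<subseteq> carrier G"
  shows "core G M \<subseteq> M"
proof
  fix x assume "x \<in> core G M"
  then have x: "x \<in> carrier G" "\<forall>g\<in>carrier G. g \<otimes> x \<otimes> inv g \<in> M"
    using core_mem_iff[OF assms, of x] by blast+
  from x(2) one_closed have "\<one> \<otimes> x \<otimes> inv \<one> \<in> M" by (rule bspec)
  then show "x \<in> M" using x(1) by simp
qed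

lemma core_normal:
  assumes M: "subgroup M G"
  shows "core G M \<lhd> G"
proof -
  have Mc: "M \<subseteq> carrier G" using M subgroup.subset by blast
  note iff = core_mem_iff[OF Mc]
  show ?thesis
  proof (rule normal_invI)
    show "subgroup (core G M) G"
    proof (rule subgroupI)
      show "core G M \<subseteq> carrier G" using iff by blast
      have "\<one> \<in> core G M" using M by (simp add: iff subgroup.one_closed)
      then show "core G M \<noteq> {}" by blast
      fix a assume a: "a \<in> core G M"
      have ac: "a \<in> carrier G" using a iff by blast
      show "inv a \<in> core G M"
      proof -
        have "g \<otimes> inv a \<otimes> inv g \<in> M" if g: "g \<in> carrier G" for g
        proof -
          have "g \<otimes> inv a \<otimes> inv g = inv (g \<otimes> a \<otimes> inv g)"
            using g ac by (simp add: inv_mult_group m_assoc)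
          then show ?thesis using a g iff M by (simp add: subgroup.m_inv_closed)
        qed
        then show ?thesis using ac by (simp add: iff)
      qed
      fix b assume b: "b \<in> core G M"
      have bc: "b \<in> carrier G" using b iff by blast
      have "g \<otimes> (a \<otimes> b) \<otimes> inv g \<in> M" if g: "g \<in> carrier G" for g
      proof -
        have "g \<otimes> (a \<otimes> b) \<otimes> inv g = (g \<otimes> a \<otimes> inv g) \<otimes> (g \<otimes> b \<otimes> inv g)"
          using g ac bc by (simp add: m_assoc)
        then show ?thesis using a b g iff M by (simp add: subgroup.m_closed)
      qed
      then show "a \<otimes> b \<in> core G M" using ac bc by (simp add: iff)
    qed
    fix x h assume x: "x \<in> carrier G" and h: "h \<in> core G M"
    have hc: "h \<in> carrier G" using h iff by blast
    have "g \<otimes> (x \<otimes> h \<otimes> inv x) \<otimes> inv g \<in> M" if g: "g \<in> carrier G" for g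
    proof -
      have "g \<otimes> (x \<otimes> h \<otimes> inv x) \<otimes> inv g = (g \<otimes> x) \<otimes> h \<otimes> inv (g \<otimes> x)"
        using g x hc by (simp add: inv_mult_group m_assoc)
      then show ?thesis using h g x iff by simp
    qed
    then show "x \<otimes> h \<otimes> inv x \<in> core G M" using x hc by (simp add: iff)
  qed
qed

lemma normal_subset_core:
  assumes "M \<subseteq> carrier G" "N \<lhd> G" "N \<subseteq> M"
  shows "N \<subseteq> core G M"
  using assms core_mem_iff[OF assms(1)] normal_invE(2)[OF assms(2)] by blast

lemma maximal_subgroupD:
  assumes "maximal_subgroup G M"
  shows "subgroup M G" "M \<subseteq> carrier G" "M \<noteq> carrier G"
    "subgroup H G \<Longrightarrow> M \<subseteq> H \<Longrightarrow> H = M \<or> H = carrier G"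
  using assms subgroup.subset by (auto simp: maximal_subgroup_def)

lemma maximal_normal_supplement:
  assumes M: "maximal_subgroup G M" and N: "N \<lhd> G" and "\<not> N \<subseteq> M"
  shows "N <#> M = carrier G" "M <#> N = carrier G"
proof -
  note sM = maximal_subgroupD[OF M]
  have sN: "subgroup N G" using N normal_imp_subgroup by blast
  have "M \<subseteq> N <#> M" "N \<subseteq> N <#> M"
    using set_mult_subset_right[OF sN sM(2)] set_mult_subset_left[OF subgroup.subset[OF sN] sM(1)] by auto
  then show "N <#> M = carrier G"
    using sM(4)[OF mult_norm_subgroup[OF N sM(1)]] assms(3) by blast
  then show "M <#> N = carrier G" using commut_normal[OF sM(1) N] by simp
qed

end

definition chief_factor :: "('a, 'b) monoid_scheme \<Rightarrow> 'a set \<Rightarrow> 'a set \<Rightarrow> bool"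
  where "chief_factor G N K \<longleftrightarrow> N \<lhd> G \<and> K \<lhd> G \<and> N \<subset> K \<and>
    (\<forall>H. H \<lhd> G \<and> N \<subseteq> H \<and> H \<subseteq> K \<longrightarrow> H = N \<or> H = K)"

lemma chief_factorD:
  assumes "chief_factor G N K"
  shows "N \<lhd> G" "K \<lhd> G" "N \<subseteq> K" "N \<noteq> K" "subgroup N G" "subgroup K G"
    "H \<lhd> G \<Longrightarrow> N \<subseteq> H \<Longrightarrow> H \<subseteq> K \<Longrightarrow> H = N \<or> H = K"
  using assms unfolding chief_factor_def by (blast intro: normal_imp_subgroup)+

context finite_group
begin

lemma ex_chief_factor_above:
  assumes N: "N \<lhd> G" and H: "H \<lhd> G" "N \<subset> H"
  shows "\<exists>K. chief_factor G N K \<and> K \<subseteq> H"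
proof -
  define S where "S = {K. K \<lhd> G \<and> N \<subset> K \<and> K \<subseteq> H}"
  have "H \<in> S" using assms by (auto simp: S_def)
  moreover have "finite S" unfolding S_def
    by (rule finite_subset[of _ "Pow H"]) (use finite_subgroup normal_imp_subgroup[OF H(1)] in auto)
  ultimately obtain K where K: "K \<in> S" "\<forall>J\<in>S. J \<subseteq> K \<longrightarrow> J = K"
    using finite_has_minimal2[of S H] by blast
  have "J = N \<or> J = K" if J: "J \<lhd> G" "N \<subseteq> J" "J \<subseteq> K" for J
  proof (cases "J = N")
    case False
    then have "J \<in> S" using J K(1) by (auto simp: S_def)
    then show ?thesis using K(2) J(3) by blast
  qed simp
  then have "chief_factor G N K"
    using K(1) N by (simp add: chief_factor_def S_def)
  then show ?thesis using K by (auto simp: S_def)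
qed

end


section \<open>Actions of p-groups and centralizers of chief factors\<close>

lemma group_actionI:
  assumes P: "group P"
    and cl: "\<And>g x. g \<in> carrier P \<Longrightarrow> x \<in> E \<Longrightarrow> \<phi> g x \<in> E"
    and ext: "\<And>g. g \<in> carrier P \<Longrightarrow> \<phi> g \<in> extensional E"
    and one: "\<And>x. x \<in> E \<Longrightarrow> \<phi> \<one>\<^bsub>P\<^esub> x = x"
    and mult: "\<And>g h x. g \<in> carrier P \<Longrightarrow> h \<in> carrier P \<Longrightarrow> x \<in> E \<Longrightarrow>
      \<phi> (g \<otimes>\<^bsub>P\<^esub> h) x = \<phi> g (\<phi> h x)"
  shows "group_action P E \<phi>"
proof -
  interpret P: group P by fact
  have bij: "bij_betw (\<phi> g) E E" if g: "g \<in> carrier P" for g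
  proof (rule bij_betw_byWitness[where f' = "\<phi> (inv\<^bsub>P\<^esub> g)"])
    show "\<forall>x\<in>E. \<phi> (inv\<^bsub>P\<^esub> g) (\<phi> g x) = x" "\<forall>x\<in>E. \<phi> g (\<phi> (inv\<^bsub>P\<^esub> g) x) = x"
      using g by (simp_all add: one flip: mult)
  qed (use cl g in auto)
  have "\<phi> \<in> hom P (BijGroup E)"
  proof (rule homI)
    show "\<phi> g \<in> carrier (BijGroup E)" if "g \<in> carrier P" for g
      using bij[OF that] ext[OF that] by (simp add: BijGroup_def Bij_def)
    fix g h assume gh: "g \<in> carrier P" "h \<in> carrier P"
    have "\<phi> (g \<otimes>\<^bsub>P\<^esub> h) = compose E (\<phi> g) (\<phi> h)"
      by (rule extensionalityI[of _ E]) (use gh ext mult in \<open>auto simp: compose_def\<close>)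
    then show "\<phi> (g \<otimes>\<^bsub>P\<^esub> h) = \<phi> g \<otimes>\<^bsub>BijGroup E\<^esub> \<phi> h"
      using gh bij ext by (simp add: BijGroup_def Bij_def)
  qed
  then show ?thesis
    by (simp add: group_action_def group_hom_def group_hom_axioms_def P group_BijGroup)
qed

text \<open>An orbit that contains no fixed point has as its size a nontrivial power of \<open>p\<close>.\<close>

lemma (in group_action) p_group_fixed_points:
  assumes p: "prime (p::nat)" and ord: "Coset.order G = p ^ m" and fin: "finite E"
  shows "p dvd card {x \<in> E. \<forall>g\<in>carrier G. \<phi> g x = x} \<longleftrightarrow> p dvd card E"
proof -
  define F where "F = {x \<in> E. \<forall>g\<in>carrier G. \<phi> g x = x}"
  define C where "C = {b \<in> orbits G E \<phi>. b \<inter> F = {}}"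
  have grp: "group G" using group_hom group_hom.axioms(1) by blast
  have orb: "b \<subseteq> E" if "b \<in> orbits G E \<phi>" for b
    using that orbits_coverture by blast
  have "\<Union>C = E - F"
  proof
    show "\<Union>C \<subseteq> E - F" using orb by (auto simp: C_def)
    show "E - F \<subseteq> \<Union>C"
    proof
      fix x assume x: "x \<in> E - F"
      have "orbit G \<phi> x \<inter> F = {}"
      proof (rule ccontr)
        assume "orbit G \<phi> x \<inter> F \<noteq> {}"
        then obtain y where y: "y \<in> orbit G \<phi> x" "y \<in> F" by blast
        have yE: "y \<in> E" using y by (simp add: F_def)
        have "x \<in> orbit G \<phi> y" using orbit_sym[of x y] x yE y by blast
        then have "x = y" using y by (auto simp: orbit_def F_def)
        then show False using x y by blast
      qed
      then have "orbit G \<phi> x \<in> C" using x by (auto simp: C_def orbits_def)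
      then show "x \<in> \<Union>C" using orbit_refl x by blast
    qed
  qed
  moreover have "p dvd card (\<Union>C)"
  proof (rule dvd_partition)
    show "finite (\<Union>C)" using fin calculation by auto
    show "\<forall>c1\<in>C. \<forall>c2\<in>C. c1 \<noteq> c2 \<longrightarrow> c1 \<inter> c2 = {}"
      using disjoint_union by (auto simp: C_def)
    show "\<forall>c\<in>C. p dvd card c"
    proof
      fix c assume c: "c \<in> C"
      then obtain x where x: "x \<in> E" "c = orbit G \<phi> x" by (auto simp: C_def orbits_def)
      have "x \<in> c" using x orbit_refl by blast
      have "card c dvd p ^ m"
        using orbit_stabilizer_theorem[OF x(1)] x ord by (metis dvd_triv_left)
      then obtain i where i: "card c = p ^ i" using p divides_primepow_nat by blast
      have "card c \<noteq> 1"
      proof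
        assume "card c = 1"
        then have "c = {x}" using \<open>x \<in> c\<close> by (metis card_1_singletonE singletonD)
        then have "\<phi> g x = x" if "g \<in> carrier G" for g
          using that x by (auto simp: orbit_def)
        then have "x \<in> F" using x by (simp add: F_def)
        then show False using c \<open>x \<in> c\<close> by (auto simp: C_def)
      qed
      then have "i \<noteq> 0" using i by auto
      then show "p dvd card c" using i by (simp add: dvd_power)
    qed
  qed
  ultimately have "p dvd card (E - F)" by simp
  moreover have "card E = card (E - F) + card F"
    using fin card_mono[of E F] by (simp add: card_Diff_subset F_def)
  ultimately show ?thesis unfolding F_def[symmetric]
    by (metis dvd_add_right_iff)
qed

context group
begin

lemma commute_mult:
  assumes "a \<in> carrier G" "b \<in> carrier G" "k \<in> carrier G"
    "a \<otimes> k = k \<otimes> a" "b \<otimes> k = k \<otimes> b"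
  shows "(a \<otimes> b) \<otimes> k = k \<otimes> (a \<otimes> b)"
  using assms by (metis m_assoc)

lemma commute_inv:
  assumes "a \<in> carrier G" "k \<in> carrier G" "a \<otimes> k = k \<otimes> a"
  shows "inv a \<otimes> k = k \<otimes> inv a"
proof -
  have "inv a \<otimes> k = inv a \<otimes> (k \<otimes> a) \<otimes> inv a" using assms(1,2) by (simp add: m_assoc)
  also have "\<dots> = k \<otimes> inv a" using assms(1,2) by (simp flip: assms(3) add: m_assoc)
  finally show ?thesis .
qed

lemma commute_conj:
  assumes "a \<in> carrier G" "k \<in> carrier G" "x \<in> carrier G"
    "a \<otimes> (inv x \<otimes> k \<otimes> x) = (inv x \<otimes> k \<otimes> x) \<otimes> a"
  shows "(x \<otimes> a \<otimes> inv x) \<otimes> k = k \<otimes> (x \<otimes> a \<otimes> inv x)"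
proof -
  have "(x \<otimes> a \<otimes> inv x) \<otimes> k = x \<otimes> (a \<otimes> (inv x \<otimes> k \<otimes> x)) \<otimes> inv x"
    using assms(1-3) by (simp add: m_assoc)
  also have "\<dots> = k \<otimes> (x \<otimes> a \<otimes> inv x)"
    using assms(1-3) by (simp add: assms(4)) (simp add: m_assoc)
  finally show ?thesis .
qed

lemma group_hom_r_coset:
  assumes "N \<lhd> G"
  shows "group_hom G (G Mod N) (\<lambda>x. N #> x)"
  using assms normal.r_coset_hom_Mod[OF assms] normal.factorgroup_is_group[OF assms] is_group
  by (simp add: group_hom_def group_hom_axioms_def)

text \<open>The centralizer in \<open>G\<close> of the section \<open>K / N\<close>. Commuting modulo \<open>N\<close> is expressed by an equality
  of cosets, which makes the relation symmetric in the two elements.\<close>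

definition centralizer_mod :: "'a set \<Rightarrow> 'a set \<Rightarrow> 'a set"
  where "centralizer_mod N K = {g \<in> carrier G. \<forall>k\<in>K. N #> (g \<otimes> k) = N #> (k \<otimes> g)}"

lemma centralizer_mod_normal:
  assumes N: "N \<lhd> G" and K: "K \<lhd> G"
  shows "centralizer_mod N K \<lhd> G"
proof -
  interpret \<pi>: group_hom G "G Mod N" "\<lambda>x. N #> x" using group_hom_r_coset[OF N] .
  have Kc: "K \<subseteq> carrier G" using K normal_imp_subgroup subgroup.subset by blast
  note [simp] = subsetD[OF Kc]
  have mem: "g \<in> centralizer_mod N K \<longleftrightarrow> g \<in> carrier G \<and>
      (\<forall>k\<in>K. (N #> g) \<otimes>\<^bsub>G Mod N\<^esub> (N #> k) = (N #> k) \<otimes>\<^bsub>G Mod N\<^esub> (N #> g))" for g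
    by (simp add: centralizer_mod_def del: mult_FactGroup cong: conj_cong flip: \<pi>.hom_mult)
  show ?thesis
  proof (rule normal_invI)
    show "subgroup (centralizer_mod N K) G"
    proof (rule subgroupI)
      show "centralizer_mod N K \<subseteq> carrier G" by (auto simp: centralizer_mod_def)
      have "\<one> \<in> centralizer_mod N K" by (simp add: centralizer_mod_def)
      then show "centralizer_mod N K \<noteq> {}" by blast
      fix a assume a: "a \<in> centralizer_mod N K"
      show "inv a \<in> centralizer_mod N K"
        using a unfolding mem by (simp add: \<pi>.hom_inv \<pi>.H.commute_inv del: mult_FactGroup)
      fix b assume b: "b \<in> centralizer_mod N K"
      show "a \<otimes> b \<in> centralizer_mod N K"
        using a b unfolding mem by (simp add: \<pi>.H.commute_mult del: mult_FactGroup)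
    qed
    fix x h assume x: "x \<in> carrier G" and h: "h \<in> centralizer_mod N K"
    have hc: "h \<in> carrier G" using h mem by blast
    have "(N #> (x \<otimes> h \<otimes> inv x)) \<otimes>\<^bsub>G Mod N\<^esub> (N #> k) = (N #> k) \<otimes>\<^bsub>G Mod N\<^esub> (N #> (x \<otimes> h \<otimes> inv x))"
      if k: "k \<in> K" for k
    proof -
      have "inv x \<otimes> k \<otimes> x \<in> K" using normal.inv_op_closed1[OF K x k] .
      then have "(N #> h) \<otimes>\<^bsub>G Mod N\<^esub> (N #> (inv x \<otimes> k \<otimes> x)) =
          (N #> (inv x \<otimes> k \<otimes> x)) \<otimes>\<^bsub>G Mod N\<^esub> (N #> h)"
        using h mem by blast
      then show ?thesis
        using x hc k by (simp add: \<pi>.hom_inv \<pi>.H.commute_conj del: mult_FactGroup)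
    qed
    then show "x \<otimes> h \<otimes> inv x \<in> centralizer_mod N K" using x hc mem by simp
  qed
qed

lemma subset_centralizer_mod:
  assumes N: "N \<lhd> G" and K: "K \<subseteq> carrier G"
  shows "N \<subseteq> centralizer_mod N K"
proof
  fix n assume n: "n \<in> N"
  interpret N: normal N G by fact
  have nc: "n \<in> carrier G" using n by simp
  have "N #> (n \<otimes> k) = N #> (k \<otimes> n)" if "k \<in> K" for k
  proof -
    have kc: "k \<in> carrier G" using that K by auto
    have "n \<otimes> k \<otimes> inv (k \<otimes> n) = n \<otimes> (k \<otimes> inv n \<otimes> inv k)"
      using nc kc by (simp add: inv_mult_group m_assoc)
    also have "\<dots> \<in> N" using n kc N.inv_op_closed2 by simp
    finally show ?thesis using nc kc N.subgroup_axioms by (simp add: subgroup_r_coset_eq_iff)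
  qed
  then show "n \<in> centralizer_mod N K" using nc by (simp add: centralizer_mod_def)
qed

end

context finite_group
begin

lemma card_r_coset_image:
  assumes "N \<lhd> G" "subgroup Q G" "N \<subseteq> Q"
  shows "card ((\<lambda>x. N #> x) ` Q) * card N = card Q"
proof -
  interpret Q: group "G\<lparr>carrier := Q\<rparr>" using assms subgroup_imp_group by blast
  have "subgroup N (G\<lparr>carrier := Q\<rparr>)"
    using assms normal_imp_subgroup subgroup_incl by blast
  moreover have "rcosets\<^bsub>G\<lparr>carrier := Q\<rparr>\<^esub> N = (\<lambda>x. N #> x) ` Q"
    by (auto simp: RCOSETS_def r_coset_def)
  ultimately show ?thesis using Q.lagrange[of N] by (simp add: Coset.order_def)
qed

text \<open>A normal subgroup \<open>Q\<close> that acts on a \<open>p\<close>-chief factor \<open>K / N\<close> as a \<open>p\<close>-group acts trivially: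
  the number of fixed points is divisible by \<open>p\<close>, so they form a nontrivial subgroup of \<open>K / N\<close>,
  which is normal in \<open>G\<close> and must be everything. For \<open>Q = K\<close> this says that a \<open>p\<close>-chief factor is
  abelian.\<close>

lemma p_chief_factor_centralized:
  assumes NK: "chief_factor G N K" and Q: "Q \<lhd> G" "N \<subseteq> Q" and p: "prime (p::nat)"
    and cQ: "card Q = card N * p ^ m" and cK: "card K = card N * p ^ a"
  shows "Q \<subseteq> centralizer_mod N K"
proof -
  note c = chief_factorD[OF NK]
  interpret \<pi>: group_hom G "G Mod N" "\<lambda>x. N #> x" using group_hom_r_coset[OF c(1)] .
  define \<pi> where "\<pi> x = N #> x" for x
  have sQ: "subgroup Q G" using Q normal_imp_subgroup by blast
  have Qc: "\<And>x. x \<in> Q \<Longrightarrow> x \<in> carrier G" and Kc: "\<And>x. x \<in> K \<Longrightarrow> x \<in> carrier G"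
    using subgroup.mem_carrier[OF sQ] subgroup.mem_carrier[OF c(6)] by auto
  have Nc: "N \<subseteq> carrier G" using c(5) subgroup.subset by blast
  have cN: "card N > 0" using c(5) card_subgroup_pos by blast
  have \<pi>m: "\<pi> (x \<otimes> y) = \<pi> x \<otimes>\<^bsub>G Mod N\<^esub> \<pi> y" if "x \<in> carrier G" "y \<in> carrier G" for x y
    using \<pi>.hom_mult[OF that] by (simp add: \<pi>_def)
  have \<pi>i: "inv\<^bsub>G Mod N\<^esub> \<pi> x = \<pi> (inv x)" if "x \<in> carrier G" for x
    using \<pi>.hom_inv[OF that] by (simp add: \<pi>_def)
  have \<pi>c: "\<pi> x \<in> carrier (G Mod N)" if "x \<in> carrier G" for x
    using \<pi>.hom_closed[OF that] by (simp add: \<pi>_def)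
  define P where "P = (G Mod N)\<lparr>carrier := \<pi> ` Q\<rparr>"
  define \<phi> where "\<phi> g = (\<lambda>x\<in>\<pi> ` K. g \<otimes>\<^bsub>G Mod N\<^esub> x \<otimes>\<^bsub>G Mod N\<^esub> inv\<^bsub>G Mod N\<^esub> g)" for g
  have sub: "subgroup (\<pi> ` Q) (G Mod N)"
    using \<pi>.subgroup_img_is_subgroup[OF sQ] by (simp add: \<pi>_def)
  have \<phi>: "\<phi> (\<pi> q) (\<pi> k) = \<pi> (q \<otimes> k \<otimes> inv q)" if "q \<in> carrier G" "k \<in> K" for q k
    using that Kc by (simp add: \<phi>_def \<pi>m \<pi>i)
  interpret A: group_action P "\<pi> ` K" \<phi>
  proof (rule group_actionI)
    show "group P" unfolding P_def using \<pi>.H.subgroup_imp_group[OF sub] .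
    show "\<phi> g x \<in> \<pi> ` K" if "g \<in> carrier P" "x \<in> \<pi> ` K" for g x
      using that \<phi> Qc normal_invE(2)[OF c(2)] by (auto simp: P_def)
    show "\<phi> g \<in> extensional (\<pi> ` K)" for g by (simp add: \<phi>_def)
    show "\<phi> \<one>\<^bsub>P\<^esub> x = x" if "x \<in> \<pi> ` K" for x
    proof -
      have "\<one>\<^bsub>P\<^esub> = \<pi> \<one>" using Nc by (simp add: P_def \<pi>_def)
      then show ?thesis using that \<phi>[OF one_closed] Kc by auto
    qed
    show "\<phi> (g \<otimes>\<^bsub>P\<^esub> h) x = \<phi> g (\<phi> h x)"
      if gh: "g \<in> carrier P" "h \<in> carrier P" "x \<in> \<pi> ` K" for g h x
    proof -
      obtain a b k where abk: "a \<in> Q" "g = \<pi> a" "b \<in> Q" "h = \<pi> b" "k \<in> K" "x = \<pi> k"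
        using gh by (auto simp: P_def)
      have "g \<otimes>\<^bsub>P\<^esub> h = \<pi> (a \<otimes> b)" using abk Qc by (simp add: P_def \<pi>m)
      moreover have "b \<otimes> k \<otimes> inv b \<in> K" using normal_invE(2)[OF c(2)] abk Qc by simp
      ultimately show ?thesis
        using abk Qc Kc by (simp add: \<phi> inv_mult_group m_assoc)
    qed
  qed
  define F where "F = {x \<in> \<pi> ` K. \<forall>g\<in>carrier P. \<phi> g x = x}"
  have "card (\<pi> ` Q) * card N = card Q" "card (\<pi> ` K) * card N = card K"
    using card_r_coset_image[OF c(1) sQ Q(2)] card_r_coset_image[OF c(1) c(6) c(3)]
    by (simp_all add: \<pi>_def)
  then have cards: "card (\<pi> ` Q) = p ^ m" "card (\<pi> ` K) = p ^ a"
    using cQ cK cN by auto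
  have "a \<noteq> 0"
  proof
    assume "a = 0"
    then have "card K \<le> card N" using cK by simp
    then show False using subgroup_eqI_card[OF c(6,3)] c(4) by blast
  qed
  then have "p dvd card (\<pi> ` K)" using cards by simp
  moreover have "Coset.order P = p ^ m" using cards by (simp add: P_def Coset.order_def)
  moreover have "finite (\<pi> ` K)" using finite_subgroup[OF c(6)] by blast
  ultimately have dv: "p dvd card F"
    using A.p_group_fixed_points[OF p] unfolding F_def by blast
  have fixed_iff: "\<pi> k \<in> F \<longleftrightarrow> k \<in> centralizer_mod N Q" if k: "k \<in> K" for k
  proof -
    have "\<pi> (q \<otimes> k \<otimes> inv q) = \<pi> k \<longleftrightarrow> \<pi> (k \<otimes> q) = \<pi> (q \<otimes> k)" if q: "q \<in> Q" for q
    proof -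
      have qc: "q \<in> carrier G" "k \<in> carrier G" using q k Qc Kc by auto
      have "\<pi> (q \<otimes> k \<otimes> inv q) = \<pi> k \<longleftrightarrow> q \<otimes> k \<otimes> inv q \<otimes> inv k \<in> N"
        unfolding \<pi>_def by (rule subgroup_r_coset_eq_iff[OF c(5)]) (use qc in auto)
      also have "q \<otimes> k \<otimes> inv q \<otimes> inv k = q \<otimes> k \<otimes> inv (k \<otimes> q)"
        using qc by (simp add: inv_mult_group m_assoc)
      also have "\<dots> \<in> N \<longleftrightarrow> \<pi> (q \<otimes> k) = \<pi> (k \<otimes> q)"
        unfolding \<pi>_def by (rule subgroup_r_coset_eq_iff[OF c(5), symmetric]) (use qc in auto)
      finally show ?thesis by auto
    qed
    then show ?thesis
      using k Kc[OF k] Qc by (auto simp: F_def P_def \<phi> centralizer_mod_def \<pi>_def[symmetric])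
  qed
  define A where "A = K \<inter> centralizer_mod N Q"
  have An: "A \<lhd> G"
    unfolding A_def using c(2) centralizer_mod_normal[OF c(1) Q(1)] normal_subgroup_intersect by blast
  have NA: "N \<subseteq> A"
    unfolding A_def using c(3) subset_centralizer_mod[OF c(1)] Qc by blast
  have "A \<noteq> N"
  proof
    assume AN: "A = N"
    have "F \<subseteq> {N}"
    proof
      fix x assume x: "x \<in> F"
      then obtain k where k: "k \<in> K" "x = \<pi> k" by (auto simp: F_def)
      then have "k \<in> N" using x fixed_iff AN A_def by blast
      then show "x \<in> {N}" using k c(5) by (simp add: \<pi>_def subgroup.rcos_const)
    qed
    moreover have "\<pi> \<one> \<in> F"
      using fixed_iff[OF subgroup.one_closed[OF c(6)]] NA subgroup.one_closed[OF c(5)]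
      by (auto simp: A_def)
    ultimately have "F = {N}" by blast
    then show False using dv p by simp
  qed
  then have "A = K" using c(7)[OF An NA] A_def by blast
  then have KQ: "K \<subseteq> centralizer_mod N Q" by (auto simp: A_def)
  then show ?thesis using Qc by (force simp: centralizer_mod_def)
qed

text \<open>By the Jordan-Hoelder argument a chief factor is a section of some factor of the given normal
  series: take the first term \<open>S\<^sub>i\<close> of the series with \<open>S\<^sub>i \<inter> K\<close> not inside \<open>N\<close>. Only the divisibility of
  orders that results from this is proved.\<close>

lemma p_solvable_chief_factor:
  assumes NK: "chief_factor G N K" and ps: "p_solvable G p" and p: "prime p"
    and dv: "card K = card N * r" "p dvd r"
  obtains m where "r = p ^ m"
proof -
  note c = chief_factorD[OF NK]
  obtain S l where S: "S 0 = {\<one>}" "S l = carrier G" "\<And>i. i \<le> l \<Longrightarrow> S i \<lhd> G"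
    "\<And>i. i < l \<Longrightarrow> S i \<subseteq> S (Suc i)"
    "\<And>i. i < l \<Longrightarrow> (\<exists>k. Coset.order (G\<lparr>carrier := S (Suc i)\<rparr> Mod S i) = p ^ k) \<or>
         coprime p (Coset.order (G\<lparr>carrier := S (Suc i)\<rparr> Mod S i))"
    using ps unfolding p_solvable_def by blast
  define i where "i = (LEAST i. \<not> S i \<inter> K \<subseteq> N)"
  have Kc: "K \<subseteq> carrier G" using c(6) subgroup.subset by blast
  have l: "\<not> S l \<inter> K \<subseteq> N" using S(2) Kc c(3,4) by auto
  have i1: "\<not> S i \<inter> K \<subseteq> N" unfolding i_def using l by (rule LeastI)
  have il: "i \<le> l" unfolding i_def using l by (rule Least_le)
  have "i \<noteq> 0" using i1 S(1) subgroup.one_closed[OF c(5)] by auto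
  then obtain j where j: "i = Suc j" using not0_implies_Suc by blast
  have j1: "S j \<inter> K \<subseteq> N"
    using not_less_Least[of j "\<lambda>i. \<not> S i \<inter> K \<subseteq> N"] j i_def by auto
  have jl: "j < l" using il j by simp
  define T where "T = S j"
  define R where "R = S i"
  have nT: "T \<lhd> G" and nR: "R \<lhd> G" using S(3)[of j] S(3)[of i] il jl by (simp_all add: T_def R_def)
  have sT: "subgroup T G" and sR: "subgroup R G" using nT nR normal_imp_subgroup by auto
  have TR: "T \<subseteq> R" using S(4)[OF jl] j by (simp add: T_def R_def)
  define q where "q = Coset.order (G\<lparr>carrier := R\<rparr> Mod T)"
  have q: "card R = card T * q"
  proof -
    have "card ((\<lambda>x. T #> x) ` R) * card T = card R" by (rule card_r_coset_image[OF nT sR TR])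
    moreover have "q = card ((\<lambda>x. T #> x) ` R)"
      unfolding q_def Coset.order_def carrier_FactGroup by simp
    ultimately show ?thesis by (simp add: mult.commute)
  qed
  \<comment> \<open>minimality of \<open>i\<close> makes \<open>K / N\<close> a quotient of \<open>A\<close> in which \<open>A \<inter> T\<close> dies\<close>
  define A where "A = R \<inter> K"
  have nA: "A \<lhd> G" unfolding A_def using nR c(2) normal_subgroup_intersect by blast
  have sA: "subgroup A G" using nA normal_imp_subgroup by blast
  have AN: "A <#> N = K"
  proof -
    have "N \<subseteq> A <#> N" using set_mult_subset_right[OF sA] subgroup.subset[OF c(5)] by blast
    moreover have "A \<subseteq> A <#> N" using set_mult_subset_left[OF subgroup.subset[OF sA] c(5)] .
    moreover have "\<not> A \<subseteq> N" using i1 by (simp add: A_def R_def)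
    moreover have "A <#> N \<subseteq> K" using set_mult_subset_subgroup[OF c(6)] c(3) by (simp add: A_def)
    ultimately show ?thesis using c(7)[OF normal_set_mult[OF nA c(1)]] by blast
  qed
  have fin: "finite A" "finite N" "finite T" "finite R"
    using finite_subgroup sA c(5) sT sR by auto
  have e1: "card K * card (A \<inter> N) = card A * card N"
    using card_set_mult[OF sA c(5)] fin AN by simp
  have AT: "A \<inter> T = N \<inter> T \<inter> A" using j1 TR by (auto simp: A_def T_def)
  have e2: "card (A <#> T) * card (A \<inter> T) = card A * card T"
    using card_set_mult[OF sA sT] fin by simp
  have sAT: "subgroup (A <#> T) G" using mult_norm_subgroup[OF nA sT] .
  have d1: "card (A <#> T) dvd card R"
    by (rule card_subgroup_dvd[OF sAT sR set_mult_subset_subgroup[OF sR]]) (use TR in \<open>auto simp: A_def\<close>)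
  have sAN: "subgroup (A \<inter> N) G" "subgroup (A \<inter> T) G"
    using subgroups_Inter_pair sA c(5) sT by auto
  have d2: "card (A \<inter> T) dvd card (A \<inter> N)"
    by (rule card_subgroup_dvd) (use sAN AT in auto)
  have pos: "card N > 0" "card (A \<inter> T) > 0" "card T > 0" "card (A \<inter> N) > 0"
    using card_subgroup_pos c(5) sAN sT by auto
  obtain t where t: "card R = card (A <#> T) * t" using d1 by blast
  obtain s where s: "card (A \<inter> N) = card (A \<inter> T) * s" using d2 by blast
  have a: "card A = r * card (A \<inter> N)" using e1 dv(1) pos by simp
  have "card (A \<inter> T) * (card T * q) = card (A <#> T) * card (A \<inter> T) * t"
    using t q by simp
  also have "\<dots> = r * (card (A \<inter> T) * s) * card T * t" using e2 a s by simp
  finally have "(card (A \<inter> T) * card T) * q = (card (A \<inter> T) * card T) * (r * s * t)"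
    by (simp add: ac_simps)
  then have rq: "r dvd q" using pos by simp
  then have "p dvd q" using dv(2) dvd_trans by blast
  have "(\<exists>k. q = p ^ k) \<or> coprime p q"
    using S(5)[OF jl] j by (simp add: q_def T_def R_def)
  then obtain k where "q = p ^ k"
    using \<open>p dvd q\<close> p by (metis coprime_absorb_left not_prime_unit)
  then show thesis using rq p that divides_primepow_nat by metis
qed

end


section \<open>Chief factors not contained in a maximal subgroup\<close>

text \<open>The maximal subgroups for which the module \<open>X\<close> is an elementary abelian \<open>p\<close>-group for some prime
  \<open>p\<close>. All maximal subgroups in the two families of the theorem are of this kind.\<close>

definition p_solvable_maximal :: "('a, 'b) monoid_scheme \<Rightarrow> 'a set \<Rightarrow> bool"
  where "p_solvable_maximal G M \<longleftrightarrow> maximal_subgroup G M \<and>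
    (\<exists>p. prime p \<and> p dvd index G M \<and> p_solvable G p)"

context group
begin

text \<open>Most normality proofs below check invariance separately under a chief factor and under a maximal
  subgroup that supplements it.\<close>

lemma normal_of_supplement:
  assumes H: "subgroup H G" and AB: "A <#> B = carrier G" "A \<subseteq> carrier G" "B \<subseteq> carrier G"
    and A: "\<And>x h. x \<in> A \<Longrightarrow> h \<in> H \<Longrightarrow> x \<otimes> h \<otimes> inv x \<in> H"
    and B: "\<And>x h. x \<in> B \<Longrightarrow> h \<in> H \<Longrightarrow> x \<otimes> h \<otimes> inv x \<in> H"
  shows "H \<lhd> G"
proof (rule normal_invI[OF H])
  fix x h assume "x \<in> carrier G" and h: "h \<in> H"
  then have "x \<in> A <#> B" using AB(1) by simp
  then obtain a b where ab: "a \<in> A" "b \<in> B" "x = a \<otimes> b"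
    by (auto simp: set_mult_def)
  have c: "a \<in> carrier G" "b \<in> carrier G" "h \<in> carrier G"
    using ab AB h subgroup.mem_carrier[OF H] by auto
  have "a \<otimes> (b \<otimes> h \<otimes> inv b) \<otimes> inv a \<in> H" using A B ab h by blast
  also have "a \<otimes> (b \<otimes> h \<otimes> inv b) \<otimes> inv a = x \<otimes> h \<otimes> inv x"
    using c ab by (simp add: inv_mult_group m_assoc)
  finally show "x \<otimes> h \<otimes> inv x \<in> H" .
qed

lemma centralizer_mod_commutator:
  assumes N: "subgroup N G" and "K \<subseteq> carrier G" "g \<in> centralizer_mod N K" "k \<in> K"
  shows "g \<otimes> k \<otimes> inv g \<otimes> inv k \<in> N" "k \<otimes> g \<otimes> inv k \<otimes> inv g \<in> N"
proof -
  have c: "g \<in> carrier G" "k \<in> carrier G" "N #> (g \<otimes> k) = N #> (k \<otimes> g)"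
    using assms by (auto simp: centralizer_mod_def)
  have "(g \<otimes> k) \<otimes> inv (k \<otimes> g) \<in> N" "(k \<otimes> g) \<otimes> inv (g \<otimes> k) \<in> N"
    using c subgroup_r_coset_eq_iff[OF N, of "g \<otimes> k" "k \<otimes> g"]
      subgroup_r_coset_eq_iff[OF N, of "k \<otimes> g" "g \<otimes> k"] by simp_all
  then show "g \<otimes> k \<otimes> inv g \<otimes> inv k \<in> N" "k \<otimes> g \<otimes> inv k \<otimes> inv g \<in> N"
    using c(1,2) by (simp_all add: inv_mult_group m_assoc)
qed

lemma centralizer_modI:
  assumes N: "subgroup N G" and "K \<subseteq> carrier G" "g \<in> carrier G"
    and "\<And>k. k \<in> K \<Longrightarrow> g \<otimes> k \<otimes> inv g \<otimes> inv k \<in> N"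
  shows "g \<in> centralizer_mod N K"
proof -
  have "N #> (g \<otimes> k) = N #> (k \<otimes> g)" if k: "k \<in> K" for k
  proof -
    have kc: "k \<in> carrier G" using k assms by auto
    have "(g \<otimes> k) \<otimes> inv (k \<otimes> g) \<in> N"
      using assms(4)[OF k] kc assms(3) by (simp add: inv_mult_group m_assoc)
    then show ?thesis using subgroup_r_coset_eq_iff[OF N] kc assms(3) by simp
  qed
  then show ?thesis using assms(3) by (simp add: centralizer_mod_def)
qed

lemma conj_mem_of_commutator:
  assumes M: "subgroup M G" and x: "x \<in> carrier G" and h: "h \<in> M"
    and c: "x \<otimes> h \<otimes> inv x \<otimes> inv h \<in> M"
  shows "x \<otimes> h \<otimes> inv x \<in> M"
proof -
  have hc: "h \<in> carrier G" using subgroup.mem_carrier[OF M h] .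
  have "x \<otimes> h \<otimes> inv x \<otimes> inv h \<otimes> h \<in> M" using subgroup.m_closed[OF M c h] .
  then show ?thesis using x hc by (simp add: m_assoc)
qed

end

text \<open>The situation at a single step of the climb along a chief series: \<open>M\<close> contains \<open>N\<close> but not \<open>K\<close>,
  hence supplements the chief factor \<open>K / N\<close>. Below, \<open>C\<close> is the centralizer of \<open>K / N\<close> and \<open>L\<close> the
  core of \<open>M\<close>. The results describe the position of \<open>K\<close>, \<open>C\<close>, \<open>L\<close> and \<open>M\<close>: one has \<open>C = K L\<close>, and
  \<open>C / L\<close> is a chief factor complemented by \<open>M\<close> and isomorphic to \<open>K / N\<close>.\<close>

locale chief_supplement = finite_group +
  fixes M N K
  assumes M: "p_solvable_maximal G M" and NK: "chief_factor G N K"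
    and NM: "N \<subseteq> M" and KM: "\<not> K \<subseteq> M"
begin

lemma max: "maximal_subgroup G M" using M by (simp add: p_solvable_maximal_def)

lemmas M_props = maximal_subgroupD[OF max]
lemmas chief_props = chief_factorD[OF NK]

lemma K_carrier: "K \<subseteq> carrier G" and N_carrier: "N \<subseteq> carrier G"
  using chief_props(5,6) subgroup.subset by blast+

lemma K_mult_M: "K <#> M = carrier G" "M <#> K = carrier G"
  using maximal_normal_supplement[OF max chief_props(2) KM] by auto

text \<open>The index of \<open>M\<close> equals the index of \<open>K \<inter> M\<close> in \<open>K\<close>, which divides the order of \<open>K / N\<close>.\<close>

lemma chief_factor_p_power:
  obtains p m where "prime p" "p_solvable G p" "m > 0" "card K = card N * p ^ m"
proof -
  obtain p where p: "prime p" "p dvd index G M" "p_solvable G p"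
    using M by (auto simp: p_solvable_maximal_def)
  have sKM: "subgroup (K \<inter> M) G" using subgroups_Inter_pair chief_props(6) M_props(1) by blast
  obtain r where r: "card K = card N * r"
    using card_subgroup_dvd[OF chief_props(5,6,3)] by blast
  obtain s where s: "card (K \<inter> M) = card N * s"
    using card_subgroup_dvd[OF chief_props(5) sKM] chief_props(3) NM by blast
  have "card (carrier G) * card (K \<inter> M) = card K * card M"
    using card_set_mult[OF chief_props(6) M_props(1)] finite_subgroup chief_props(6) M_props(1) K_mult_M
    by simp
  then have "index G M * card M * (card N * s) = card N * r * card M"
    using index_mult_card[OF M_props(1)] s r by simp
  then have "(card M * card N) * (index G M * s) = (card M * card N) * r"
    by (simp add: ac_simps)
  then have "index G M * s = r"
    using card_subgroup_pos[OF M_props(1)] card_subgroup_pos[OF chief_props(5)] by simp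
  then have "p dvd r" using p(2) by auto
  then obtain m where m: "r = p ^ m"
    using p_solvable_chief_factor[OF NK p(3,1) r] by blast
  have "m > 0" using \<open>p dvd r\<close> m p(1) by (cases m) auto
  then show thesis using that p r m by blast
qed

lemma K_abelian: "K \<subseteq> centralizer_mod N K"
proof -
  obtain p m where "prime p" "card K = card N * p ^ m" using chief_factor_p_power by blast
  then show ?thesis
    using p_chief_factor_centralized[OF NK chief_props(2,3)] by blast
qed

text \<open>As \<open>K / N\<close> is abelian, \<open>K\<close> normalizes \<open>K \<inter> M\<close>; so does \<open>M\<close>. Thus \<open>K \<inter> M\<close> is normal in \<open>G = K M\<close>.\<close>

lemma K_Int_M: "K \<inter> M = N"
proof -
  have sKM: "subgroup (K \<inter> M) G" using subgroups_Inter_pair chief_props(6) M_props(1) by blast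
  have "K \<inter> M \<lhd> G"
  proof (rule normal_of_supplement[OF sKM K_mult_M(1) K_carrier M_props(2)])
    fix x h assume x: "x \<in> K" and h: "h \<in> K \<inter> M"
    have "x \<otimes> h \<otimes> inv x \<otimes> inv h \<in> N"
      using centralizer_mod_commutator(1)[OF chief_props(5) K_carrier] x h K_abelian by blast
    then show "x \<otimes> h \<otimes> inv x \<in> K \<inter> M"
      using conj_mem_of_commutator[OF sKM _ h] x K_carrier NM chief_props(3) by blast
  next
    fix x h assume x: "x \<in> M" and h: "h \<in> K \<inter> M"
    have "x \<otimes> h \<otimes> inv x \<in> M"
      using x h M_props(1) by (auto intro!: subgroup.m_closed subgroup.m_inv_closed)
    then show "x \<otimes> h \<otimes> inv x \<in> K \<inter> M"
      using x h M_props(2) normal_invE(2)[OF chief_props(2)] by blast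
  qed
  then show ?thesis using chief_props(7)[of "K \<inter> M"] chief_props(3) NM KM by blast
qed

definition C where "C = centralizer_mod N K"
definition L where "L = core G M"

lemma L_normal: "L \<lhd> G" and L_subset: "L \<subseteq> M" and N_subset_L: "N \<subseteq> L"
  using core_normal[OF M_props(1)] core_subset[OF M_props(2)]
    normal_subset_core[OF M_props(2) chief_props(1) NM] by (simp_all add: L_def)

lemma C_normal: "C \<lhd> G"
  using centralizer_mod_normal[OF chief_props(1,2)] by (simp add: C_def)

lemma C_carrier: "C \<subseteq> carrier G" by (auto simp: C_def centralizer_mod_def)

lemma K_subset_C: "K \<subseteq> C" using K_abelian by (simp add: C_def)

lemma K_Int_L: "K \<inter> L = N"
  using K_Int_M L_subset N_subset_L chief_props(3) by blast

text \<open>The commutators of \<open>L\<close> and \<open>K\<close> lie in \<open>K \<inter> L = N\<close>.\<close>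

lemma L_subset_C: "L \<subseteq> C"
proof
  fix l assume l: "l \<in> L"
  have lc: "l \<in> carrier G" using l L_subset M_props(2) by blast
  show "l \<in> C" unfolding C_def
  proof (rule centralizer_modI[OF chief_props(5) K_carrier lc])
    fix k assume k: "k \<in> K"
    have kc: "k \<in> carrier G" using k K_carrier by blast
    have ik: "inv k \<in> K" "inv l \<in> L"
      using k l chief_props(6) normal_imp_subgroup[OF L_normal] by (auto intro: subgroup.m_inv_closed)
    have "l \<otimes> k \<otimes> inv l \<in> K" using normal_invE(2)[OF chief_props(2) lc k] .
    then have "l \<otimes> k \<otimes> inv l \<otimes> inv k \<in> K" using ik chief_props(6) by (auto intro: subgroup.m_closed)
    moreover have "k \<otimes> inv l \<otimes> inv k \<in> L" using normal_invE(2)[OF L_normal kc ik(2)] .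
    then have "l \<otimes> (k \<otimes> inv l \<otimes> inv k) \<in> L"
      using l normal_imp_subgroup[OF L_normal] by (auto intro: subgroup.m_closed)
    then have "l \<otimes> k \<otimes> inv l \<otimes> inv k \<in> L" using lc kc by (simp add: m_assoc)
    ultimately show "l \<otimes> k \<otimes> inv l \<otimes> inv k \<in> N" using K_Int_L by blast
  qed
qed

text \<open>Elements of \<open>K\<close> normalize \<open>C \<inter> M\<close> because they commute with it modulo \<open>N\<close>, so \<open>C \<inter> M\<close> is normal
  in \<open>G = K M\<close> and lies in the core.\<close>

lemma C_Int_M: "C \<inter> M = L"
proof
  have sC: "subgroup C G" using C_normal normal_imp_subgroup by blast
  have sCM: "subgroup (C \<inter> M) G" using subgroups_Inter_pair[OF sC M_props(1)] .
  have "C \<inter> M \<lhd> G"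
  proof (rule normal_of_supplement[OF sCM K_mult_M(1) K_carrier M_props(2)])
    fix x h assume x: "x \<in> K" and h: "h \<in> C \<inter> M"
    have "x \<otimes> h \<otimes> inv x \<otimes> inv h \<in> N"
      using centralizer_mod_commutator(2)[OF chief_props(5) K_carrier] x h C_def by blast
    then show "x \<otimes> h \<otimes> inv x \<in> C \<inter> M"
      using conj_mem_of_commutator[OF sCM _ h] x K_carrier K_subset_C NM chief_props(3) by blast
  next
    fix x h assume x: "x \<in> M" and h: "h \<in> C \<inter> M"
    have "x \<otimes> h \<otimes> inv x \<in> M"
      using x h M_props(1) by (auto intro!: subgroup.m_closed subgroup.m_inv_closed)
    then show "x \<otimes> h \<otimes> inv x \<in> C \<inter> M"
      using x h M_props(2) normal_invE(2)[OF C_normal] by blast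
  qed
  then show "C \<inter> M \<subseteq> L" using normal_subset_core[OF M_props(2)] by (simp add: L_def)
  show "L \<subseteq> C \<inter> M" using L_subset L_subset_C by blast
qed

lemma C_eq: "C = K <#> L" "C = L <#> K"
proof -
  have "(K <#> M) \<inter> C = K <#> (M \<inter> C)"
    using dedekind_modular_law[OF normal_imp_subgroup[OF C_normal] K_subset_C M_props(2)] .
  moreover have "(K <#> M) \<inter> C = C" by (simp only: K_mult_M(1) Int_absorb1[OF C_carrier])
  moreover have "M \<inter> C = L" using C_Int_M by blast
  ultimately show "C = K <#> L" by simp
  then show "C = L <#> K" by (rule trans) (rule commut_normal[OF chief_props(6) L_normal])
qed

text \<open>A normal subgroup \<open>H\<close> between \<open>L\<close> and \<open>C = L K\<close> is determined by \<open>H \<inter> K\<close>.\<close>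

lemma chief_factor_L_C: "chief_factor G L C"
  unfolding chief_factor_def
proof (intro conjI allI impI)
  have "L \<noteq> C" using K_subset_C KM L_subset by blast
  then show "L \<subset> C" using L_subset_C by blast
  fix H assume H: "H \<lhd> G \<and> L \<subseteq> H \<and> H \<subseteq> C"
  have H1: "H \<lhd> G" "L \<subseteq> H" "H \<subseteq> C" using H by auto
  have "H = C \<inter> H" using H1(3) by blast
  also have "C \<inter> H = (L <#> K) \<inter> H" by (simp only: C_eq(2))
  also have "\<dots> = L <#> (K \<inter> H)"
    by (rule dedekind_modular_law[OF normal_imp_subgroup[OF H1(1)] H1(2) K_carrier])
  finally have HK: "H = L <#> (K \<inter> H)" .
  have "K \<inter> H \<lhd> G" by (rule normal_subgroup_intersect[OF chief_props(2) H1(1)])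
  moreover have "N \<subseteq> K \<inter> H" using N_subset_L H1(2) chief_props(3) by blast
  ultimately have "K \<inter> H = N \<or> K \<inter> H = K"
    by (rule chief_props(7)[OF _ _ Int_lower1])
  moreover have "L <#> N = L"
    using set_mult_absorb(2)[OF normal_imp_subgroup[OF L_normal] N_subset_L]
      subgroup.one_closed[OF chief_props(5)] by simp
  ultimately show "H = L \<or> H = C" using HK C_eq(2) by metis
qed (use L_normal C_normal in auto)

end


section \<open>Conjugacy of maximal subgroups with the same core\<close>

lemma (in comm_group) endomorphism_finprod:
  assumes "f \<in> hom G G" "g \<in> A \<rightarrow> carrier G" "finite A"
  shows "f (finprod G g A) = finprod G (\<lambda>x. f (g x)) A"
  using assms(3,2)
proof (induction A rule: finite_induct)
  case empty
  then show ?case using hom_one[OF assms(1)] is_group by simp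
next
  case (insert x F)
  have f: "f y \<in> carrier G" if "y \<in> carrier G" for y using hom_in_carrier[OF assms(1) that] .
  have "f (finprod G g (insert x F)) = f (g x \<otimes> finprod G g F)"
    using insert by (simp add: Pi_iff)
  also have "\<dots> = f (g x) \<otimes> f (finprod G g F)"
    using insert by (intro hom_mult[OF assms(1)]) (auto simp: Pi_iff)
  also have "\<dots> = finprod G (\<lambda>x. f (g x)) (insert x F)"
    using insert f by (simp add: Pi_iff)
  finally show ?case .
qed

text \<open>The conjugacy part of the Schur-Zassenhaus theorem for an abelian normal subgroup. Write \<open>c g\<close> for
  the \<open>K\<close>-component of \<open>g\<close> in \<open>G = M K\<close>. This is a cocycle, and multiplying the cocycle identity
  over all \<open>s \<in> S\<close> shows that its restriction to \<open>S\<close> becomes a coboundary once a \<open>card S\<close>-th root can be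
  taken in \<open>K\<close>; coprimality allows that.\<close>

lemma (in group) coprime_subgroup_in_conjugate_complement:
  assumes K: "K \<lhd> G" and ab: "\<And>x y. x \<in> K \<Longrightarrow> y \<in> K \<Longrightarrow> x \<otimes> y = y \<otimes> x" and finK: "finite K"
    and M: "subgroup M G" and KM: "K \<inter> M = {\<one>}" and MK: "M <#> K = carrier G"
    and S: "subgroup S G" and finS: "finite S" and cop: "coprime (card S) (card K)"
  shows "\<exists>d\<in>K. \<forall>s\<in>S. d \<otimes> s \<otimes> inv d \<in> M"
proof -
  have sK: "subgroup K G" using K normal_imp_subgroup by blast
  note Kc = subgroup.mem_carrier[OF sK] and Mc = subgroup.mem_carrier[OF M] and Sc = subgroup.mem_carrier[OF S]
  define A where "A = G\<lparr>carrier := K\<rparr>"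
  have cA [simp]: "carrier A = K" "monoid.mult A = monoid.mult G" by (simp_all add: A_def)
  interpret A: comm_group A
    by (rule group.group_comm_groupI) (use subgroup_imp_group[OF sK] ab in \<open>auto simp: A_def\<close>)
  define c where "c g = (THE k. k \<in> K \<and> g \<otimes> inv k \<in> M)" for g
  have c_unique: "k = k'" if g: "g \<in> carrier G" and k: "k \<in> K" "g \<otimes> inv k \<in> M" and k': "k' \<in> K" "g \<otimes> inv k' \<in> M"
    for g k k'
  proof -
    have "inv (g \<otimes> inv k) \<otimes> (g \<otimes> inv k') \<in> M"
      by (rule subgroup.m_closed[OF M subgroup.m_inv_closed[OF M k(2)] k'(2)])
    also have "inv (g \<otimes> inv k) \<otimes> (g \<otimes> inv k') = k \<otimes> inv k'"
      using g Kc[OF k(1)] Kc[OF k'(1)] by (simp add: inv_mult_group m_assoc)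
    finally have "k \<otimes> inv k' \<in> K \<inter> M"
      using k k' sK by (simp add: subgroup.m_closed subgroup.m_inv_closed)
    then have "k \<otimes> inv k' = \<one>" using KM by simp
    then show ?thesis using Kc[OF k(1)] Kc[OF k'(1)] inv_equality[of k "inv k'"] by simp
  qed
  have c: "c g \<in> K \<and> g \<otimes> inv (c g) \<in> M" if g: "g \<in> carrier G" for g
  proof -
    have "g \<in> M <#> K" using g MK by simp
    then obtain m k where mk: "m \<in> M" "k \<in> K" "g = m \<otimes> k" by (auto simp: set_mult_def)
    have "g \<otimes> inv k = m" using mk Mc[OF mk(1)] Kc[OF mk(2)] by (simp add: m_assoc)
    then have "k \<in> K \<and> g \<otimes> inv k \<in> M" using mk by simp
    then show ?thesis unfolding c_def by (rule theI) (use c_unique[OF g] \<open>k \<in> K \<and> g \<otimes> inv k \<in> M\<close> in blast)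
  qed
  have conjK: "inv t \<otimes> k \<otimes> t \<in> K" if "t \<in> carrier G" "k \<in> K" for t k
    using normal.inv_op_closed1[OF K that] .
  have cocycle: "c (s \<otimes> t) = (inv t \<otimes> c s \<otimes> t) \<otimes> c t" if s: "s \<in> carrier G" and t: "t \<in> carrier G" for s t
  proof (rule c_unique[of "s \<otimes> t"])
    have cs: "c s \<in> K" "c t \<in> K" using c s t by auto
    have k: "inv t \<otimes> c s \<otimes> t \<in> K" using conjK t cs by simp
    show "(inv t \<otimes> c s \<otimes> t) \<otimes> c t \<in> K" using k cs sK by (simp add: subgroup.m_closed)
    have "inv ((inv t \<otimes> c s \<otimes> t) \<otimes> c t) = inv (c t \<otimes> (inv t \<otimes> c s \<otimes> t))"
      using ab[OF k cs(2)] by simp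
    also have "\<dots> = inv t \<otimes> inv (c s) \<otimes> t \<otimes> inv (c t)"
      using Kc[OF cs(1)] Kc[OF cs(2)] t by (simp add: inv_mult_group m_assoc)
    finally have "s \<otimes> t \<otimes> inv ((inv t \<otimes> c s \<otimes> t) \<otimes> c t) = (s \<otimes> inv (c s)) \<otimes> (t \<otimes> inv (c t))"
      using Kc[OF cs(1)] Kc[OF cs(2)] s t by (simp add: m_assoc)
    then show "s \<otimes> t \<otimes> inv ((inv t \<otimes> c s \<otimes> t) \<otimes> c t) \<in> M"
      using c s t subgroup.m_closed[OF M] by simp
  qed (use c s t in auto)
  \<comment> \<open>taking powers with exponent \<open>u\<close> inverts taking powers with exponent \<open>card S\<close> in \<open>K\<close>\<close>
  obtain u v where uv: "card S * u = card K * v + 1"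
  proof -
    have "card S \<noteq> 0" using finS subgroup.one_closed[OF S] by auto
    then show thesis using bezout_nat[of "card S" "card K"] cop that by auto
  qed
  have pow1: "x [^]\<^bsub>A\<^esub> (card S * u) = x" if x: "x \<in> K" for x
  proof -
    have "x [^]\<^bsub>A\<^esub> card K = \<one>\<^bsub>A\<^esub>" using A.power_order_eq_one[of x] x finK by simp
    then show ?thesis
      using x by (simp add: uv A.nat_pow_mult[symmetric] A.nat_pow_pow[symmetric] del: cA(2))
  qed
  define C where "C = finprod A c S"
  have cS: "c \<in> S \<rightarrow> K" using c Sc by auto
  have CK: "C \<in> K" unfolding C_def using A.finprod_closed[of c S] cS by simp
  define D where "D = C [^]\<^bsub>A\<^esub> u"
  have DK: "D \<in> K" unfolding D_def using A.nat_pow_closed[of C u] CK by simp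
  \<comment> \<open>the cocycle is the coboundary of \<open>D\<close> on \<open>S\<close>\<close>
  have D: "D = (inv t \<otimes> D \<otimes> t) \<otimes> c t" if t: "t \<in> S" for t
  proof -
    have tc: "t \<in> carrier G" using t Sc by blast
    have ct: "c t \<in> K" using c tc by blast
    define \<kappa> where "\<kappa> x = inv t \<otimes> x \<otimes> t" for x
    have \<kappa>: "\<kappa> \<in> hom A A"
    proof (rule homI)
      fix x y assume xy: "x \<in> carrier A" "y \<in> carrier A"
      then have "x \<in> carrier G" "y \<in> carrier G" using Kc by auto
      then show "\<kappa> (x \<otimes>\<^bsub>A\<^esub> y) = \<kappa> x \<otimes>\<^bsub>A\<^esub> \<kappa> y" using tc by (simp add: \<kappa>_def m_assoc)
    qed (use conjK tc in \<open>simp add: \<kappa>_def\<close>)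
    have \<kappa>K: "\<kappa> x \<in> K" if "x \<in> K" for x using conjK tc that by (simp add: \<kappa>_def)
    have img: "(\<lambda>s. s \<otimes> t) ` S = S"
    proof
      show "(\<lambda>s. s \<otimes> t) ` S \<subseteq> S" using t S by (auto simp: subgroup.m_closed)
      show "S \<subseteq> (\<lambda>s. s \<otimes> t) ` S"
      proof
        fix s assume s: "s \<in> S"
        have "s \<otimes> inv t \<in> S" using s t S by (simp add: subgroup.m_closed subgroup.m_inv_closed)
        moreover have "s = s \<otimes> inv t \<otimes> t" using Sc[OF s] tc by (simp add: m_assoc)
        ultimately show "s \<in> (\<lambda>s. s \<otimes> t) ` S" by (rule rev_image_eqI)
      qed
    qed
    have inj: "inj_on (\<lambda>s. s \<otimes> t) S" using Sc tc by (auto simp: inj_on_def)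
    have "C = finprod A c ((\<lambda>s. s \<otimes> t) ` S)" by (simp add: C_def img)
    also have "\<dots> = finprod A (\<lambda>s. c (s \<otimes> t)) S"
      by (rule A.finprod_reindex) (use cS img inj in auto)
    also have "\<dots> = finprod A (\<lambda>s. \<kappa> (c s) \<otimes>\<^bsub>A\<^esub> c t) S"
      by (rule A.finprod_cong') (use cS \<kappa>K ct cocycle Sc tc subgroup.m_closed[OF sK] in \<open>auto simp: \<kappa>_def Pi_iff\<close>)
    also have "\<dots> = finprod A (\<lambda>s. \<kappa> (c s)) S \<otimes>\<^bsub>A\<^esub> finprod A (\<lambda>s. c t) S"
      by (rule A.finprod_multf) (use cS \<kappa>K ct in auto)
    also have "finprod A (\<lambda>s. \<kappa> (c s)) S = \<kappa> C"
      unfolding C_def by (rule A.endomorphism_finprod[symmetric]) (use \<kappa> cS finS in auto)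
    also have "finprod A (\<lambda>s. c t) S = c t [^]\<^bsub>A\<^esub> card S"
      using A.finprod_const[of "c t" S] ct by simp
    finally have "D = (\<kappa> C \<otimes>\<^bsub>A\<^esub> c t [^]\<^bsub>A\<^esub> card S) [^]\<^bsub>A\<^esub> u" by (simp add: D_def)
    also have "\<dots> = \<kappa> C [^]\<^bsub>A\<^esub> u \<otimes>\<^bsub>A\<^esub> (c t [^]\<^bsub>A\<^esub> card S) [^]\<^bsub>A\<^esub> u"
      using A.pow_mult_distrib[of "\<kappa> C" "c t [^]\<^bsub>A\<^esub> card S" u] A.m_comm CK ct \<kappa>K A.nat_pow_closed[of "c t" "card S"]
      by (simp del: cA(2))
    also have "(c t [^]\<^bsub>A\<^esub> card S) [^]\<^bsub>A\<^esub> u = c t"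
      using pow1[OF ct] ct by (simp add: A.nat_pow_pow)
    also have "\<kappa> C [^]\<^bsub>A\<^esub> u = \<kappa> D"
    proof -
      interpret h: group_hom A A \<kappa> using \<kappa> by unfold_locales
      show ?thesis unfolding D_def using h.hom_nat_pow[of C u] CK by simp
    qed
    finally show ?thesis by (simp add: \<kappa>_def)
  qed
  show ?thesis
  proof (intro bexI ballI)
    fix t assume t: "t \<in> S"
    have tc: "t \<in> carrier G" using t Sc by blast
    have ct: "c t \<in> K" "t \<otimes> inv (c t) \<in> M" using c tc by auto
    have cc: "D \<in> carrier G" "c t \<in> carrier G" using Kc DK ct by auto
    have "t \<otimes> D = t \<otimes> ((inv t \<otimes> D \<otimes> t) \<otimes> c t)" using D[OF t] by simp
    also have "\<dots> = D \<otimes> t \<otimes> c t" using tc cc by (simp add: m_assoc)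
    finally have "D \<otimes> t = t \<otimes> D \<otimes> inv (c t)" using tc cc by (simp add: m_assoc)
    moreover have "D \<otimes> inv (c t) = inv (c t) \<otimes> D"
      using ab DK subgroup.m_inv_closed[OF sK ct(1)] by blast
    ultimately have "D \<otimes> t = t \<otimes> inv (c t) \<otimes> D" using tc cc by (simp add: m_assoc)
    then have "D \<otimes> t \<otimes> inv D = t \<otimes> inv (c t)" using tc cc by (simp add: m_assoc)
    then show "D \<otimes> t \<otimes> inv D \<in> M" using ct by simp
  qed (rule DK)
qed

context finite_group
begin

text \<open>The normalizer of \<open>S\<close>. The equivalence, instead of one implication, gives closure under inverses
  for arbitrary sets.\<close>

definition conj_stabilizer :: "'a set \<Rightarrow> 'a set"
  where "conj_stabilizer S = {g \<in> carrier G. \<forall>s\<in>carrier G. g \<otimes> s \<otimes> inv g \<in> S \<longleftrightarrow> s \<in> S}"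

lemma subgroup_conj_stabilizer: "subgroup (conj_stabilizer S) G"
proof (rule subgroupI)
  show "conj_stabilizer S \<subseteq> carrier G" by (auto simp: conj_stabilizer_def)
  have "\<one> \<in> conj_stabilizer S" by (simp add: conj_stabilizer_def)
  then show "conj_stabilizer S \<noteq> {}" by blast
  fix a assume a: "a \<in> conj_stabilizer S"
  have ac: "a \<in> carrier G" using a by (simp add: conj_stabilizer_def)
  have iff_a: "a \<otimes> s \<otimes> inv a \<in> S \<longleftrightarrow> s \<in> S" if "s \<in> carrier G" for s
    using a that by (simp add: conj_stabilizer_def)
  show "inv a \<in> conj_stabilizer S"
  proof -
    have "inv a \<otimes> s \<otimes> inv (inv a) \<in> S \<longleftrightarrow> s \<in> S" if s: "s \<in> carrier G" for s
      using iff_a[of "inv a \<otimes> s \<otimes> a"] s ac by (simp add: m_assoc)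
    then show ?thesis using ac by (simp add: conj_stabilizer_def)
  qed
  fix b assume b: "b \<in> conj_stabilizer S"
  have bc: "b \<in> carrier G" using b by (simp add: conj_stabilizer_def)
  have iff_b: "b \<otimes> s \<otimes> inv b \<in> S \<longleftrightarrow> s \<in> S" if "s \<in> carrier G" for s
    using b that by (simp add: conj_stabilizer_def)
  have "(a \<otimes> b) \<otimes> s \<otimes> inv (a \<otimes> b) \<in> S \<longleftrightarrow> s \<in> S" if s: "s \<in> carrier G" for s
    using iff_a[of "b \<otimes> s \<otimes> inv b"] iff_b[OF s] s ac bc by (simp add: m_assoc inv_mult_group)
  then show "a \<otimes> b \<in> conj_stabilizer S" using ac bc by (simp add: conj_stabilizer_def)
qed

lemma conj_stabilizerI:
  assumes H: "subgroup H G" and g: "g \<in> H" and S: "S \<subseteq> carrier G"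
    and "\<And>g s. g \<in> H \<Longrightarrow> s \<in> S \<Longrightarrow> g \<otimes> s \<otimes> inv g \<in> S"
  shows "g \<in> conj_stabilizer S"
proof -
  have gc: "g \<in> carrier G" using subgroup.mem_carrier[OF H g] .
  have "s \<in> S" if s: "s \<in> carrier G" "g \<otimes> s \<otimes> inv g \<in> S" for s
  proof -
    have "inv g \<otimes> (g \<otimes> s \<otimes> inv g) \<otimes> inv (inv g) \<in> S"
      using assms(4)[OF subgroup.m_inv_closed[OF H g] s(2)] .
    then show ?thesis using gc s by (simp add: m_assoc)
  qed
  moreover have "g \<otimes> s \<otimes> inv g \<in> S" if "s \<in> S" for s
    by (rule assms(4)[OF g that])
  ultimately show ?thesis using gc unfolding conj_stabilizer_def by blast
qed

text \<open>Let \<open>K / L\<close> be the common minimal normal subgroup of \<open>G / L\<close>; it is its own centralizer. If \<open>K \<noteq> G\<close>,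
  let \<open>Q / K\<close> be a chief factor. It is not a \<open>p\<close>-group, since otherwise \<open>Q\<close> would centralize \<open>K / L\<close>, so
  its order is prime to \<open>p\<close> by \<open>p\<close>-solvability. The intersections \<open>Q \<inter> M1\<close> and \<open>Q \<inter> M2\<close> complement
  \<open>K / L\<close> in \<open>Q / L\<close> and are therefore conjugate, and each \<open>M\<^sub>i\<close> is the normalizer of \<open>Q \<inter> M\<^sub>i\<close>.\<close>

lemma maximal_same_core_conjugate:
  assumes M1: "p_solvable_maximal G M1" and M2: "p_solvable_maximal G M2"
    and L: "core G M1 = L" "core G M2 = L" and LK: "chief_factor G L K"
  shows "\<exists>d\<in>carrier G. \<forall>g\<in>M1. d \<otimes> g \<otimes> inv d \<in> M2"
proof -
  note c = chief_factorD[OF LK]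
  have max: "maximal_subgroup G M1" "maximal_subgroup G M2"
    using M1 M2 by (auto simp: p_solvable_maximal_def)
  note m1 = maximal_subgroupD[OF max(1)] and m2 = maximal_subgroupD[OF max(2)]
  have LM: "L \<subseteq> M1" "L \<subseteq> M2" using core_subset[OF m1(2)] core_subset[OF m2(2)] L by auto
  have KM: "\<not> K \<subseteq> M1" "\<not> K \<subseteq> M2"
    using normal_subset_core[OF m1(2) c(2)] normal_subset_core[OF m2(2) c(2)] L c(3,4) by auto
  interpret A: chief_supplement G M1 L K
    using M1 LK LM KM by unfold_locales auto
  interpret B: chief_supplement G M2 L K
    using M2 LK LM KM by unfold_locales auto
  have CK: "centralizer_mod L K = K"
  proof -
    have "A.L = L" using L by (simp add: A.L_def)
    then have "A.C = K <#> L" using A.C_eq(1) by simp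
    also have "\<dots> = K" using set_mult_absorb(2)[OF c(6,3)] subgroup.one_closed[OF c(5)] by simp
    finally show ?thesis by (simp add: A.C_def)
  qed
  show ?thesis
  proof (cases "K = carrier G")
    case True
    have "M1 = K \<inter> M1" using m1(2) True by (simp add: Int_absorb1)
    then have "M1 \<subseteq> M2" using A.K_Int_M LM by simp
    then show ?thesis by (intro bexI[of _ \<one>]) (auto simp: subsetD[OF m1(2)])
  next
    case False
    then have "K \<subset> carrier G" using A.K_carrier by blast
    then obtain Q where KQ: "chief_factor G K Q"
      using ex_chief_factor_above[OF c(2) normal_invI[OF subgroup_self]] by auto
    note q = chief_factorD[OF KQ]
    obtain p m where p: "prime p" "p_solvable G p" "m > 0" "card K = card L * p ^ m"
      using A.chief_factor_p_power by blast
    obtain r where r: "card Q = card K * r" using card_subgroup_dvd[OF q(5,6,3)] by blast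
      have npr: "\<not> p dvd r"
    proof
      assume "p dvd r"
      then obtain k where "r = p ^ k" using p_solvable_chief_factor[OF KQ p(2,1) r] by blast
      then have "card Q = card L * p ^ (m + k)" using r p(4) by (simp add: power_add)
      then have "Q \<subseteq> centralizer_mod L K"
        using p_chief_factor_centralized[OF LK q(2) _ p(1) _ p(4)] c(3) q(3) by blast
      then show False using CK q(3,4) by blast
    qed
    have Qc: "Q \<subseteq> carrier G" using subgroup.subset[OF q(6)] .
    have complement: "card (Q \<inter> M) = card L * r"
      if M: "subgroup M G" "K <#> M = carrier G" "K \<inter> M = L" for M
    proof -
      have "K <#> (M \<inter> Q) = Q"
        using dedekind_modular_law[OF q(6,3) subgroup.subset[OF M(1)]] M(2) Qc by (simp add: Int_absorb1)
      moreover have "K \<inter> (M \<inter> Q) = L" using M(3) q(3) by blast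
      moreover have s: "subgroup (M \<inter> Q) G" using subgroups_Inter_pair[OF M(1) q(6)] .
      ultimately have "card Q * card L = card K * card (M \<inter> Q)"
        using card_set_mult[OF c(6) s] finite_subgroup[OF c(6)] finite_subgroup[OF s] by simp
      then show ?thesis using r card_subgroup_pos[OF c(6)] by (simp add: Int_commute[of Q] mult.commute)
    qed
    define S1 where "S1 = Q \<inter> M1"
    define S2 where "S2 = Q \<inter> M2"
    have cS: "card S1 = card L * r" "card S2 = card L * r"
      using complement[OF m1(1) A.K_mult_M(1) A.K_Int_M] complement[OF m2(1) B.K_mult_M(1) B.K_Int_M]
      by (simp_all add: S1_def S2_def)
    have sS: "subgroup S1 G" "subgroup S2 G"
      using subgroups_Inter_pair[OF q(6) m1(1)] subgroups_Inter_pair[OF q(6) m2(1)]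
      by (simp_all add: S1_def S2_def)
    have LS: "L \<subseteq> S1" using LM c(3) q(3) by (auto simp: S1_def)
    interpret \<pi>: group_hom G "G Mod L" "\<lambda>x. L #> x" using group_hom_r_coset[OF c(1)] .
    define \<pi> where "\<pi> x = L #> x" for x
    have \<pi>m: "\<pi> x \<otimes>\<^bsub>G Mod L\<^esub> \<pi> y = \<pi> (x \<otimes> y)" if "x \<in> carrier G" "y \<in> carrier G" for x y
      using \<pi>.hom_mult[OF that] by (simp add: \<pi>_def)
    have \<pi>i: "inv\<^bsub>G Mod L\<^esub> \<pi> x = \<pi> (inv x)" if "x \<in> carrier G" for x
      using \<pi>.hom_inv[OF that] by (simp add: \<pi>_def)
    have \<pi>s: "\<pi> ` carrier G = carrier (G Mod L)" by (simp add: \<pi>_def[abs_def] carrier_FactGroup)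
    have \<pi>_eq: "\<pi> x = \<pi> y \<longleftrightarrow> x \<otimes> inv y \<in> L" if "x \<in> carrier G" "y \<in> carrier G" for x y
      unfolding \<pi>_def by (rule subgroup_r_coset_eq_iff[OF c(5) that])
    have \<pi>_mem: "x \<in> M2" if x: "x \<in> carrier G" "\<pi> x \<in> \<pi> ` M2" for x
    proof -
      obtain y where y: "y \<in> M2" "\<pi> x = \<pi> y" using x by auto
      have yc: "y \<in> carrier G" using y m2(2) by blast
      have "x \<otimes> inv y \<in> M2" using \<pi>_eq[OF x(1) yc] y(2) LM by blast
      then have "x \<otimes> inv y \<otimes> y \<in> M2" using y(1) subgroup.m_closed[OF m2(1)] by blast
      then show ?thesis using x yc by (simp add: m_assoc)
    qed
    have "\<exists>d\<in>\<pi> ` K. \<forall>s\<in>\<pi> ` S1. d \<otimes>\<^bsub>G Mod L\<^esub> s \<otimes>\<^bsub>G Mod L\<^esub> inv\<^bsub>G Mod L\<^esub> d \<in> \<pi> ` M2"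
    proof (rule \<pi>.H.coprime_subgroup_in_conjugate_complement)
      show "\<pi> ` K \<lhd> G Mod L"
        by (rule normal.surj_hom_normal_subgroup[OF c(2)])
          (use \<pi>s \<pi>.group_hom_axioms in \<open>simp_all add: \<pi>_def[abs_def]\<close>)
      show "x \<otimes>\<^bsub>G Mod L\<^esub> y = y \<otimes>\<^bsub>G Mod L\<^esub> x" if xy: "x \<in> \<pi> ` K" "y \<in> \<pi> ` K" for x y
      proof -
        obtain a b where ab: "a \<in> K" "x = \<pi> a" "b \<in> K" "y = \<pi> b" using xy by blast
        have "\<pi> (a \<otimes> b) = \<pi> (b \<otimes> a)" using A.K_abelian ab by (auto simp: centralizer_mod_def \<pi>_def)
        moreover have "a \<in> carrier G" "b \<in> carrier G" using ab A.K_carrier by auto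
        ultimately show ?thesis using ab \<pi>m by simp
      qed
      show "finite (\<pi> ` K)" "finite (\<pi> ` S1)" using finite_subgroup c(6) sS by auto
      show "subgroup (\<pi> ` M2) (G Mod L)" "subgroup (\<pi> ` S1) (G Mod L)"
        using \<pi>.subgroup_img_is_subgroup m2(1) sS(1) by (simp_all add: \<pi>_def[abs_def])
      have one: "\<one>\<^bsub>G Mod L\<^esub> = \<pi> \<one>" using A.N_carrier by (simp add: \<pi>_def)
      show "\<pi> ` K \<inter> \<pi> ` M2 = {\<one>\<^bsub>G Mod L\<^esub>}"
      proof
        show "\<pi> ` K \<inter> \<pi> ` M2 \<subseteq> {\<one>\<^bsub>G Mod L\<^esub>}"
        proof
          fix x assume x: "x \<in> \<pi> ` K \<inter> \<pi> ` M2"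
          then obtain k where k: "k \<in> K" "x = \<pi> k" by blast
          have kc: "k \<in> carrier G" using k A.K_carrier by blast
          have "k \<in> M2" using \<pi>_mem[OF kc] x k by blast
          then have "k \<in> L" using B.K_Int_M k by blast
          then show "x \<in> {\<one>\<^bsub>G Mod L\<^esub>}" using k kc one \<pi>_eq[OF kc one_closed] by simp
        qed
        show "{\<one>\<^bsub>G Mod L\<^esub>} \<subseteq> \<pi> ` K \<inter> \<pi> ` M2"
          using one subgroup.one_closed[OF c(6)] subgroup.one_closed[OF m2(1)] by auto
      qed
      show "\<pi> ` M2 <#>\<^bsub>G Mod L\<^esub> \<pi> ` K = carrier (G Mod L)"
      proof -
        have "\<pi> ` M2 <#>\<^bsub>G Mod L\<^esub> \<pi> ` K = \<pi> ` (M2 <#> K)"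
          by (rule set_mult_hom[OF \<pi>.homh, folded \<pi>_def[abs_def], symmetric]) (use m2(2) A.K_carrier in auto)
        then show ?thesis using B.K_mult_M(2) \<pi>s by simp
      qed
      have "card (\<pi> ` S1) * card L = card S1" "card (\<pi> ` K) * card L = card K"
        using card_r_coset_image[OF c(1) sS(1) LS] card_r_coset_image[OF c(1,6,3)]
        by (simp_all add: \<pi>_def[abs_def])
      then have "card (\<pi> ` S1) = r" "card (\<pi> ` K) = p ^ m"
        using cS(1) p(4) card_subgroup_pos[OF c(5)] by (simp_all add: mult.commute)
      then show "coprime (card (\<pi> ` S1)) (card (\<pi> ` K))"
        using npr p(1) by (simp add: coprime_commute prime_imp_coprime)
    qed
    then obtain d where d: "d \<in> K" "\<And>s. s \<in> S1 \<Longrightarrow>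
        \<pi> d \<otimes>\<^bsub>G Mod L\<^esub> \<pi> s \<otimes>\<^bsub>G Mod L\<^esub> inv\<^bsub>G Mod L\<^esub> \<pi> d \<in> \<pi> ` M2" by blast
    have dc: "d \<in> carrier G" using d(1) A.K_carrier by blast
    define f where "f s = d \<otimes> s \<otimes> inv d" for s
    have fc: "f s \<in> carrier G" if "s \<in> carrier G" for s using that dc by (simp add: f_def)
    have S1c: "s \<in> carrier G" if "s \<in> S1" for s using subgroup.mem_carrier[OF sS(1) that] .
    have f_inj: "inj_on f (carrier G)" using dc by (auto simp: inj_on_def f_def)
    have fS: "f ` S1 = S2"
    proof (rule card_seteq)
      show "finite S2" using finite_subgroup sS by blast
      show "f ` S1 \<subseteq> S2"
      proof
        fix y assume "y \<in> f ` S1"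
        then obtain s where s: "s \<in> S1" "y = f s" by blast
        have "\<pi> (f s) \<in> \<pi> ` M2" using d(2)[OF s(1)] dc S1c[OF s(1)] by (simp add: \<pi>m \<pi>i f_def del: mult_FactGroup)
        then have "f s \<in> M2" using \<pi>_mem fc S1c s by blast
        moreover have "f s \<in> Q" unfolding f_def using normal_invE(2)[OF q(2) dc] s by (simp add: S1_def)
        ultimately show "y \<in> S2" using s by (simp add: S2_def)
      qed
      have "card (f ` S1) = card S1"
        by (rule card_image) (rule inj_on_subset[OF f_inj], use S1c in blast)
      then show "card S2 \<le> card (f ` S1)" using cS by simp
    qed
    have S2c: "S2 \<subseteq> carrier G" using subgroup.subset[OF sS(2)] .
    have "conj_stabilizer S2 = M2 \<or> conj_stabilizer S2 = carrier G"
    proof (rule m2(4)[OF subgroup_conj_stabilizer], rule subsetI, rule conj_stabilizerI[OF m2(1) _ S2c])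
      fix g s assume g: "g \<in> M2" and s: "s \<in> S2"
      have "g \<otimes> s \<otimes> inv g \<in> M2" using g s m2(1) by (simp add: S2_def subgroup.m_closed subgroup.m_inv_closed)
      moreover have "g \<otimes> s \<otimes> inv g \<in> Q" using normal_invE(2)[OF q(2)] g s m2(2) by (auto simp: S2_def)
      ultimately show "g \<otimes> s \<otimes> inv g \<in> S2" by (simp add: S2_def)
    qed
    moreover have "conj_stabilizer S2 \<noteq> carrier G"
    proof
      assume all: "conj_stabilizer S2 = carrier G"
      have "S2 \<lhd> G"
      proof (rule normal_invI[OF sS(2)])
        fix x h assume x: "x \<in> carrier G" "h \<in> S2"
        then have "x \<in> conj_stabilizer S2" "h \<in> carrier G" using all S2c by auto
        then show "x \<otimes> h \<otimes> inv x \<in> S2" using x by (simp add: conj_stabilizer_def)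
      qed
      then have "S2 \<subseteq> L" using normal_subset_core[OF m2(2)] L by (auto simp: S2_def)
      then have "card L * r \<le> card L" using cS(2) card_mono[OF finite_subgroup[OF c(5)], of S2] by simp
      then have "r \<le> 1" using card_subgroup_pos[OF c(5)] by simp
      then have "card Q \<le> card K" using r by (cases r) auto
      then show False using subgroup_eqI_card[OF q(6,3)] q(4) by simp
    qed
    ultimately have N2: "conj_stabilizer S2 = M2" by simp
    have fM1: "f g \<in> M2" if g: "g \<in> M1" for g
    proof -
      have fm: "subgroup (f ` M1) G"
      proof -
        interpret f: group_hom G G f
          by (unfold_locales, rule homI) (use dc in \<open>auto simp: f_def m_assoc\<close>)
        show ?thesis by (rule f.subgroup_img_is_subgroup[OF m1(1)])
      qed
      have "f g \<in> conj_stabilizer S2"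
      proof (rule conj_stabilizerI[OF fm _ S2c])
        show "f g \<in> f ` M1" using g by blast
        fix x s assume x: "x \<in> f ` M1" and s: "s \<in> S2"
        obtain h where h: "h \<in> M1" "x = f h" using x by blast
        obtain u where u: "u \<in> S1" "s = f u" using s unfolding fS[symmetric] by blast
        have hu: "h \<in> carrier G" "u \<in> carrier G" using h u m1(2) S1c by auto
        have "h \<otimes> u \<otimes> inv h \<in> S1"
          using h u hu m1(1) normal_invE(2)[OF q(2)]
          by (simp add: S1_def subgroup.m_closed subgroup.m_inv_closed)
        then have "f (h \<otimes> u \<otimes> inv h) \<in> S2" unfolding fS[symmetric] by (rule imageI)
        also have "f (h \<otimes> u \<otimes> inv h) = x \<otimes> s \<otimes> inv x"
          using h u hu dc by (simp add: f_def m_assoc inv_mult_group)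
        finally show "x \<otimes> s \<otimes> inv x \<in> S2" .
      qed
      then show ?thesis using N2 by simp
    qed
    then show ?thesis using dc by (auto simp: f_def)
  qed
qed

end


section \<open>Intersections of maximal subgroups without a common chief factor\<close>

text \<open>Two maximal subgroups are linked if they supplement a common chief factor. Not being
  linked is the only consequence of having nonisomorphic modules \<open>X\<close> that the induction uses, and it
  is stated without reference to quotient groups.\<close>

definition chief_linked :: "('a, 'b) monoid_scheme \<Rightarrow> 'a set \<Rightarrow> 'a set \<Rightarrow> bool"
  where "chief_linked G M M' \<longleftrightarrow>
    (\<exists>N K. chief_factor G N K \<and> N \<subseteq> M \<and> N \<subseteq> M' \<and> \<not> K \<subseteq> M \<and> \<not> K \<subseteq> M')"

context finite_group
begin

lemma subgroup_family_inter:
  assumes "\<And>i. i \<in> I \<Longrightarrow> subgroup (F i) G"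
  shows "subgroup (family_inter G I F) G"
proof -
  have "subgroup (\<Inter>(insert (carrier G) (F ` I))) G"
    by (rule subgroups_Inter) (use assms subgroup_self in auto)
  then show ?thesis by (simp add: family_inter_def)
qed

text \<open>Modulo the intersection of the two cores, the centralizer of \<open>K / N\<close> is a direct sum of two copies
  of \<open>K / N\<close>, in which the two cores and \<open>K\<close> give three different simple submodules. The group \<open>M \<inter> J\<close>
  complements the whole sum, so that adding one simple submodule to it gives a maximal subgroup. With
  the cores one recovers \<open>M\<close> and \<open>J\<close>; with \<open>K\<close> one gets \<open>D\<close>.\<close>

lemma diagonal_maximal_subgroup:
  assumes M: "p_solvable_maximal G M" and J: "p_solvable_maximal G J"
    and NK: "chief_factor G N K" and NMJ: "N \<subseteq> M" "N \<subseteq> J" and KMJ: "\<not> K \<subseteq> M" "\<not> K \<subseteq> J"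
    and ne: "core G M \<noteq> core G J"
  defines "D \<equiv> K <#> (M \<inter> J)"
  shows "p_solvable_maximal G D" "D \<inter> J = M \<inter> J" "J <#> M = carrier G"
proof -
  interpret A: chief_supplement G M N K using M NK NMJ KMJ by unfold_locales
  interpret B: chief_supplement G J N K using J NK NMJ KMJ by unfold_locales
  note c = A.chief_props
  note sM = A.M_props(1) and sJ = B.M_props(1)
  define T where "T = M \<inter> J"
  have sT: "subgroup T G" unfolding T_def using subgroups_Inter_pair[OF sM sJ] .
  have Tc: "T \<subseteq> carrier G" using subgroup.subset[OF sT] .
  have CC: "A.C = B.C" by (simp add: A.C_def B.C_def)
  have LJ: "\<not> A.L \<subseteq> J"
  proof
    assume "A.L \<subseteq> J"
    then have "A.L \<subseteq> B.L" using normal_subset_core[OF B.M_props(2) A.L_normal] by (simp add: B.L_def)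
    then have "B.L = A.L \<or> B.L = A.C"
      using chief_factorD(7)[OF A.chief_factor_L_C B.L_normal] B.L_subset_C CC by simp
    moreover have "B.L \<noteq> A.L" using ne by (simp add: A.L_def B.L_def)
    ultimately have "K \<subseteq> B.L" using A.K_subset_C by simp
    then show False using B.L_subset KMJ(2) by simp
  qed
  have LJG: "A.L <#> J = carrier G" "J <#> A.L = carrier G"
    using maximal_normal_supplement[OF B.max A.L_normal LJ] by auto
  have Lc: "A.L \<subseteq> carrier G" using A.L_subset A.M_props(2) by simp
  show JM: "J <#> M = carrier G"
  proof -
    have "J <#> A.L \<subseteq> J <#> M" using A.L_subset by (rule mono_set_mult[OF subset_refl])
    moreover have "J <#> M \<subseteq> carrier G" using setmult_subset_G[OF B.M_props(2) A.M_props(2)] .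
    ultimately show ?thesis using LJG(2) by simp
  qed
  have MLT: "M = A.L <#> T"
  proof -
    have "M = (A.L <#> J) \<inter> M" by (simp only: LJG(1) Int_absorb1[OF A.M_props(2)])
    also have "\<dots> = A.L <#> (J \<inter> M)"
      by (rule dedekind_modular_law[OF sM A.L_subset B.M_props(2)])
    also have "J \<inter> M = T" by (auto simp: T_def)
    finally show ?thesis .
  qed
  \<comment> \<open>\<open>Z\<close> can be read off from \<open>L Z\<close>, which lies between the maximal subgroup \<open>M = L T\<close> and \<open>G\<close>\<close>
  have T_max: "Z = T \<or> Z = J" if Z: "subgroup Z G" "T \<subseteq> Z" "Z \<subseteq> J" for Z
  proof -
    have sLZ: "subgroup (A.L <#> Z) G" using mult_norm_subgroup[OF A.L_normal Z(1)] .
    have "A.L <#> T \<subseteq> A.L <#> Z" using mono_set_mult[OF subset_refl Z(2)] .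
    then have "M \<subseteq> A.L <#> Z" using MLT by simp
    then consider "A.L <#> Z = M" | "A.L <#> Z = carrier G"
      using A.M_props(4)[OF sLZ] by auto
    then show ?thesis
    proof cases
      case 1
      have "Z \<subseteq> A.L <#> Z"
        using set_mult_subset_right[OF normal_imp_subgroup[OF A.L_normal] subgroup.subset[OF Z(1)]] .
      then show ?thesis using 1 Z by (auto simp: T_def)
    next
      case 2
      then have "Z <#> A.L = carrier G" using commut_normal[OF Z(1) A.L_normal] by simp
      then have "J = (Z <#> A.L) \<inter> J" using B.M_props(2) by (simp add: Int_absorb1)
      also have "\<dots> = Z <#> (A.L \<inter> J)" by (rule dedekind_modular_law[OF sJ Z(3) Lc])
      also have "A.L \<inter> J \<subseteq> Z" using A.L_subset Z(2) by (auto simp: T_def)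
      then have "Z <#> (A.L \<inter> J) \<subseteq> Z" by (rule set_mult_subset_subgroup[OF Z(1) subset_refl])
      finally show ?thesis using Z by simp
    qed
  qed
  have NT: "N \<subseteq> T" using NMJ by (simp add: T_def)
  have D: "D = K <#> T" "D = T <#> K"
    unfolding D_def T_def[symmetric] using commut_normal[OF sT c(2)] by auto
  have DJ: "D \<inter> J = T"
  proof -
    have "(T <#> K) \<inter> J = T <#> (K \<inter> J)"
      by (rule dedekind_modular_law[OF sJ _ A.K_carrier]) (simp add: T_def)
    also have "\<dots> = T"
      using set_mult_absorb(2)[OF sT NT] subgroup.one_closed[OF c(5)] B.K_Int_M by simp
    finally show ?thesis using D by simp
  qed
  then show "D \<inter> J = M \<inter> J" by (simp add: T_def)
  have sD: "subgroup D G" unfolding D(1) using mult_norm_subgroup[OF c(2) sT] .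
  have TJ: "T \<noteq> J"
  proof
    assume "T = J"
    then have "J \<subseteq> M" by (auto simp: T_def)
    then have "M = J" using B.M_props(4)[OF sM] A.M_props(3) by simp
    then show False using ne by simp
  qed
  have maxD: "maximal_subgroup G D"
    unfolding maximal_subgroup_def
  proof (intro conjI allI impI)
    show "subgroup D G" by fact
    show "D \<noteq> carrier G"
    proof
      assume "D = carrier G"
      then have "D \<inter> J = J" using B.M_props(2) by (simp add: Int_absorb1)
      then show False using DJ TJ by simp
    qed
    fix H assume H: "subgroup H G \<and> D \<subseteq> H"
    have KD: "K \<subseteq> D" unfolding D(1) using set_mult_subset_left[OF A.K_carrier sT] .
    have "T \<subseteq> D" using DJ by auto
    then have "T \<subseteq> J \<inter> H" using H by (auto simp: T_def)
    moreover have "subgroup (J \<inter> H) G" using subgroups_Inter_pair[OF sJ] H by simp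
    ultimately have "J \<inter> H = T \<or> J \<inter> H = J" using T_max by simp
    moreover have "K <#> (J \<inter> H) = H"
    proof -
      have "(K <#> J) \<inter> H = K <#> (J \<inter> H)"
        by (rule dedekind_modular_law[OF _ _ B.M_props(2)]) (use H KD in auto)
      moreover have "H \<subseteq> carrier G" using H subgroup.subset[of H G] by simp
      ultimately show ?thesis using B.K_mult_M(1) by (simp add: Int_absorb1)
    qed
    ultimately show "H = D \<or> H = carrier G" using D(1) B.K_mult_M(1) by metis
  qed
  have "index G D = index G M"
  proof -
    have fin: "finite K" "finite T" "finite M" "finite J"
      using finite_subgroup[OF c(6)] finite_subgroup[OF sT] finite_subgroup[OF sM] finite_subgroup[OF sJ] .
    have "K \<inter> T = N" using A.K_Int_M NT c(3) by (auto simp: T_def)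
    then have e1: "card D * card N = card K * card T"
      using card_set_mult[OF c(6) sT] fin D(1) by simp
    have e2: "card (carrier G) * card T = card J * card M"
      using card_set_mult[OF sJ sM] fin JM by (simp add: T_def Int_commute)
    have e3: "card (carrier G) * card N = card K * card J"
      using card_set_mult[OF c(6) sJ] fin B.K_mult_M(1) B.K_Int_M by simp
    have "card D * (card N * card J) = (card K * card J) * card T" using e1 by (simp add: ac_simps)
    also have "\<dots> = (card (carrier G) * card T) * card N" unfolding e3[symmetric] by (simp add: ac_simps)
    also have "\<dots> = card M * (card N * card J)" unfolding e2 by (simp add: ac_simps)
    finally have eq: "card D = card M"
      using card_subgroup_pos[OF c(5)] card_subgroup_pos[OF sJ] by simp
    have "index G D * card M = index G M * card M"
      using index_mult_card[OF sD] index_mult_card[OF sM] eq by simp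
    then show ?thesis using card_subgroup_pos[OF sM] by simp
  qed
  then show "p_solvable_maximal G D"
    using M maxD by (simp add: p_solvable_maximal_def)
qed

text \<open>Induction on the index of a normal subgroup \<open>N\<close> contained in all the maximal subgroups. For a chief
  factor \<open>K / N\<close>, at most one member \<open>F j\<close> of an unlinked family fails to contain \<open>K\<close>. If \<open>A\<close> is the
  intersection of the others, then \<open>A = U K\<close>, so that \<open>U H = A H\<close> for each subgroup \<open>H\<close> that
  contains \<open>K\<close>. The induction hypothesis can thus be applied to \<open>A\<close> and to \<open>M\<close> or the
  diagonal subgroup.\<close>

theorem unlinked_intersection_dichotomy:
  assumes F: "\<And>i. i \<in> I \<Longrightarrow> p_solvable_maximal G (F i)"
    and unl: "\<And>i j. i \<in> I \<Longrightarrow> j \<in> I \<Longrightarrow> i \<noteq> j \<Longrightarrow> \<not> chief_linked G (F i) (F j)"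
    and M: "p_solvable_maximal G M"
    and N: "N \<lhd> G" "\<And>i. i \<in> I \<Longrightarrow> N \<subseteq> F i" "N \<subseteq> M"
  shows "(\<exists>x\<in>carrier G. \<forall>u\<in>family_inter G I F. x \<otimes> u \<otimes> inv x \<in> M) \<or>
    family_inter G I F <#> M = carrier G"
  using assms
proof (induction "card (carrier G) - card N" arbitrary: N I M rule: less_induct)
  case less
  note F = less.prems(1) and unl = less.prems(2) and M = less.prems(3) and N = less.prems(4-6)
  define U where "U = family_inter G I F"
  have mM: "maximal_subgroup G M" using M by (simp add: p_solvable_maximal_def)
  note m = maximal_subgroupD[OF mM]
  have sF: "subgroup (F i) G" if "i \<in> I" for i
    using F[OF that] maximal_subgroupD(1) by (simp add: p_solvable_maximal_def)
  have sU: "subgroup U G" unfolding U_def using subgroup_family_inter sF by simp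
  have Uc: "U \<subseteq> carrier G" using subgroup.subset[OF sU] .
  have "N \<noteq> carrier G" using N(3) m(2,3) by auto
  then have "N \<subset> carrier G" using N(3) m(2) by auto
  then obtain K where NK: "chief_factor G N K"
    using ex_chief_factor_above[OF N(1) normal_invI[OF subgroup_self]] by auto
  note c = chief_factorD[OF NK]
  have Kc: "K \<subseteq> carrier G" using subgroup.subset[OF c(6)] .
  have "card N < card K" using c(3,4) finite_subgroup[OF c(6)] by (simp add: psubset_card_mono psubset_eq)
  moreover have "card K \<le> card (carrier G)" using Kc by (simp add: card_mono)
  ultimately have smaller: "card (carrier G) - card K < card (carrier G) - card N" by simp
  have UM: "U <#> M \<subseteq> carrier G" using setmult_subset_G[OF Uc m(2)] .
  show ?case
  proof (cases "\<forall>i\<in>I. K \<subseteq> F i")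
    case all: True
    show ?thesis
    proof (cases "K \<subseteq> M")
      case True
      show ?thesis
        by (rule less.hyps[OF smaller F unl M c(2) _ True]) (use all in auto)
    next
      case False
      have "K \<subseteq> U" using all Kc by (auto simp: U_def family_inter_def)
      then have "K <#> M \<subseteq> U <#> M" by (rule mono_set_mult[OF _ subset_refl])
      then have "U <#> M = carrier G" using maximal_normal_supplement(1)[OF mM c(2) False] UM by simp
      then show ?thesis by (simp add: U_def)
    qed
  next
    case False
    then obtain j where j: "j \<in> I" "\<not> K \<subseteq> F j" by blast
    define I' where "I' = I - {j}"
    have I'I: "i \<in> I" if "i \<in> I'" for i using that by (simp add: I'_def)
    have KF: "K \<subseteq> F i" if i: "i \<in> I'" for i
    proof (rule ccontr)
      assume "\<not> K \<subseteq> F i"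
      then have "chief_linked G (F i) (F j)"
        unfolding chief_linked_def using NK N(2)[OF I'I[OF i]] N(2)[OF j(1)] j(2)
        by (intro exI[of _ N] exI[of _ K]) simp
      then show False using unl[OF I'I[OF i] j(1)] i by (simp add: I'_def)
    qed
    have F': "\<And>i. i \<in> I' \<Longrightarrow> p_solvable_maximal G (F i)" using F I'I by simp
    have unl': "\<And>i k. i \<in> I' \<Longrightarrow> k \<in> I' \<Longrightarrow> i \<noteq> k \<Longrightarrow> \<not> chief_linked G (F i) (F k)"
      using unl I'I by simp
    define A where "A = family_inter G I' F"
    have sA: "subgroup A G" unfolding A_def using subgroup_family_inter sF I'I by simp
    have KA: "K \<subseteq> A" unfolding A_def family_inter_def using KF Kc by auto
    have UA: "U = F j \<inter> A" unfolding U_def A_def family_inter_def I'_def using j(1) by auto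
    have mJ: "maximal_subgroup G (F j)" using F[OF j(1)] by (simp add: p_solvable_maximal_def)
    note J = maximal_subgroupD[OF mJ]
    have KJ: "K <#> F j = carrier G" using maximal_normal_supplement(1)[OF mJ c(2) j(2)] .
    have AKU: "A = K <#> U"
    proof -
      have "(K <#> F j) \<inter> A = K <#> (F j \<inter> A)" by (rule dedekind_modular_law[OF sA KA J(2)])
      then show ?thesis using KJ subgroup.subset[OF sA] by (simp add: Int_absorb1 UA)
    qed
    also have "\<dots> = U <#> K" using commut_normal[OF sU c(2)] by simp
    finally have AUK: "A = U <#> K" .
    have AH: "A <#> H = U <#> H" if H: "subgroup H G" "K \<subseteq> H" for H
    proof -
      have "A <#> H = U <#> (K <#> H)"
        unfolding AUK by (rule set_mult_assoc[OF Uc Kc subgroup.subset[OF H(1)]])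
      then show ?thesis using set_mult_absorb(1)[OF H] subgroup.one_closed[OF c(6)] by simp
    qed
    show ?thesis
    proof (cases "K \<subseteq> M")
      case True
      have "(\<exists>x\<in>carrier G. \<forall>u\<in>A. x \<otimes> u \<otimes> inv x \<in> M) \<or> A <#> M = carrier G"
        unfolding A_def by (rule less.hyps[OF smaller F' unl' M c(2) KF True])
      then show ?thesis using AH[OF m(1) True] UA unfolding U_def[symmetric] by auto
    next
      case KM: False
      show ?thesis
      proof (cases "core G M = core G (F j)")
        case True
        interpret S: chief_supplement G M N K using M NK N(3) KM by unfold_locales
        have "chief_factor G (core G M) S.C" using S.chief_factor_L_C by (simp add: S.L_def)
        then have "\<exists>d\<in>carrier G. \<forall>g\<in>F j. d \<otimes> g \<otimes> inv d \<in> M"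
          using maximal_same_core_conjugate[OF F[OF j(1)] M True[symmetric] refl] by simp
        then show ?thesis using UA unfolding U_def[symmetric] by auto
      next
        case ne: False
        define D where "D = K <#> (M \<inter> F j)"
        note diag = diagonal_maximal_subgroup[OF M F[OF j(1)] NK N(3) N(2)[OF j(1)] KM j(2) ne,
            folded D_def]
        have mD: "subgroup D G" using diag(1) maximal_subgroupD(1) by (simp add: p_solvable_maximal_def)
        have KD: "K \<subseteq> D"
          unfolding D_def using set_mult_subset_left[OF Kc subgroups_Inter_pair[OF m(1) J(1)]] .
        have "(\<exists>x\<in>carrier G. \<forall>u\<in>A. x \<otimes> u \<otimes> inv x \<in> D) \<or> A <#> D = carrier G"
          unfolding A_def by (rule less.hyps[OF smaller F' unl' diag(1) c(2) KF KD])
        then show ?thesis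
        proof
          assume "\<exists>x\<in>carrier G. \<forall>u\<in>A. x \<otimes> u \<otimes> inv x \<in> D"
          then obtain x where x: "x \<in> carrier G" "\<forall>u\<in>A. x \<otimes> u \<otimes> inv x \<in> D" by blast
          \<comment> \<open>since \<open>G = D (F j)\<close>, the conjugating element can be taken in \<open>F j\<close>\<close>
          have "K <#> F j \<subseteq> D <#> F j" using KD by (rule mono_set_mult[OF _ subset_refl])
          then have "x \<in> D <#> F j" using KJ x(1) by auto
          then obtain d y where dy: "d \<in> D" "y \<in> F j" "x = d \<otimes> y" by (auto simp: set_mult_def)
          have dyc: "d \<in> carrier G" "y \<in> carrier G"
            using subgroup.mem_carrier[OF mD dy(1)] subgroup.mem_carrier[OF J(1) dy(2)] .
          have "y \<otimes> u \<otimes> inv y \<in> M" if u: "u \<in> U" for u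
          proof -
            have uc: "u \<in> carrier G" using u Uc by auto
            have "x \<otimes> u \<otimes> inv x \<in> D" using x(2) u UA by simp
            then have "inv d \<otimes> (x \<otimes> u \<otimes> inv x) \<otimes> d \<in> D"
              using dy(1) mD by (simp add: subgroup.m_closed subgroup.m_inv_closed)
            also have "inv d \<otimes> (x \<otimes> u \<otimes> inv x) \<otimes> d = y \<otimes> u \<otimes> inv y"
              using dyc uc by (simp add: dy(3) inv_mult_group m_assoc)
            finally have "y \<otimes> u \<otimes> inv y \<in> D" .
            moreover have "y \<otimes> u \<otimes> inv y \<in> F j"
              using u dy(2) J(1) UA by (simp add: subgroup.m_closed subgroup.m_inv_closed)
            ultimately have "y \<otimes> u \<otimes> inv y \<in> D \<inter> F j" by simp
            then show ?thesis using diag(2) by simp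
          qed
          then show ?thesis using dyc(2) unfolding U_def[symmetric] by blast
        next
          assume "A <#> D = carrier G"
          then have UD: "U <#> D = carrier G" using AH[OF mD KD] by simp
          have "(U <#> D) \<inter> F j = U <#> (D \<inter> F j)"
            by (rule dedekind_modular_law[OF J(1) _ subgroup.subset[OF mD]]) (simp add: UA)
          then have JUT: "F j = U <#> (M \<inter> F j)" using UD J(2) diag(2) by (simp add: Int_absorb1)
          have Tc: "M \<inter> F j \<subseteq> carrier G" using m(2) by auto
          have "carrier G = F j <#> M" using diag(3) by simp
          also have "\<dots> = (U <#> (M \<inter> F j)) <#> M" using arg_cong[OF JUT, of "\<lambda>Z. Z <#> M"] .
          also have "\<dots> = U <#> ((M \<inter> F j) <#> M)" by (rule set_mult_assoc[OF Uc Tc m(2)])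
          also have "(M \<inter> F j) <#> M = M"
            by (rule set_mult_absorb(1)[OF m(1)]) (use subgroup.one_closed[OF m(1)] subgroup.one_closed[OF J(1)] in auto)
          finally show ?thesis unfolding U_def[symmetric] by simp
        qed
      qed
    qed
  qed
qed

end


section \<open>The modules attached to maximal subgroups\<close>

lemma (in normal) normal_factor_group_cases:
  assumes Y: "Y \<lhd> G Mod H"
  obtains P where "P \<lhd> G" "H \<subseteq> P" "Y = (\<lambda>x. H #> x) ` P"
proof
  have sY: "subgroup Y (G Mod H)" using Y normal_imp_subgroup by blast
  note ch = factgroup_subgroup_union_char[OF sY]
  show "\<Union>Y \<lhd> G" by (rule factgroup_subgroup_union_normal[OF Y])
  have "H \<in> Y" using subgroup.one_closed[OF sY] by simp
  then show "H \<subseteq> \<Union>Y" by blast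
  show "Y = (\<lambda>x. H #> x) ` \<Union>Y"
  proof
    show "(\<lambda>x. H #> x) ` \<Union>Y \<subseteq> Y" unfolding ch by auto
    show "Y \<subseteq> (\<lambda>x. H #> x) ` \<Union>Y"
    proof
      fix y assume y: "y \<in> Y"
      then have "y \<in> carrier (G Mod H)" using subgroup.mem_carrier[OF sY] by blast
      then obtain x where "x \<in> carrier G" "y = H #> x" by (auto simp: carrier_FactGroup)
      then show "y \<in> (\<lambda>x. H #> x) ` \<Union>Y" unfolding ch using y by auto
    qed
  qed
qed

lemma (in finite_group) normal_r_coset_image:
  assumes "H \<lhd> G" "P \<lhd> G"
  shows "(\<lambda>x. H #> x) ` P \<lhd> G Mod H"
  by (rule normal.surj_hom_normal_subgroup[OF assms(2) group_hom_r_coset[OF assms(1)]])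
    (simp add: carrier_FactGroup)

lemma (in finite_group) r_coset_image_subset_iff:
  assumes H: "H \<lhd> G" and P: "P \<lhd> G" "H \<subseteq> P" and Q: "Q \<subseteq> carrier G"
  shows "(\<lambda>x. H #> x) ` Q \<subseteq> (\<lambda>x. H #> x) ` P \<longleftrightarrow> Q \<subseteq> P"
proof
  assume sub: "(\<lambda>x. H #> x) ` Q \<subseteq> (\<lambda>x. H #> x) ` P"
  have sP: "subgroup P G" using P normal_imp_subgroup by blast
  have sH: "subgroup H G" using H normal_imp_subgroup by blast
  show "Q \<subseteq> P"
  proof
    fix x assume x: "x \<in> Q"
    then have "H #> x \<in> (\<lambda>x. H #> x) ` P" using sub by blast
    then obtain y where y: "y \<in> P" "H #> x = H #> y" by blast
    have c: "x \<in> carrier G" "y \<in> carrier G" using x Q subgroup.mem_carrier[OF sP y(1)] by auto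
    have "x \<otimes> inv y \<in> P" using subgroup_r_coset_eq_iff[OF sH c] y(2) P(2) by blast
    then have "x \<otimes> inv y \<otimes> y \<in> P" using y(1) subgroup.m_closed[OF sP] by simp
    then show "x \<in> P" using c by (simp add: m_assoc)
  qed
qed (rule image_mono)

context chief_supplement
begin

text \<open>If \<open>C1 / L\<close> is any chief factor, then \<open>C1\<close> supplements \<open>M\<close> too, hence is its own centralizer
  modulo \<open>L\<close>. If it were different from \<open>C\<close>, then \<open>C\<close> and \<open>C1\<close> would intersect in \<open>L\<close> and centralize
  each other. So \<open>C / L = K L / L\<close> is the only minimal normal subgroup of \<open>G / L\<close>.\<close>

lemma minimal_normal_eq:
  "(THE Y. minimal_normal_subgroup (G Mod L) Y) = (\<lambda>x. L #> x) ` K"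
proof -
  define \<pi> where "\<pi> = (\<lambda>x. L #> x)"
  note lc = chief_factorD[OF chief_factor_L_C]
  have \<pi>L: "\<pi> ` L = {\<one>\<^bsub>G Mod L\<^esub>}"
    using subgroup.rcos_const[OF lc(5)] subgroup.one_closed[OF lc(5)] by (auto simp: \<pi>_def)
  have sub_iff: "\<pi> ` Q \<subseteq> \<pi> ` P \<longleftrightarrow> Q \<subseteq> P" if "P \<lhd> G" "L \<subseteq> P" "Q \<subseteq> carrier G" for P Q
    unfolding \<pi>_def by (rule r_coset_image_subset_iff[OF L_normal that])
  have Pc: "P \<subseteq> carrier G" if "P \<lhd> G" for P
    using subgroup.subset[OF normal_imp_subgroup[OF that]] .
  have eq_iff: "\<pi> ` Q = \<pi> ` P \<longleftrightarrow> Q = P" if "P \<lhd> G" "L \<subseteq> P" "Q \<lhd> G" "L \<subseteq> Q" for P Q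
    unfolding set_eq_subset
    using sub_iff[OF that(1,2) Pc[OF that(3)]] sub_iff[OF that(3,4) Pc[OF that(1)]] by (simp only:)
  have CK: "\<pi> ` C = \<pi> ` K"
  proof
    show "\<pi> ` K \<subseteq> \<pi> ` C" using K_subset_C by (rule image_mono)
    show "\<pi> ` C \<subseteq> \<pi> ` K"
    proof
      fix y assume "y \<in> \<pi> ` C"
      then obtain l k where lk: "l \<in> L" "k \<in> K" "y = \<pi> (l \<otimes> k)"
        unfolding C_eq(2) by (auto simp: set_mult_def)
      have c: "l \<in> carrier G" "k \<in> carrier G" using lk subgroup.mem_carrier[OF lc(5)] K_carrier by auto
      have "\<pi> (l \<otimes> k) = \<pi> k"
        unfolding \<pi>_def using subgroup_r_coset_eq_iff[OF lc(5), of "l \<otimes> k" k] lk(1) c by (simp add: m_assoc)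
      then show "y \<in> \<pi> ` K" using lk by auto
    qed
  qed
  have min: "minimal_normal_subgroup (G Mod L) (\<pi> ` C)"
    unfolding minimal_normal_subgroup_def
  proof (intro conjI allI impI)
    show "\<pi> ` C \<lhd> G Mod L" unfolding \<pi>_def by (rule normal_r_coset_image[OF L_normal C_normal])
    show "\<pi> ` C \<noteq> {\<one>\<^bsub>G Mod L\<^esub>}"
      using eq_iff[OF L_normal subset_refl C_normal L_subset_C] lc(4) \<pi>L by simp
    fix Y assume Y: "Y \<lhd> G Mod L \<and> Y \<subseteq> \<pi> ` C"
    then obtain P where P: "P \<lhd> G" "L \<subseteq> P" "Y = \<pi> ` P"
      using normal.normal_factor_group_cases[OF L_normal conjunct1[OF Y]] unfolding \<pi>_def by metis
    have "P \<subseteq> C" using sub_iff[OF C_normal L_subset_C Pc[OF P(1)]] Y P(3) by simp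
    then have "P = L \<or> P = C" using lc(7)[OF P(1,2)] by simp
    then show "Y = {\<one>\<^bsub>G Mod L\<^esub>} \<or> Y = \<pi> ` C" using P(3) \<pi>L by metis
  qed
  have uniq: "Y = \<pi> ` C" if Y: "minimal_normal_subgroup (G Mod L) Y" for Y
  proof -
    have Yn: "Y \<lhd> G Mod L" "Y \<noteq> {\<one>\<^bsub>G Mod L\<^esub>}"
      and Ym: "\<And>Z. Z \<lhd> G Mod L \<Longrightarrow> Z \<subseteq> Y \<Longrightarrow> Z = {\<one>\<^bsub>G Mod L\<^esub>} \<or> Z = Y"
      using Y unfolding minimal_normal_subgroup_def by simp_all
    obtain P where P: "P \<lhd> G" "L \<subseteq> P" "Y = \<pi> ` P"
      using normal.normal_factor_group_cases[OF L_normal Yn(1)] unfolding \<pi>_def by metis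
    have "P \<noteq> L" using Yn(2) P(3) \<pi>L by metis
    then have "L \<subset> P" using P(2) by blast
    then obtain C1 where C1: "chief_factor G L C1" "C1 \<subseteq> P"
      using ex_chief_factor_above[OF L_normal P(1)] by blast
    note c1 = chief_factorD[OF C1(1)]
    have "\<not> C1 \<subseteq> M"
      using normal_subset_core[OF M_props(2) c1(2)] c1(3,4) by (auto simp: L_def)
    then interpret S: chief_supplement G M L C1
      using M C1(1) L_subset by unfold_locales
    have "S.L = L" by (simp add: S.L_def L_def)
    then have SC: "centralizer_mod L C1 = C1"
      using S.C_eq(1) set_mult_absorb(2)[OF c1(6,3)] subgroup.one_closed[OF c1(5)] by (simp add: S.C_def)
    have CC1: "C \<inter> C1 = L \<or> C \<inter> C1 = C1"
      by (rule c1(7)[OF normal_subgroup_intersect[OF C_normal c1(2)]]) (use L_subset_C c1(3) in auto)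
    have "C1 = C"
    proof (cases "C \<inter> C1 = L")
      case True
      have "C \<subseteq> centralizer_mod L C1"
      proof
        fix x assume x: "x \<in> C"
        have xc: "x \<in> carrier G" using x C_carrier by blast
        show "x \<in> centralizer_mod L C1"
        proof (rule centralizer_modI[OF lc(5) S.K_carrier xc])
          fix k assume k: "k \<in> C1"
          have kc: "k \<in> carrier G" using k S.K_carrier by blast
          have "x \<otimes> k \<otimes> inv x \<in> C1" using normal_invE(2)[OF c1(2) xc k] .
          then have "x \<otimes> k \<otimes> inv x \<otimes> inv k \<in> C1"
            using subgroup.m_closed[OF c1(6)] subgroup.m_inv_closed[OF c1(6) k] by simp
          moreover have "k \<otimes> inv x \<otimes> inv k \<in> C"
            using normal_invE(2)[OF C_normal kc subgroup.m_inv_closed[OF lc(6) x]] .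
          then have "x \<otimes> (k \<otimes> inv x \<otimes> inv k) \<in> C" using subgroup.m_closed[OF lc(6) x] by simp
          then have "x \<otimes> k \<otimes> inv x \<otimes> inv k \<in> C" using xc kc by (simp add: m_assoc)
          ultimately have "x \<otimes> k \<otimes> inv x \<otimes> inv k \<in> C \<inter> C1" by simp
          then show "x \<otimes> k \<otimes> inv x \<otimes> inv k \<in> L" by (simp only: True)
        qed
      qed
      then have "C \<subseteq> C1" by (simp only: SC)
      then have "C = L" using True by auto
      then show ?thesis using lc(4) by simp
    next
      case False
      then have "C1 \<subseteq> C" using CC1 by auto
      then show ?thesis using lc(7)[OF c1(2,3)] c1(4) by auto
    qed
    moreover have "\<pi> ` C1 = Y"
    proof -
      have "\<pi> ` C1 \<lhd> G Mod L" unfolding \<pi>_def by (rule normal_r_coset_image[OF L_normal c1(2)])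
      moreover have "\<pi> ` C1 \<subseteq> Y" unfolding P(3) using C1(2) by (rule image_mono)
      moreover have "\<pi> ` C1 \<noteq> {\<one>\<^bsub>G Mod L\<^esub>}"
        using eq_iff[OF L_normal subset_refl c1(2,3)] c1(4) \<pi>L by simp
      ultimately show ?thesis using Ym[of "\<pi> ` C1"] by simp
    qed
    ultimately show ?thesis by simp
  qed
  have "(THE Y. minimal_normal_subgroup (G Mod L) Y) = \<pi> ` C"
    using min uniq by (rule the_equality)
  then show ?thesis using CK by (simp add: \<pi>_def)
qed

lemma X_group_simps:
  "carrier (X_group G M) = (\<lambda>x. L #> x) ` K"
  "monoid.mult (X_group G M) = (<#>)"
  using minimal_normal_eq by (simp_all add: X_group_def L_def)

lemma X_action_r_coset:
  assumes "x \<in> K" "g \<in> carrier G"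
  shows "X_action G M (L #> x) g = L #> conj_elt G x g"
proof -
  interpret \<pi>: group_hom G "G Mod L" "\<lambda>x. L #> x" using group_hom_r_coset[OF L_normal] .
  have c: "x \<in> carrier G" using assms K_carrier by blast
  have "X_action G M (L #> x) g =
      inv\<^bsub>G Mod L\<^esub> (L #> g) \<otimes>\<^bsub>G Mod L\<^esub> (L #> x) \<otimes>\<^bsub>G Mod L\<^esub> (L #> g)"
    by (simp add: X_action_def conj_elt_def L_def)
  also have "\<dots> = L #> (inv g \<otimes> x \<otimes> g)"
    using c assms(2) by (simp del: mult_FactGroup)
  finally show ?thesis by (simp add: conj_elt_def)
qed

end

text \<open>Both modules are isomorphic to the common chief factor \<open>K / N\<close>: the cosets of the two cores that
  contain the same element of \<open>K\<close> correspond to each other.\<close>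

lemma (in finite_group) chief_linked_imp_module_isomorphic:
  assumes M: "p_solvable_maximal G M" and M': "p_solvable_maximal G M'" and l: "chief_linked G M M'"
  shows "module_isomorphic G (X_group G M) (X_action G M) (X_group G M') (X_action G M')"
proof -
  obtain N K where NK: "chief_factor G N K" "N \<subseteq> M" "N \<subseteq> M'" "\<not> K \<subseteq> M" "\<not> K \<subseteq> M'"
    using l unfolding chief_linked_def by blast
  interpret A: chief_supplement G M N K using M NK by unfold_locales
  interpret B: chief_supplement G M' N K using M' NK by unfold_locales
  note sK = A.chief_props(6)
  have sL: "subgroup A.L G" "subgroup B.L G"
    using A.L_normal B.L_normal normal_imp_subgroup by auto
  have Kc: "x \<in> carrier G" if "x \<in> K" for x using that A.K_carrier by blast
  have eq_iff: "A.L #> x = A.L #> y \<longleftrightarrow> B.L #> x = B.L #> y" if xy: "x \<in> K" "y \<in> K" for x y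
  proof -
    have "x \<otimes> inv y \<in> K" using xy sK by (simp add: subgroup.m_closed subgroup.m_inv_closed)
    then have "x \<otimes> inv y \<in> A.L \<longleftrightarrow> x \<otimes> inv y \<in> B.L" using A.K_Int_L B.K_Int_L by blast
    then show ?thesis
      using subgroup_r_coset_eq_iff[OF sL(1) Kc[OF xy(1)] Kc[OF xy(2)]]
        subgroup_r_coset_eq_iff[OF sL(2) Kc[OF xy(1)] Kc[OF xy(2)]] by simp
  qed
  define f where "f X = B.L #> (SOME x. x \<in> K \<and> X = A.L #> x)" for X
  have f: "f (A.L #> x) = B.L #> x" if x: "x \<in> K" for x
  proof -
    define y where "y = (SOME y. y \<in> K \<and> A.L #> x = A.L #> y)"
    have y: "y \<in> K \<and> A.L #> x = A.L #> y" unfolding y_def by (rule someI[of _ x]) (simp add: x)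
    have "B.L #> x = B.L #> y" using eq_iff[OF x conjunct1[OF y]] conjunct2[OF y] by blast
    then show ?thesis by (simp add: f_def y_def)
  qed
  have conjK: "conj_elt G x g \<in> K" if "x \<in> K" "g \<in> carrier G" for x g
    unfolding conj_elt_def by (rule normal.inv_op_closed1[OF A.chief_props(2) that(2,1)])
  have "f \<in> hom (X_group G M) (X_group G M')"
  proof (rule homI)
    fix X Y assume "X \<in> carrier (X_group G M)" "Y \<in> carrier (X_group G M)"
    then obtain x y where xy: "x \<in> K" "X = A.L #> x" "y \<in> K" "Y = A.L #> y"
      unfolding A.X_group_simps by blast
    have "f (X <#> Y) = f (A.L #> (x \<otimes> y))"
      using normal.rcos_sum[OF A.L_normal Kc[OF xy(1)] Kc[OF xy(3)]] xy by simp
    also have "\<dots> = B.L #> (x \<otimes> y)" using f subgroup.m_closed[OF sK xy(1,3)] by simp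
    also have "\<dots> = f X <#> f Y"
      using normal.rcos_sum[OF B.L_normal Kc[OF xy(1)] Kc[OF xy(3)]] xy f by simp
    finally show "f (X \<otimes>\<^bsub>X_group G M\<^esub> Y) = f X \<otimes>\<^bsub>X_group G M'\<^esub> f Y"
      by (simp add: A.X_group_simps B.X_group_simps)
  qed (auto simp: A.X_group_simps B.X_group_simps f)
  moreover have "bij_betw f (carrier (X_group G M)) (carrier (X_group G M'))"
    unfolding A.X_group_simps B.X_group_simps bij_betw_def
    by (auto simp: inj_on_def f eq_iff image_image)
  ultimately have "f \<in> iso (X_group G M) (X_group G M')" by (simp add: iso_def)
  moreover have "\<forall>X\<in>carrier (X_group G M). \<forall>g\<in>carrier G.
      f (X_action G M X g) = X_action G M' (f X) g"
    unfolding A.X_group_simps by (auto simp: A.X_action_r_coset B.X_action_r_coset f conjK)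
  ultimately show ?thesis unfolding module_isomorphic_def by blast
qed


section \<open>Counting cosets\<close>

context group
begin

lemma fixed_coset_iff:
  assumes U: "subgroup U G" and "x \<in> carrier G" "g \<in> carrier G"
  shows "(U #> x) #> g = U #> x \<longleftrightarrow> x \<otimes> g \<otimes> inv x \<in> U"
  using assms subgroup_r_coset_eq_iff[OF U, of "x \<otimes> g" x]
  by (simp add: coset_mult_assoc subgroup.subset)

lemma supplement_commute:
  assumes A: "subgroup A G" and B: "subgroup B G" and AB: "A <#> B = carrier G"
  shows "B <#> A = carrier G"
proof
  show "B <#> A \<subseteq> carrier G"
    using setmult_subset_G[OF subgroup.subset[OF B] subgroup.subset[OF A]] .
  show "carrier G \<subseteq> B <#> A"
  proof
    fix x assume x: "x \<in> carrier G"
    then have "inv x \<in> A <#> B" using AB by simp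
    then obtain a b where ab: "a \<in> A" "b \<in> B" "inv x = a \<otimes> b" by (auto simp: set_mult_def)
    have "a \<in> carrier G" "b \<in> carrier G"
      using subgroup.mem_carrier[OF A ab(1)] subgroup.mem_carrier[OF B ab(2)] by simp_all
    then have "inv (inv x) = inv b \<otimes> inv a" unfolding ab(3) by (rule inv_mult_group)
    then have "x = inv b \<otimes> inv a" using x by simp
    then show "x \<in> B <#> A"
      using subgroup.m_inv_closed[OF A ab(1)] subgroup.m_inv_closed[OF B ab(2)]
      by (auto simp: set_mult_def)
  qed
qed

end

context finite_group
begin

lemma finite_rcosets [simp]: "finite (rcosets H)"
  by (simp add: RCOSETS_def)

lemma perm_character_eq_0_iff:
  assumes U: "subgroup U G" and g: "g \<in> carrier G"
  shows "perm_character G U g = 0 \<longleftrightarrow> (\<forall>x\<in>carrier G. x \<otimes> g \<otimes> inv x \<notin> U)"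
proof -
  have "perm_character G U g = 0 \<longleftrightarrow> {D \<in> rcosets U. D #> g = D} = {}"
    using g by (simp add: perm_character_def)
  also have "\<dots> \<longleftrightarrow> (\<forall>x\<in>carrier G. (U #> x) #> g \<noteq> U #> x)"
    by (auto simp: RCOSETS_def)
  also have "\<dots> \<longleftrightarrow> (\<forall>x\<in>carrier G. x \<otimes> g \<otimes> inv x \<notin> U)"
    using fixed_coset_iff[OF U _ g] by simp
  finally show ?thesis .
qed

text \<open>Burnside's counting lemma for the transitive action of \<open>H\<close> on the cosets of \<open>U\<close>.\<close>

lemma sum_fixed_cosets_of_supplement:
  assumes U: "subgroup U G" and H: "subgroup H G" and UH: "U <#> H = carrier G"
  shows "(\<Sum>h\<in>H. card {D \<in> rcosets U. D #> h = D}) = card H"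
proof -
  have Hc: "h \<in> carrier G" if "h \<in> H" for h using subgroup.mem_carrier[OF H that] .
  have finH: "finite H" using finite_subgroup[OF H] .
  have stab: "card {h \<in> H. D #> h = D} = card (U \<inter> H)" if D: "D \<in> rcosets U" for D
  proof -
    obtain y where y: "y \<in> carrier G" "D = U #> y" using D by (auto simp: RCOSETS_def)
    then have "y \<in> U <#> H" using UH by simp
    then obtain u x where ux: "u \<in> U" "x \<in> H" "y = u \<otimes> x" by (auto simp: set_mult_def)
    have c: "u \<in> carrier G" "x \<in> carrier G" using ux Hc subgroup.mem_carrier[OF U ux(1)] by auto
    have D': "D = U #> x"
      using y(2) subgroup_r_coset_eq_iff[OF U y(1) c(2)] ux c by (simp add: m_assoc)
    have "bij_betw (\<lambda>h. x \<otimes> h \<otimes> inv x) {h \<in> H. D #> h = D} (U \<inter> H)"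
    proof (rule bij_betw_byWitness[where f' = "\<lambda>h. inv x \<otimes> h \<otimes> x"])
      show "\<forall>h\<in>{h \<in> H. D #> h = D}. inv x \<otimes> (x \<otimes> h \<otimes> inv x) \<otimes> x = h"
        using Hc c by (simp add: m_assoc)
      show "\<forall>h\<in>U \<inter> H. x \<otimes> (inv x \<otimes> h \<otimes> x) \<otimes> inv x = h"
        using Hc c by (simp add: m_assoc)
      show "(\<lambda>h. x \<otimes> h \<otimes> inv x) ` {h \<in> H. D #> h = D} \<subseteq> U \<inter> H"
        using fixed_coset_iff[OF U c(2)] Hc ux(2) H
        by (auto simp: D' subgroup.m_closed subgroup.m_inv_closed)
      show "(\<lambda>h. inv x \<otimes> h \<otimes> x) ` (U \<inter> H) \<subseteq> {h \<in> H. D #> h = D}"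
      proof
        fix z assume "z \<in> (\<lambda>h. inv x \<otimes> h \<otimes> x) ` (U \<inter> H)"
        then obtain h where h: "h \<in> U" "h \<in> H" "z = inv x \<otimes> h \<otimes> x" by blast
        have "x \<otimes> z \<otimes> inv x = h" using h Hc[OF h(2)] c by (simp add: m_assoc)
        moreover have "z \<in> H" using h ux(2) H by (simp add: subgroup.m_closed subgroup.m_inv_closed)
        ultimately show "z \<in> {h \<in> H. D #> h = D}"
          using fixed_coset_iff[OF U c(2) Hc[of z]] h by (simp add: D')
      qed
    qed
    then show ?thesis by (rule bij_betw_same_card)
  qed
  have "(\<Sum>h\<in>H. card {D \<in> rcosets U. D #> h = D}) = (\<Sum>h\<in>H. \<Sum>D\<in>rcosets U. if D #> h = D then 1 else 0)"
    by (simp add: sum.If_cases Int_def)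
  also have "\<dots> = (\<Sum>D\<in>rcosets U. \<Sum>h\<in>H. if D #> h = D then 1 else 0)" by (rule sum.swap)
  also have "\<dots> = (\<Sum>D\<in>rcosets U. card {h \<in> H. D #> h = D})"
    using finH by (simp add: sum.If_cases Int_def)
  also have "\<dots> = index G U * card (U \<inter> H)" by (simp add: stab index_def)
  finally have *: "(\<Sum>h\<in>H. card {D \<in> rcosets U. D #> h = D}) = index G U * card (U \<inter> H)" .
  have "card U * card H = index G U * card U * card (U \<inter> H)"
    using card_set_mult[OF U H finite_subgroup[OF U] finH] UH index_mult_card[OF U] by simp
  then have "card U * card H = card U * (index G U * card (U \<inter> H))" by (simp add: ac_simps)
  then show ?thesis using * card_subgroup_pos[OF U] by simp
qed

text \<open>Jordan's theorem on transitive actions: on average an element of \<open>U\<close> fixes one coset of \<open>M\<close>, and the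
  identity fixes more than one.\<close>

lemma exists_derangement_of_supplement:
  assumes U: "subgroup U G" and M: "subgroup M G" "M \<noteq> carrier G" and UM: "U <#> M = carrier G"
  shows "\<exists>u\<in>U. \<forall>x\<in>carrier G. x \<otimes> u \<otimes> inv x \<notin> M"
proof (rule ccontr)
  assume "\<not> ?thesis"
  then have ex: "\<exists>x\<in>carrier G. x \<otimes> u \<otimes> inv x \<in> M" if "u \<in> U" for u using that by blast
  define fx where "fx u = card {D \<in> rcosets M. D #> u = D}" for u
  have Uc: "u \<in> carrier G" if "u \<in> U" for u using subgroup.mem_carrier[OF U that] .
  have pos: "1 \<le> fx u" if u: "u \<in> U" for u
  proof -
    obtain x where x: "x \<in> carrier G" "x \<otimes> u \<otimes> inv x \<in> M" using ex[OF u] by blast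
    then have "M #> x \<in> {D \<in> rcosets M. D #> u = D}"
      using fixed_coset_iff[OF M(1) x(1) Uc[OF u]] rcosetsI[OF subgroup.subset[OF M(1)] x(1)] by simp
    then have "{D \<in> rcosets M. D #> u = D} \<noteq> {}" by blast
    then show ?thesis by (simp add: fx_def Suc_le_eq card_gt_0_iff)
  qed
  have one: "\<one> \<in> U" using subgroup.one_closed[OF U] .
  have "fx \<one> = index G M"
  proof -
    have "{D \<in> rcosets M. D #> \<one> = D} = rcosets M"
      using rcosets_part_G[OF M(1)] coset_mult_one by blast
    then show ?thesis by (simp add: fx_def index_def)
  qed
  moreover have "index G M > 1"
  proof (rule ccontr)
    assume "\<not> index G M > 1"
    then have "index G M * card M \<le> 1 * card M" by (intro mult_right_mono) auto
    then have "card (carrier G) \<le> card M" using index_mult_card[OF M(1)] by simp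
    then show False using subgroup_eqI_card[OF subgroup_self subgroup.subset[OF M(1)]] M(2) by simp
  qed
  ultimately have "\<exists>u\<in>U. 1 < fx u" using one by (intro bexI[of _ \<one>]) simp_all
  then have "(\<Sum>u\<in>U. 1) < (\<Sum>u\<in>U. fx u)"
    using pos by (intro sum_strict_mono_ex1 finite_subgroup[OF U]) auto
  then show False
    using sum_fixed_cosets_of_supplement[OF M(1) U supplement_commute[OF U M(1) UM]]
    by (simp add: fx_def)
qed

text \<open>The cosets of the intersection embed into the product of the coset spaces, and by the index condition
  the two sets have the same size.\<close>

lemma complete_intersection_common_coset:
  assumes I: "finite I" and F: "\<And>i. i \<in> I \<Longrightarrow> subgroup (F i) G"
    and ind: "index G (family_inter G I F) = (\<Prod>i\<in>I. index G (F i))"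
    and x: "\<And>i. i \<in> I \<Longrightarrow> x i \<in> carrier G"
  shows "\<exists>g\<in>carrier G. \<forall>i\<in>I. F i #> x i = F i #> g"
proof -
  define V where "V = family_inter G I F"
  have sV: "subgroup V G" unfolding V_def using subgroup_family_inter F by simp
  have VF: "V \<subseteq> F i" if "i \<in> I" for i using that by (auto simp: V_def family_inter_def)
  define \<Phi> where "\<Phi> D = (\<lambda>i\<in>I. F i <#> D)" for D
  have \<Phi>: "\<Phi> (V #> g) = (\<lambda>i\<in>I. F i #> g)" if g: "g \<in> carrier G" for g
  proof -
    have "F i <#> (V #> g) = F i #> g" if i: "i \<in> I" for i
    proof -
      have "F i <#> (V #> g) = (F i <#> V) #> g"
        using setmult_rcos_assoc[OF subgroup.subset[OF F[OF i]] subgroup.subset[OF sV] g] .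
      also have "F i <#> V = F i"
        by (rule set_mult_absorb(2)[OF F[OF i] VF[OF i] subgroup.one_closed[OF sV]])
      finally show ?thesis .
    qed
    then show ?thesis unfolding \<Phi>_def by (intro restrict_ext) simp
  qed
  have inj: "inj_on \<Phi> (rcosets V)"
  proof (rule inj_onI)
    fix D E assume "D \<in> rcosets V" "E \<in> rcosets V" and eq: "\<Phi> D = \<Phi> E"
    then obtain g h where gh: "g \<in> carrier G" "D = V #> g" "h \<in> carrier G" "E = V #> h"
      by (auto simp: RCOSETS_def)
    have "g \<otimes> inv h \<in> F i" if i: "i \<in> I" for i
    proof -
      have "F i #> g = F i #> h"
        using fun_cong[OF eq[unfolded gh(2,4) \<Phi>[OF gh(1)] \<Phi>[OF gh(3)]], of i] i by simp
      then show ?thesis using subgroup_r_coset_eq_iff[OF F[OF i] gh(1,3)] by simp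
    qed
    then have "g \<otimes> inv h \<in> V" using gh by (simp add: V_def family_inter_def)
    then show "D = E" using subgroup_r_coset_eq_iff[OF sV gh(1,3)] gh by simp
  qed
  have "\<Phi> ` (rcosets V) = (\<Pi>\<^sub>E i\<in>I. rcosets (F i))"
  proof (rule card_seteq)
    show "finite (\<Pi>\<^sub>E i\<in>I. rcosets (F i))" using I by (simp add: finite_PiE)
    show "\<Phi> ` (rcosets V) \<subseteq> (\<Pi>\<^sub>E i\<in>I. rcosets (F i))"
    proof
      fix \<phi> assume "\<phi> \<in> \<Phi> ` (rcosets V)"
      then obtain g where "g \<in> carrier G" "\<phi> = \<Phi> (V #> g)" by (auto simp: RCOSETS_def)
      then show "\<phi> \<in> (\<Pi>\<^sub>E i\<in>I. rcosets (F i))"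
        using \<Phi> rcosetsI[OF subgroup.subset[OF F]] by auto
    qed
    have "card (\<Pi>\<^sub>E i\<in>I. rcosets (F i)) = (\<Prod>i\<in>I. index G (F i))"
      using I by (simp add: card_PiE index_def)
    then show "card (\<Pi>\<^sub>E i\<in>I. rcosets (F i)) \<le> card (\<Phi> ` (rcosets V))"
      using ind by (simp add: card_image[OF inj] V_def[symmetric] index_def)
  qed
  moreover have "(\<lambda>i\<in>I. F i #> x i) \<in> (\<Pi>\<^sub>E i\<in>I. rcosets (F i))"
    using rcosetsI[OF subgroup.subset[OF F] x] by auto
  ultimately have "(\<lambda>i\<in>I. F i #> x i) \<in> \<Phi> ` (rcosets V)" by simp
  then obtain D where D: "D \<in> rcosets V" "(\<lambda>i\<in>I. F i #> x i) = \<Phi> D" by blast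
  then obtain g where g: "g \<in> carrier G" "D = V #> g" by (auto simp: RCOSETS_def)
  have "F i #> x i = F i #> g" if i: "i \<in> I" for i
    using fun_cong[OF D(2)[unfolded g(2) \<Phi>[OF g(1)]], of i] i by simp
  then show ?thesis using g(1) by blast
qed

text \<open>Containments up to conjugacy are handled elementwise from here on; note that \<open>conj_set G U x\<close> is
  \<open>x\<^sup>-\<^sup>1 U x\<close>, while the elements \<open>g\<close> on the right act by \<open>u \<mapsto> g u g\<^sup>-\<^sup>1\<close>.\<close>

lemma conjugate_to_subgroup_of_iff:
  assumes U: "subgroup U G" and V: "subgroup V G"
  shows "conjugate_to_subgroup_of G U V \<longleftrightarrow> (\<exists>g\<in>carrier G. \<forall>u\<in>U. g \<otimes> u \<otimes> inv g \<in> V)"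
proof
  assume "conjugate_to_subgroup_of G U V"
  then obtain x where x: "x \<in> carrier G" "subgroup (conj_set G U x) (G\<lparr>carrier := V\<rparr>)"
    by (auto simp: conjugate_to_subgroup_of_def)
  have sub: "conj_set G U x \<subseteq> V" using subgroup.subset[OF x(2)] by simp
  have "inv x \<otimes> u \<otimes> inv (inv x) \<in> V" if u: "u \<in> U" for u
    using sub u x(1) by (auto simp: conj_set_def conj_elt_def)
  then show "\<exists>g\<in>carrier G. \<forall>u\<in>U. g \<otimes> u \<otimes> inv g \<in> V" using inv_closed[OF x(1)] by blast
next
  assume "\<exists>g\<in>carrier G. \<forall>u\<in>U. g \<otimes> u \<otimes> inv g \<in> V"
  then obtain g where g: "g \<in> carrier G" "\<And>u. u \<in> U \<Longrightarrow> g \<otimes> u \<otimes> inv g \<in> V" by blast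
  define f where "f u = g \<otimes> u \<otimes> inv g" for u
  interpret f: group_hom G G f
    by (unfold_locales, rule homI) (use g(1) in \<open>auto simp: f_def m_assoc\<close>)
  have "conj_set G U (inv g) = f ` U" using g(1) by (simp add: conj_set_def conj_elt_def f_def)
  moreover have "subgroup (f ` U) G" by (rule f.subgroup_img_is_subgroup[OF U])
  moreover have "f ` U \<subseteq> V" using g(2) by (auto simp: f_def)
  ultimately have "subgroup (conj_set G U (inv g)) (G\<lparr>carrier := V\<rparr>)"
    using subgroup_incl[OF _ V] by simp
  then show "conjugate_to_subgroup_of G U V"
    using g(1) unfolding conjugate_to_subgroup_of_def by blast
qed

lemma vanishes_off_conjugates_iff:
  assumes U: "subgroup U G" and V: "subgroup V G"
    and \<chi>: "\<forall>g\<in>carrier G. cnj (\<chi> g) * \<chi> g = perm_character G U g"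
  shows "vanishes_off_conjugates G \<chi> V \<longleftrightarrow> (\<forall>u\<in>U. \<exists>x\<in>carrier G. x \<otimes> u \<otimes> inv x \<in> V)"
proof -
  have Vc: "V \<subseteq> carrier G" using subgroup.subset[OF V] .
  have zero: "\<chi> g = 0 \<longleftrightarrow> (\<forall>x\<in>carrier G. x \<otimes> g \<otimes> inv x \<notin> U)" if g: "g \<in> carrier G" for g
    using perm_character_eq_0_iff[OF U g] bspec[OF \<chi> g] by auto
  have union: "g \<in> (\<Union>x\<in>carrier G. conj_set G V x) \<longleftrightarrow> (\<exists>x\<in>carrier G. x \<otimes> g \<otimes> inv x \<in> V)"
    if g: "g \<in> carrier G" for g
    using mem_conj_set_iff[OF Vc _ g] by simp
  show ?thesis
  proof
    assume van: "vanishes_off_conjugates G \<chi> V"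
    show "\<forall>u\<in>U. \<exists>x\<in>carrier G. x \<otimes> u \<otimes> inv x \<in> V"
    proof
      fix u assume u: "u \<in> U"
      have uc: "u \<in> carrier G" using subgroup.mem_carrier[OF U u] .
      have "\<one> \<otimes> u \<otimes> inv \<one> \<in> U" using u uc by simp
      then have "\<chi> u \<noteq> 0" using zero[OF uc] one_closed by blast
      then show "\<exists>x\<in>carrier G. x \<otimes> u \<otimes> inv x \<in> V"
        using van uc union[OF uc] unfolding vanishes_off_conjugates_def by blast
    qed
  next
    assume cov: "\<forall>u\<in>U. \<exists>x\<in>carrier G. x \<otimes> u \<otimes> inv x \<in> V"
    show "vanishes_off_conjugates G \<chi> V"
      unfolding vanishes_off_conjugates_def
    proof (rule ballI, rule ccontr)
      fix g assume g: "g \<in> carrier G - (\<Union>x\<in>carrier G. conj_set G V x)" and nz: "\<chi> g \<noteq> 0"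
      have gc: "g \<in> carrier G" using g by simp
      obtain x where x: "x \<in> carrier G" "x \<otimes> g \<otimes> inv x \<in> U" using zero[OF gc] nz by blast
      obtain y where y: "y \<in> carrier G" "y \<otimes> (x \<otimes> g \<otimes> inv x) \<otimes> inv y \<in> V" using cov x(2) by blast
      have "(y \<otimes> x) \<otimes> g \<otimes> inv (y \<otimes> x) \<in> V"
        using y x(1) gc by (simp add: inv_mult_group m_assoc)
      then have "g \<in> (\<Union>x\<in>carrier G. conj_set G V x)" using union[OF gc] m_closed[OF y(1) x(1)] by blast
      then show False using g by simp
    qed
  qed
qed

end


section \<open>A norm criterion for irreducibility\<close>

lemma mat_mult_entry:
  assumes "A \<in> carrier_mat n n" "B \<in> carrier_mat n n" "i < n" "j < n"
  shows "(A * B) $$ (i, j) = (\<Sum>k<n. A $$ (i, k) * B $$ (k, j))"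
  using assms by (simp add: scalar_prod_def atLeast0LessThan)

lemma mat_vec_entry:
  assumes "A \<in> carrier_mat n n" "v \<in> carrier_vec n" "i < n"
  shows "(A *\<^sub>v v) $ i = (\<Sum>k<n. A $$ (i, k) * v $ k)"
  using assms by (simp add: scalar_prod_def atLeast0LessThan)

lemma mat_trace_carrier:
  "A \<in> carrier_mat n n \<Longrightarrow> mat_trace A = (\<Sum>i<n. A $$ (i, i))"
  by (simp add: mat_trace_def)

lemma mat_trace_mult_commute:
  fixes A B :: "complex mat"
  assumes "A \<in> carrier_mat n n" "B \<in> carrier_mat n n"
  shows "mat_trace (A * B) = mat_trace (B * A)"
proof -
  have "mat_trace (A * B) = (\<Sum>i<n. \<Sum>k<n. A $$ (i, k) * B $$ (k, i))"
    using assms by (simp add: mat_trace_carrier[of _ n] mat_mult_entry del: index_mult_mat)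
  also have "\<dots> = (\<Sum>k<n. \<Sum>i<n. B $$ (k, i) * A $$ (i, k))"
    by (subst sum.swap) (simp add: mult.commute)
  also have "\<dots> = mat_trace (B * A)"
    using assms by (simp add: mat_trace_carrier[of _ n] mat_mult_entry del: index_mult_mat)
  finally show ?thesis .
qed

text \<open>An upper triangular form of an idempotent matrix has only \<open>0\<close> and \<open>1\<close> on the diagonal, and \<open>1\<close>
  occurs if it is an eigenvalue.\<close>

lemma idempotent_mat_trace:
  fixes A :: "complex mat"
  assumes A: "A \<in> carrier_mat N N" and idem: "A * A = A"
  shows "0 \<le> Re (mat_trace A)"
    and "\<lbrakk>v \<in> carrier_vec N; v \<noteq> 0\<^sub>v N; A *\<^sub>v v = v\<rbrakk> \<Longrightarrow> 1 \<le> Re (mat_trace A)"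
proof -
  obtain es where es: "char_poly A = (\<Prod>a\<leftarrow>es. [:- a, 1:])" using char_poly_factorized[OF A] by blast
  obtain B P Q where dec: "schur_decomposition A es = (B, P, Q)"
    by (cases "schur_decomposition A es") auto
  have sch: "similar_mat_wit A B P Q" "upper_triangular B"
    using schur_decomposition[OF A es dec] by auto
  note w = similar_mat_witD2[OF A sch(1)]
  have B: "B \<in> carrier_mat N N" and P: "P \<in> carrier_mat N N" and Q: "Q \<in> carrier_mat N N"
    using w by auto
  have BQAP: "B = Q * A * P"
  proof -
    have "Q * A * P = (Q * P) * B * (Q * P)"
      unfolding w(3) using B P Q by (simp add: assoc_mult_mat[of _ N N _ N _ N])
    then show ?thesis using w(2) B by simp
  qed
  have BB: "B * B = B"
  proof -
    have "B * B = Q * A * (P * Q) * A * P"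
      unfolding BQAP using A P Q by (simp add: assoc_mult_mat[of _ N N _ N _ N])
    also have "\<dots> = Q * (A * A) * P"
      unfolding w(1) using A P Q by (simp add: assoc_mult_mat[of _ N N _ N _ N])
    finally show ?thesis unfolding idem BQAP[symmetric] .
  qed
  have "mat_trace A = mat_trace (P * (B * Q))"
    using w(3) B P Q by (simp add: assoc_mult_mat[of _ N N _ N _ N])
  also have "\<dots> = mat_trace ((B * Q) * P)"
    by (rule mat_trace_mult_commute[of _ N]) (use B P Q in auto)
  also have "(B * Q) * P = B" using w(2) B P Q by (simp add: assoc_mult_mat[of _ N N _ N _ N])
  finally have tr: "mat_trace A = (\<Sum>i<N. B $$ (i, i))" using B by (simp add: mat_trace_carrier)
  have diag: "B $$ (i, i) = 0 \<or> B $$ (i, i) = 1" if i: "i < N" for i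
  proof -
    have "B $$ (i, i) = (\<Sum>k<N. B $$ (i, k) * B $$ (k, i))"
      using mat_mult_entry[OF B B i i] BB by simp
    also have "\<dots> = (\<Sum>k\<in>{i}. B $$ (i, k) * B $$ (k, i))"
    proof (rule sum.mono_neutral_right)
      show "\<forall>k\<in>{..<N} - {i}. B $$ (i, k) * B $$ (k, i) = 0"
      proof
        fix k assume k: "k \<in> {..<N} - {i}"
        show "B $$ (i, k) * B $$ (k, i) = 0"
        proof (cases "k < i")
          case True
          then show ?thesis using upper_triangularD[OF sch(2) True] i B by simp
        next
          case False
          then have "i < k" using k by auto
          then show ?thesis using upper_triangularD[OF sch(2) \<open>i < k\<close>] k B by simp
        qed
      qed
    qed (use i in auto)
    finally have "B $$ (i, i) * (B $$ (i, i) - 1) = 0" by (simp add: algebra_simps)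
    then show ?thesis by simp
  qed
  have nonneg: "0 \<le> Re (B $$ (i, i))" if "i \<in> {..<N}" for i using diag[of i] that by auto
  then show "0 \<le> Re (mat_trace A)" unfolding tr Re_sum by (rule sum_nonneg)
  assume v: "v \<in> carrier_vec N" "v \<noteq> 0\<^sub>v N" "A *\<^sub>v v = v"
  have "eigenvector A v 1" using v A by (simp add: eigenvector_def)
  then have "eigenvalue A 1" by (auto simp: eigenvalue_def)
  then have "poly (char_poly A) 1 = 0" using eigenvalue_root_char_poly[OF A] by blast
  also have "char_poly A = char_poly B"
    by (rule char_poly_similar) (use sch(1) in \<open>auto simp: similar_mat_def\<close>)
  also have "\<dots> = (\<Prod>a\<leftarrow>diag_mat B. [:- a, 1:])" by (rule char_poly_upper_triangular[OF B sch(2)])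
  finally have "1 \<in> set (diag_mat B)" by (auto simp: poly_prod_list prod_list_zero_iff)
  then obtain i where i: "i < N" "B $$ (i, i) = 1" using B by (auto simp: diag_mat_def)
  have "1 = Re (B $$ (i, i))" using i by simp
  also have "\<dots> \<le> (\<Sum>i<N. Re (B $$ (i, i)))"
    by (rule member_le_sum) (use i nonneg in auto)
  finally show "1 \<le> Re (mat_trace A)" by (simp add: tr)
qed

lemma sum_div_mod:
  fixes f :: "nat \<Rightarrow> nat \<Rightarrow> 'a::comm_monoid_add"
  shows "(\<Sum>a<n * n. f (a div n) (a mod n)) = (\<Sum>i<n. \<Sum>j<n. f i j)"
proof -
  have "(\<Sum>i<n. \<Sum>j<n. f i j) = (\<Sum>p\<in>{..<n} \<times> {..<n}. f (fst p) (snd p))"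
    by (simp add: sum.cartesian_product split_def)
  also have "\<dots> = (\<Sum>a<n * n. f (a div n) (a mod n))"
  proof (rule sum.reindex_bij_witness[where i = "\<lambda>a. (a div n, a mod n)" and j = "\<lambda>p. fst p * n + snd p"])
    fix p assume p: "p \<in> {..<n} \<times> {..<n}"
    show "fst p * n + snd p \<in> {..<n * n}"
    proof -
      have "fst p * n + snd p < fst p * n + n" using p by auto
      also have "\<dots> = (fst p + 1) * n" by simp
      also have "\<dots> \<le> n * n" using p by (intro mult_right_mono) auto
      finally show ?thesis by simp
    qed
  next
    fix a assume a: "a \<in> {..<n * n}"
    then have "n > 0" by (cases n) auto
    then show "(a div n, a mod n) \<in> {..<n} \<times> {..<n}" using a by (simp add: less_mult_imp_div_less)
  qed auto
  finally show ?thesis by simp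
qed

text \<open>The operator that sends \<open>Y\<close> to the average of \<open>A v Y B v\<close> over \<open>v \<in> H\<close> is idempotent, and its trace is
  the average of \<open>tr (A v) tr (B v)\<close>. It is written as a matrix \<open>T\<close> of size \<open>n\<^sup>2\<close>, with the pair \<open>(i, j)\<close>
  encoded as \<open>i n + j\<close>. The values \<open>A \<one>\<close> and \<open>B \<one>\<close> may be proper idempotents, which is how
  subrepresentations and quotients are treated inside the full matrix space.\<close>

lemma averaged_tensor_trace:
  fixes H (structure) and A B :: "'g \<Rightarrow> complex mat"
  assumes H: "group H" and fin: "finite (carrier H)"
    and A: "\<And>v. v \<in> carrier H \<Longrightarrow> A v \<in> carrier_mat n n"
    and B: "\<And>v. v \<in> carrier H \<Longrightarrow> B v \<in> carrier_mat n n"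
    and AA: "\<And>v w. v \<in> carrier H \<Longrightarrow> w \<in> carrier H \<Longrightarrow> A v * A w = A (v \<otimes> w)"
    and BB: "\<And>v w. v \<in> carrier H \<Longrightarrow> w \<in> carrier H \<Longrightarrow> B w * B v = B (v \<otimes> w)"
  shows "0 \<le> Re (\<Sum>v\<in>carrier H. mat_trace (A v) * mat_trace (B v))"
    and "\<lbrakk>Y \<in> carrier_mat n n; Y \<noteq> 0\<^sub>m n n; \<And>v. v \<in> carrier H \<Longrightarrow> A v * Y * B v = Y\<rbrakk> \<Longrightarrow>
      real (card (carrier H)) \<le> Re (\<Sum>v\<in>carrier H. mat_trace (A v) * mat_trace (B v))"
proof -
  interpret group H by (rule H)
  define N where "N = card (carrier H)"
  have N: "N > 0" using fin one_closed by (auto simp: N_def card_gt_0_iff)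
  define c :: complex where "c = 1 / of_nat N"
  have c: "c * of_nat N = 1" using N by (simp add: c_def)
  define k where "k i j p q = c * (\<Sum>v\<in>carrier H. A v $$ (i, p) * B v $$ (q, j))" for i j p q
  define T where "T = mat (n * n) (n * n) (\<lambda>(a, b). k (a div n) (a mod n) (b div n) (b mod n))"
  have T: "T \<in> carrier_mat (n * n) (n * n)" by (simp add: T_def)
  have lt: "a div n < n" "a mod n < n" if "a < n * n" for a
  proof -
    have "n > 0" using that by (cases n) auto
    then show "a div n < n" "a mod n < n" using that by (auto simp: less_mult_imp_div_less)
  qed
  have kk: "(\<Sum>r<n. \<Sum>s<n. k i j r s * k r s p q) = k i j p q"
    if ij: "i < n" "j < n" "p < n" "q < n" for i j p q
  proof -
    have "(\<Sum>r<n. \<Sum>s<n. k i j r s * k r s p q) =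
        (\<Sum>r<n. \<Sum>s<n. \<Sum>v\<in>carrier H. \<Sum>w\<in>carrier H.
          c * c * ((A v $$ (i, r) * A w $$ (r, p)) * (B w $$ (q, s) * B v $$ (s, j))))"
      unfolding k_def
      by (intro sum.cong refl) (simp add: sum_distrib_left sum_distrib_right sum_product ac_simps)
    also have "\<dots> = (\<Sum>v\<in>carrier H. \<Sum>w\<in>carrier H. \<Sum>r<n. \<Sum>s<n.
          c * c * ((A v $$ (i, r) * A w $$ (r, p)) * (B w $$ (q, s) * B v $$ (s, j))))"
      by (simp only: sum.swap[of _ "carrier H" "{..<n}"])
    also have "\<dots> = (\<Sum>v\<in>carrier H. \<Sum>w\<in>carrier H. c * c * (A (v \<otimes> w) $$ (i, p) * B (v \<otimes> w) $$ (q, j)))"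
    proof (intro sum.cong refl)
      fix v w assume vw: "v \<in> carrier H" "w \<in> carrier H"
      have "A (v \<otimes> w) $$ (i, p) = (\<Sum>r<n. A v $$ (i, r) * A w $$ (r, p))"
        using mat_mult_entry[OF A[OF vw(1)] A[OF vw(2)] ij(1,3)] AA[OF vw] by simp
      moreover have "B (v \<otimes> w) $$ (q, j) = (\<Sum>s<n. B w $$ (q, s) * B v $$ (s, j))"
        using mat_mult_entry[OF B[OF vw(2)] B[OF vw(1)] ij(4,2)] BB[OF vw] by simp
      ultimately show "(\<Sum>r<n. \<Sum>s<n. c * c * ((A v $$ (i, r) * A w $$ (r, p)) * (B w $$ (q, s) * B v $$ (s, j)))) =
          c * c * (A (v \<otimes> w) $$ (i, p) * B (v \<otimes> w) $$ (q, j))"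
        by (simp only: sum_product) (simp only: sum_distrib_left)
    qed
    also have "\<dots> = (\<Sum>v\<in>carrier H. \<Sum>u\<in>carrier H. c * c * (A u $$ (i, p) * B u $$ (q, j)))"
    proof (rule sum.cong[OF refl])
      fix v assume v: "v \<in> carrier H"
      show "(\<Sum>w\<in>carrier H. c * c * (A (v \<otimes> w) $$ (i, p) * B (v \<otimes> w) $$ (q, j))) =
          (\<Sum>u\<in>carrier H. c * c * (A u $$ (i, p) * B u $$ (q, j)))"
        by (rule sum.reindex_bij_witness[where i = "\<lambda>u. inv v \<otimes> u" and j = "\<lambda>w. v \<otimes> w"])
          (use v in \<open>auto simp: m_assoc[symmetric]\<close>)
    qed
    also have "\<dots> = c * of_nat N * k i j p q"
      by (simp add: k_def N_def sum_distrib_left ac_simps)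
    finally show ?thesis by (simp add: c)
  qed
  have idem: "T * T = T"
  proof (rule eq_matI)
    fix a b assume ab: "a < dim_row T" "b < dim_col T"
    then have ab': "a < n * n" "b < n * n" by (auto simp: T_def)
    have "(T * T) $$ (a, b) = (\<Sum>d<n * n. T $$ (a, d) * T $$ (d, b))"
      by (rule mat_mult_entry[OF T T ab'])
    also have "\<dots> = (\<Sum>d<n * n. k (a div n) (a mod n) (d div n) (d mod n) * k (d div n) (d mod n) (b div n) (b mod n))"
      using ab' by (intro sum.cong) (auto simp: T_def)
    also have "\<dots> = (\<Sum>r<n. \<Sum>s<n. k (a div n) (a mod n) r s * k r s (b div n) (b mod n))"
      by (rule sum_div_mod)
    also have "\<dots> = T $$ (a, b)" using kk lt ab' by (simp add: T_def)
    finally show "(T * T) $$ (a, b) = T $$ (a, b)" .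
  qed (auto simp: T_def)
  have tr: "mat_trace T = c * (\<Sum>v\<in>carrier H. mat_trace (A v) * mat_trace (B v))"
  proof -
    have "mat_trace T = (\<Sum>a<n * n. k (a div n) (a mod n) (a div n) (a mod n))"
      using T by (simp add: mat_trace_carrier) (simp add: T_def)
    also have "\<dots> = (\<Sum>i<n. \<Sum>j<n. k i j i j)" by (rule sum_div_mod)
    also have "\<dots> = (\<Sum>i<n. \<Sum>j<n. \<Sum>v\<in>carrier H. c * (A v $$ (i, i) * B v $$ (j, j)))"
      by (simp add: k_def sum_distrib_left)
    also have "\<dots> = (\<Sum>v\<in>carrier H. \<Sum>i<n. \<Sum>j<n. c * (A v $$ (i, i) * B v $$ (j, j)))"
      by (simp only: sum.swap[of _ "carrier H" "{..<n}"])
    also have "\<dots> = (\<Sum>v\<in>carrier H. c * (mat_trace (A v) * mat_trace (B v)))"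
      by (intro sum.cong refl) (simp only: mat_trace_carrier[OF A] mat_trace_carrier[OF B] sum_product, simp only: sum_distrib_left)
    finally show ?thesis by (simp add: sum_distrib_left)
  qed
  have "Re (mat_trace T) = Re (\<Sum>v\<in>carrier H. mat_trace (A v) * mat_trace (B v)) / N"
    by (simp add: tr c_def)
  then have Re: "Re (\<Sum>v\<in>carrier H. mat_trace (A v) * mat_trace (B v)) = N * Re (mat_trace T)"
    using N by (simp add: field_simps)
  show "0 \<le> Re (\<Sum>v\<in>carrier H. mat_trace (A v) * mat_trace (B v))"
    unfolding Re using idempotent_mat_trace(1)[OF T idem] by simp
  assume Y: "Y \<in> carrier_mat n n" "Y \<noteq> 0\<^sub>m n n" "\<And>v. v \<in> carrier H \<Longrightarrow> A v * Y * B v = Y"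
  define y where "y = vec (n * n) (\<lambda>a. Y $$ (a div n, a mod n))"
  have y: "y \<in> carrier_vec (n * n)" by (simp add: y_def)
  have "1 \<le> Re (mat_trace T)"
  proof (rule idempotent_mat_trace(2)[OF T idem y])
    obtain i j where ij: "i < n" "j < n" "Y $$ (i, j) \<noteq> 0"
      using Y(1,2) by (auto simp: mat_eq_iff)
    have "i * n + j < n * n"
    proof -
      have "i * n + j < (i + 1) * n" using ij by simp
      also have "\<dots> \<le> n * n" using ij by (intro mult_right_mono) auto
      finally show ?thesis .
    qed
    moreover have "y $ (i * n + j) \<noteq> 0" using calculation ij by (simp add: y_def)
    ultimately show "y \<noteq> 0\<^sub>v (n * n)" by auto
    show "T *\<^sub>v y = y"
    proof (rule eq_vecI)
      fix a assume "a < dim_vec y"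
      then have a: "a < n * n" by (simp add: y_def)
      let ?i = "a div n" and ?j = "a mod n"
      have "(T *\<^sub>v y) $ a = (\<Sum>d<n * n. T $$ (a, d) * y $ d)" by (rule mat_vec_entry[OF T y a])
      also have "\<dots> = (\<Sum>d<n * n. k ?i ?j (d div n) (d mod n) * Y $$ (d div n, d mod n))"
        using a by (intro sum.cong) (auto simp: T_def y_def)
      also have "\<dots> = (\<Sum>r<n. \<Sum>s<n. k ?i ?j r s * Y $$ (r, s))" by (rule sum_div_mod)
      also have "\<dots> = (\<Sum>r<n. \<Sum>s<n. \<Sum>v\<in>carrier H. c * (A v $$ (?i, r) * Y $$ (r, s) * B v $$ (s, ?j)))"
        by (simp add: k_def sum_distrib_left sum_distrib_right ac_simps)
      also have "\<dots> = (\<Sum>v\<in>carrier H. \<Sum>r<n. \<Sum>s<n. c * (A v $$ (?i, r) * Y $$ (r, s) * B v $$ (s, ?j)))"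
        by (simp only: sum.swap[of _ "carrier H" "{..<n}"])
      also have "\<dots> = (\<Sum>v\<in>carrier H. c * Y $$ (?i, ?j))"
      proof (intro sum.cong refl)
        fix v assume v: "v \<in> carrier H"
        have AY: "A v * Y \<in> carrier_mat n n" using A[OF v] Y(1) by simp
        have "Y $$ (?i, ?j) = (\<Sum>s<n. (A v * Y) $$ (?i, s) * B v $$ (s, ?j))"
          using mat_mult_entry[OF AY B[OF v] lt[OF a]] Y(3)[OF v] by simp
        also have "\<dots> = (\<Sum>s<n. \<Sum>r<n. A v $$ (?i, r) * Y $$ (r, s) * B v $$ (s, ?j))"
          using mat_mult_entry[OF A[OF v] Y(1) lt(1)[OF a]]
          by (intro sum.cong refl) (simp add: sum_distrib_right)
        also have "\<dots> = (\<Sum>r<n. \<Sum>s<n. A v $$ (?i, r) * Y $$ (r, s) * B v $$ (s, ?j))"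
          by (rule sum.swap)
        finally show "(\<Sum>r<n. \<Sum>s<n. c * (A v $$ (?i, r) * Y $$ (r, s) * B v $$ (s, ?j))) = c * Y $$ (?i, ?j)"
          by (simp add: sum_distrib_left)
      qed
      also have "\<dots> = c * of_nat N * Y $$ (?i, ?j)" by (simp add: N_def)
      also have "\<dots> = y $ a" using a by (simp add: c y_def)
      finally show "(T *\<^sub>v y) $ a = y $ a" .
    qed (use T in \<open>simp add: y_def\<close>)
  qed
  then have "real N * 1 \<le> real N * Re (mat_trace T)" by (intro mult_left_mono) auto
  then show "real (card (carrier H)) \<le> Re (\<Sum>v\<in>carrier H. mat_trace (A v) * mat_trace (B v))"
    unfolding Re by (simp add: N_def)
qed

lemma vector_space_seq: "vector_space (\<lambda>(c::complex) (f::nat \<Rightarrow> complex) i. c * f i)"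
  by unfold_locales (auto simp: fun_eq_iff algebra_simps)

lemma sum_fun_apply: "(\<Sum>j\<in>A. F j) i = (\<Sum>j\<in>A. F j i)"
  by (induction A rule: infinite_finite_induct) auto

text \<open>Embedding vectors of length \<open>n\<close> into the space of all sequences makes the existence of projections
  for abstract vector spaces available.\<close>

lemma ex_projection_mat:
  fixes W :: "complex vec set"
  assumes W: "W \<subseteq> carrier_vec n" "0\<^sub>v n \<in> W"
    and add: "\<And>v w. v \<in> W \<Longrightarrow> w \<in> W \<Longrightarrow> v + w \<in> W"
    and smult: "\<And>c v. v \<in> W \<Longrightarrow> c \<cdot>\<^sub>v v \<in> W"
  shows "\<exists>P\<in>carrier_mat n n. (\<forall>v\<in>carrier_vec n. P *\<^sub>v v \<in> W) \<and> (\<forall>w\<in>W. P *\<^sub>v w = w)"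
proof -
  define sc :: "complex \<Rightarrow> (nat \<Rightarrow> complex) \<Rightarrow> nat \<Rightarrow> complex" where "sc c f i = c * f i" for c f i
  interpret S: vector_space sc unfolding sc_def[abs_def] by (rule vector_space_seq)
  interpret SS: vector_space_pair sc sc by unfold_locales
  define ex where "ex v i = (if i < n then v $ i else 0)" for v :: "complex vec" and i
  have ex_add: "ex (v + w) = ex v + ex w" if "v \<in> carrier_vec n" "w \<in> carrier_vec n" for v w
    using that by (auto simp: ex_def fun_eq_iff)
  have ex_smult: "ex (c \<cdot>\<^sub>v v) = sc c (ex v)" if "v \<in> carrier_vec n" for c v
    using that by (auto simp: ex_def sc_def fun_eq_iff)
  have ex_vec: "vec n (ex v) = v" if "v \<in> carrier_vec n" for v
    using that by (auto simp: ex_def)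
  have sub: "S.subspace (ex ` W)"
  proof (rule S.subspaceI)
    have "ex (0\<^sub>v n) = 0" by (auto simp: ex_def fun_eq_iff)
    then show "0 \<in> ex ` W" using W(2) by (metis image_eqI)
    show "x + y \<in> ex ` W" if xy: "x \<in> ex ` W" "y \<in> ex ` W" for x y
    proof -
      obtain v w where vw: "v \<in> W" "x = ex v" "w \<in> W" "y = ex w" using xy by blast
      have "x + y = ex (v + w)" using ex_add[OF subsetD[OF W(1) vw(1)] subsetD[OF W(1) vw(3)]] vw by simp
      then show ?thesis using add[OF vw(1,3)] by blast
    qed
    show "sc c x \<in> ex ` W" if x: "x \<in> ex ` W" for c x
    proof -
      obtain v where v: "v \<in> W" "x = ex v" using x by blast
      have "sc c x = ex (c \<cdot>\<^sub>v v)" using ex_smult v W(1) by auto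
      then show ?thesis using smult[OF v(1)] by blast
    qed
  qed
  obtain p where p: "p ` UNIV \<subseteq> ex ` W" "Vector_Spaces.linear sc sc p" "\<forall>v\<in>ex ` W. p v = v"
    using SS.linear_exists_left_inverse_on[OF S.linear_id sub] by auto
  interpret p: Vector_Spaces.linear sc sc p by (rule p(2))
  define e :: "nat \<Rightarrow> nat \<Rightarrow> complex" where "e j i = (if i = j then 1 else 0)" for i j
  define P where "P = mat n n (\<lambda>(i, j). p (e j) i)"
  have P: "P \<in> carrier_mat n n" by (simp add: P_def)
  have Pv: "P *\<^sub>v v = vec n (p (ex v))" if v: "v \<in> carrier_vec n" for v
  proof (rule eq_vecI)
    fix i assume "i < dim_vec (vec n (p (ex v)))"
    then have i: "i < n" by simp
    have "ex v = (\<Sum>j<n. sc (v $ j) (e j))"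
      by (rule ext) (simp add: sum_fun_apply ex_def sc_def e_def sum.delta' if_distrib[of "(*) _"] cong: if_cong)
    then have "p (ex v) = (\<Sum>j<n. sc (v $ j) (p (e j)))" by (simp add: p.sum p.scale)
    then have "p (ex v) i = (\<Sum>j<n. v $ j * p (e j) i)" by (simp add: sc_def sum_fun_apply)
    moreover have "(P *\<^sub>v v) $ i = (\<Sum>j<n. p (e j) i * v $ j)"
      using mat_vec_entry[OF P v i] i by (simp add: P_def)
    ultimately show "(P *\<^sub>v v) $ i = vec n (p (ex v)) $ i" using i by (simp add: mult.commute)
  qed (simp add: P_def)
  have "P *\<^sub>v v \<in> W" if v: "v \<in> carrier_vec n" for v
  proof -
    obtain w where w: "w \<in> W" "p (ex v) = ex w" using p(1) by blast
    then show ?thesis using Pv[OF v] ex_vec[of w] W(1) by auto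
  qed
  moreover have "P *\<^sub>v w = w" if w: "w \<in> W" for w
    using Pv[of w] ex_vec[of w] p(3) w W(1) by auto
  ultimately show ?thesis using P by blast
qed

lemma mat_eq_of_mult_vec:
  fixes A B :: "complex mat"
  assumes A: "A \<in> carrier_mat n n" and B: "B \<in> carrier_mat n n"
    and eq: "\<And>v. v \<in> carrier_vec n \<Longrightarrow> A *\<^sub>v v = B *\<^sub>v v"
  shows "A = B"
proof (rule eq_matI)
  fix i j assume "i < dim_row B" "j < dim_col B"
  then have ij: "i < n" "j < n" using B by auto
  have *: "(Z *\<^sub>v unit_vec n j) $ i = Z $$ (i, j)" if Z: "Z \<in> carrier_mat n n" for Z :: "complex mat"
    using Z ij mat_vec_entry[OF Z unit_vec_carrier ij(1), of j]
    by (simp add: unit_vec_def if_distrib[of "(*) _"] cong: if_cong)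
  show "A $$ (i, j) = B $$ (i, j)" using *[OF A] *[OF B] eq[OF unit_vec_carrier, of j] by simp
qed (use A B in auto)

text \<open>If \<open>W\<close> is a proper invariant subspace, the character is a sum \<open>\<alpha> + \<beta>\<close> belonging to \<open>W\<close> and to the
  quotient by \<open>W\<close>. In the sum of \<open>\<chi> v * \<chi> (inv v)\<close> over \<open>H\<close> the contributions of \<open>\<alpha>\<close> and \<open>\<beta>\<close> with themselves are
  at least the order of \<open>H\<close> each, because the identity maps of \<open>W\<close> and of the quotient are
  equivariant, while the mixed ones are nonnegative. So the sum is at least twice the order of \<open>H\<close>. It is
  bounded by the sum of the \<open>\<bar>\<chi> v\<bar>\<^sup>2\<close>, by the inequality of arithmetic and geometric means.\<close>

theorem irreducible_of_norm_one:
  fixes H (structure) and \<rho> :: "'g \<Rightarrow> complex mat"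
  assumes H: "group H" and fin: "finite (carrier H)"
    and rep: "representation H n \<rho>" and n: "n > 0"
    and norm: "(\<Sum>v\<in>carrier H. (cmod (mat_trace (\<rho> v)))\<^sup>2) \<le> card (carrier H)"
  shows "irreducible_representation H n \<rho>"
  unfolding irreducible_representation_def
proof (intro conjI allI impI rep n)
  interpret group H by (rule H)
  interpret R: ring "ring_mat TYPE(complex) n ()" by (rule ring_mat)
  have hom: "\<rho> \<in> hom H (units_of (ring_mat TYPE(complex) n ()))"
    using rep by (simp add: representation_def)
  have \<rho>: "\<rho> v \<in> carrier_mat n n" if "v \<in> carrier H" for v
    using hom_in_carrier[OF hom that] by (auto simp: units_of_def Units_def ring_mat_simps)
  have \<rho>m: "\<rho> (v \<otimes> w) = \<rho> v * \<rho> w" if "v \<in> carrier H" "w \<in> carrier H" for v w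
    using hom_mult[OF hom that] by (simp add: units_of_def ring_mat_simps)
  have \<rho>1: "\<rho> \<one> = 1\<^sub>m n"
    using hom_one[OF hom is_group R.units_group] by (simp add: units_of_def ring_mat_simps)
  fix W assume asm: "VectorSpace.subspace class_ring W (module_vec TYPE(complex) n) \<and>
    (\<forall>g\<in>carrier H. \<forall>w\<in>W. \<rho> g *\<^sub>v w \<in> W)"
  then have sm: "submodule class_ring W (module_vec TYPE(complex) n)"
    by (simp add: VectorSpace.subspace_def)
  have W: "W \<subseteq> carrier_vec n" "0\<^sub>v n \<in> W"
    "\<And>v w. v \<in> W \<Longrightarrow> w \<in> W \<Longrightarrow> v + w \<in> W" "\<And>c v. v \<in> W \<Longrightarrow> c \<cdot>\<^sub>v v \<in> W"
    using submodule.subset[OF sm] submodule.zero_closed[OF sm] submodule.m_closed[OF sm]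
      submodule.smult_closed[OF sm] by (simp_all add: module_vec_simps)
  have inv_W: "\<rho> g *\<^sub>v w \<in> W" if "g \<in> carrier H" "w \<in> W" for g w using asm that by blast
  show "W = {0\<^sub>v n} \<or> W = carrier_vec n"
  proof (rule ccontr)
    assume ne: "\<not> ?thesis"
    obtain P where P: "P \<in> carrier_mat n n" and PW: "\<And>v. v \<in> carrier_vec n \<Longrightarrow> P *\<^sub>v v \<in> W"
      and Pid: "\<And>w. w \<in> W \<Longrightarrow> P *\<^sub>v w = w"
      using ex_projection_mat[OF W] by blast
    define Q where "Q = 1\<^sub>m n - P"
    have Q: "Q \<in> carrier_mat n n" by (simp add: Q_def minus_carrier_mat[OF P])
    have PP: "P * P = P"
      by (rule mat_eq_of_mult_vec) (use P PW Pid in \<open>auto simp: assoc_mult_mat_vec[of _ n n _ n]\<close>)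
    have P\<rho>P: "P * \<rho> v * P = \<rho> v * P" if v: "v \<in> carrier H" for v
    proof (rule mat_eq_of_mult_vec)
      fix x :: "complex vec" assume x: "x \<in> carrier_vec n"
      have "(P * \<rho> v * P) *\<^sub>v x = P *\<^sub>v (\<rho> v *\<^sub>v (P *\<^sub>v x))"
        using P \<rho>[OF v] x by (simp add: assoc_mult_mat_vec[of _ n n _ n])
      also have "\<dots> = \<rho> v *\<^sub>v (P *\<^sub>v x)" using Pid inv_W[OF v] PW[OF x] by simp
      also have "\<dots> = (\<rho> v * P) *\<^sub>v x" using P \<rho>[OF v] x by (simp add: assoc_mult_mat_vec[of _ n n _ n])
      finally show "(P * \<rho> v * P) *\<^sub>v x = (\<rho> v * P) *\<^sub>v x" .
    qed (use P \<rho>[OF v] in auto)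
    have Q\<rho>Q: "Q * \<rho> v * Q = Q * \<rho> v" if v: "v \<in> carrier H" for v
    proof -
      have R: "\<rho> v \<in> carrier_mat n n" using \<rho>[OF v] .
      have "Q * \<rho> v * Q = Q * \<rho> v - Q * \<rho> v * P"
        unfolding Q_def using P R
        by (subst mult_minus_distrib_mat[of _ n n _ n]) auto
      also have "Q * \<rho> v * P = \<rho> v * P - P * \<rho> v * P"
        unfolding Q_def using P R
        by (simp add: minus_mult_distrib_mat[of _ n n _ _ n])
      also have "\<dots> = 0\<^sub>m n n" using P\<rho>P[OF v] P R by (simp add: minus_r_inv_mat[of _ n n])
      finally have "Q * \<rho> v * Q = Q * \<rho> v - 0\<^sub>m n n" .
      also have "\<dots> = Q * \<rho> v" by (rule eq_matI) (use Q R in auto)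
      finally show ?thesis .
    qed
    have QQ: "Q * Q = Q"
      using Q\<rho>Q[OF one_closed] Q by (simp add: \<rho>1)
    have "P \<noteq> 0\<^sub>m n n"
    proof
      assume P0: "P = 0\<^sub>m n n"
      have "w = 0\<^sub>v n" if w: "w \<in> W" for w
      proof -
        have "0\<^sub>m n n *\<^sub>v w = 0\<^sub>v n" by (rule eq_vecI) (use W(1) w in auto)
        then show ?thesis using Pid[OF w] by (simp add: P0)
      qed
      then show False using ne W(2) by blast
    qed
    have "Q \<noteq> 0\<^sub>m n n"
    proof
      assume Q0: "Q = 0\<^sub>m n n"
      have "P = 1\<^sub>m n"
      proof (rule eq_matI)
        fix i j assume ij: "i < dim_row (1\<^sub>m n :: complex mat)" "j < dim_col (1\<^sub>m n :: complex mat)"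
        have "Q $$ (i, j) = 0" using Q0 ij by simp
        then show "P $$ (i, j) = 1\<^sub>m n $$ (i, j)" using ij P by (simp add: Q_def)
      qed (use P in auto)
      then have "v \<in> W" if "v \<in> carrier_vec n" for v using PW[OF that] that by simp
      then show False using ne W(1) by blast
    qed
    define \<alpha> where "\<alpha> v = mat_trace (\<rho> v * P)" for v
    define \<beta> where "\<beta> v = mat_trace (Q * \<rho> v)" for v
    have \<chi>: "mat_trace (\<rho> v) = \<alpha> v + \<beta> v" if v: "v \<in> carrier H" for v
    proof -
      have "Q * \<rho> v = \<rho> v - P * \<rho> v"
        unfolding Q_def using P \<rho>[OF v] by (simp add: minus_mult_distrib_mat[of _ n n _ _ n])
      moreover have PR: "P * \<rho> v \<in> carrier_mat n n" using P \<rho>[OF v] by simp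
      ultimately have "\<beta> v = mat_trace (\<rho> v) - mat_trace (P * \<rho> v)"
        using carrier_matD[OF PR]
        by (simp add: \<beta>_def mat_trace_carrier[OF minus_carrier_mat[OF PR]] mat_trace_carrier[OF PR]
            mat_trace_carrier[OF \<rho>[OF v]] sum_subtractf del: index_mult_mat)
      moreover have "mat_trace (P * \<rho> v) = \<alpha> v" unfolding \<alpha>_def by (rule mat_trace_mult_commute[OF P \<rho>[OF v]])
      ultimately show ?thesis by simp
    qed
    \<comment> \<open>\<open>\<rho> P\<close> and \<open>Q \<rho>\<close> are the representations on \<open>W\<close> and on the quotient by \<open>W\<close>, written in the full
      matrix space; their values at \<open>\<one>\<close> are \<open>P\<close> and \<open>Q\<close>\<close>
    have aa: "(\<rho> v * P) * (\<rho> w * P) = \<rho> (v \<otimes> w) * P" if vw: "v \<in> carrier H" "w \<in> carrier H" for v w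
    proof -
      have R: "\<rho> v \<in> carrier_mat n n" "\<rho> w \<in> carrier_mat n n" using \<rho> vw by auto
      have "(\<rho> v * P) * (\<rho> w * P) = \<rho> v * (P * \<rho> w * P)"
        using R P by (simp add: assoc_mult_mat[of _ n n _ n _ n])
      also have "\<dots> = \<rho> v * \<rho> w * P"
        unfolding P\<rho>P[OF vw(2)] using R P by (simp add: assoc_mult_mat[of _ n n _ n _ n])
      finally show ?thesis using \<rho>m vw by simp
    qed
    have bb: "(Q * \<rho> v) * (Q * \<rho> w) = Q * \<rho> (v \<otimes> w)" if vw: "v \<in> carrier H" "w \<in> carrier H" for v w
    proof -
      have R: "\<rho> v \<in> carrier_mat n n" "\<rho> w \<in> carrier_mat n n" using \<rho> vw by auto
      have "(Q * \<rho> v) * (Q * \<rho> w) = (Q * \<rho> v * Q) * \<rho> w"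
        using R Q by (simp add: assoc_mult_mat[of _ n n _ n _ n])
      also have "\<dots> = Q * (\<rho> v * \<rho> w)"
        unfolding Q\<rho>Q[OF vw(1)] using R Q by (simp add: assoc_mult_mat[of _ n n _ n _ n])
      finally show ?thesis using \<rho>m vw by simp
    qed
    have ia: "(\<rho> (inv w) * P) * (\<rho> (inv v) * P) = \<rho> (inv (v \<otimes> w)) * P"
      and ib: "(Q * \<rho> (inv w)) * (Q * \<rho> (inv v)) = Q * \<rho> (inv (v \<otimes> w))"
      if vw: "v \<in> carrier H" "w \<in> carrier H" for v w
      using aa[of "inv w" "inv v"] bb[of "inv w" "inv v"] vw by (simp_all add: inv_mult_group)
    have c1: "\<rho> v * P \<in> carrier_mat n n" "\<rho> (inv v) * P \<in> carrier_mat n n"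
      "Q * \<rho> v \<in> carrier_mat n n" "Q * \<rho> (inv v) \<in> carrier_mat n n" if "v \<in> carrier H" for v
      using P Q \<rho>[OF that] \<rho>[OF inv_closed[OF that]] by auto
    have fixP: "(\<rho> v * P) * P * (\<rho> (inv v) * P) = P" if v: "v \<in> carrier H" for v
    proof -
      have "(\<rho> v * P) * P * (\<rho> (inv v) * P) = (\<rho> v * P) * (\<rho> (inv v) * P)"
        using P \<rho>[OF v] PP by (simp add: assoc_mult_mat[of _ n n _ n _ n])
      also have "\<dots> = P" using aa[OF v inv_closed[OF v]] v P by (simp add: \<rho>1)
      finally show ?thesis .
    qed
    have fixQ: "(Q * \<rho> v) * Q * (Q * \<rho> (inv v)) = Q" if v: "v \<in> carrier H" for v
    proof -
      show ?thesis unfolding Q\<rho>Q[OF v] using bb[OF v inv_closed[OF v]] v Q by (simp add: \<rho>1)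
    qed
    let ?S = "\<lambda>f g. Re (\<Sum>v\<in>carrier H. f v * g (inv v))"
    have "card (carrier H) \<le> ?S \<alpha> \<alpha>"
      unfolding \<alpha>_def by (rule averaged_tensor_trace(2)[OF H fin c1(1) c1(2) aa ia P \<open>P \<noteq> 0\<^sub>m n n\<close> fixP])
    moreover have "card (carrier H) \<le> ?S \<beta> \<beta>"
      unfolding \<beta>_def by (rule averaged_tensor_trace(2)[OF H fin c1(3) c1(4) bb ib Q \<open>Q \<noteq> 0\<^sub>m n n\<close> fixQ])
    moreover have "0 \<le> ?S \<alpha> \<beta>"
      unfolding \<alpha>_def \<beta>_def by (rule averaged_tensor_trace(1)[OF H fin c1(1) c1(4) aa ib])
    moreover have "0 \<le> ?S \<beta> \<alpha>"
      unfolding \<alpha>_def \<beta>_def by (rule averaged_tensor_trace(1)[OF H fin c1(3) c1(2) bb ia])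
    moreover have "?S (\<lambda>v. mat_trace (\<rho> v)) (\<lambda>v. mat_trace (\<rho> v)) = ?S \<alpha> \<alpha> + ?S \<beta> \<beta> + ?S \<alpha> \<beta> + ?S \<beta> \<alpha>"
    proof -
      have "(\<Sum>v\<in>carrier H. mat_trace (\<rho> v) * mat_trace (\<rho> (inv v))) =
          (\<Sum>v\<in>carrier H. \<alpha> v * \<alpha> (inv v) + \<beta> v * \<beta> (inv v) + \<alpha> v * \<beta> (inv v) + \<beta> v * \<alpha> (inv v))"
        by (rule sum.cong) (auto simp: \<chi> algebra_simps)
      then show ?thesis by (simp add: sum.distrib)
    qed
    ultimately have lower: "2 * real (card (carrier H)) \<le> ?S (\<lambda>v. mat_trace (\<rho> v)) (\<lambda>v. mat_trace (\<rho> v))"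
      by linarith
    let ?m = "\<lambda>v. cmod (mat_trace (\<rho> v))"
    have "?S (\<lambda>v. mat_trace (\<rho> v)) (\<lambda>v. mat_trace (\<rho> v)) = (\<Sum>v\<in>carrier H. Re (mat_trace (\<rho> v) * mat_trace (\<rho> (inv v))))"
      by (rule Re_sum)
    also have "\<dots> \<le> (\<Sum>v\<in>carrier H. ((?m v)\<^sup>2 + (?m (inv v))\<^sup>2) / 2)"
    proof (rule sum_mono)
      fix v
      have "Re (mat_trace (\<rho> v) * mat_trace (\<rho> (inv v))) \<le> ?m v * ?m (inv v)"
        using complex_Re_le_cmod[of "mat_trace (\<rho> v) * mat_trace (\<rho> (inv v))"] by (simp add: norm_mult)
      moreover have "2 * (?m v * ?m (inv v)) \<le> (?m v)\<^sup>2 + (?m (inv v))\<^sup>2"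
        using sum_squares_bound[of "?m v" "?m (inv v)"] by (simp add: mult.assoc)
      ultimately show "Re (mat_trace (\<rho> v) * mat_trace (\<rho> (inv v))) \<le> ((?m v)\<^sup>2 + (?m (inv v))\<^sup>2) / 2"
        by simp
    qed
    also have "\<dots> = ((\<Sum>v\<in>carrier H. (?m v)\<^sup>2) + (\<Sum>v\<in>carrier H. (?m (inv v))\<^sup>2)) / 2"
      by (simp add: sum.distrib flip: sum_divide_distrib)
    also have "(\<Sum>v\<in>carrier H. (?m (inv v))\<^sup>2) = (\<Sum>v\<in>carrier H. (?m v)\<^sup>2)"
      by (rule sum.reindex_bij_witness[where i = "\<lambda>v. inv v" and j = "\<lambda>v. inv v"]) auto
    finally have "2 * real (card (carrier H)) \<le> card (carrier H)" using lower norm by simp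
    moreover have "card (carrier H) > 0" using fin one_closed by (auto simp: card_gt_0_iff)
    ultimately show False by simp
  qed
qed


section \<open>Regular and complete intersections\<close>

context finite_group
begin

text \<open>\<open>V\<close> is transitive on the cosets of \<open>U\<close>, so Burnside's lemma evaluates the norm of the restriction
  as \<open>1\<close>.\<close>

lemma restrict_irreducible_of_supplement:
  assumes \<chi>: "\<chi> \<in> Irr G" and U: "subgroup U G" and V: "subgroup V G"
    and perm: "\<forall>g\<in>carrier G. cnj (\<chi> g) * \<chi> g = perm_character G U g"
    and UV: "U <#> V = carrier G"
  shows "restrict \<chi> V \<in> Irr (G\<lparr>carrier := V\<rparr>)"
proof -
  obtain n \<rho> where \<rho>: "irreducible_representation G n \<rho>" "\<chi> = character G \<rho>"
    using \<chi> by (auto simp: Irr_def)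
  have Vc: "v \<in> carrier G" if "v \<in> V" for v using subgroup.mem_carrier[OF V that] .
  have \<chi>V: "\<chi> v = mat_trace (\<rho> v)" if "v \<in> V" for v
    using Vc[OF that] by (simp add: \<rho>(2) character_def)
  have rep: "representation G n \<rho>" and n: "n > 0"
    using \<rho>(1) by (simp_all add: irreducible_representation_def)
  have repV: "representation (G\<lparr>carrier := V\<rparr>) n \<rho>"
    using rep Vc by (auto simp: representation_def hom_def)
  have "irreducible_representation (G\<lparr>carrier := V\<rparr>) n \<rho>"
  proof (rule irreducible_of_norm_one[OF _ _ repV n])
    show "group (G\<lparr>carrier := V\<rparr>)" using subgroup_imp_group[OF V] .
    show "finite (carrier (G\<lparr>carrier := V\<rparr>))" using finite_subgroup[OF V] by simp
    have "complex_of_real (\<Sum>v\<in>V. (cmod (mat_trace (\<rho> v)))\<^sup>2) = (\<Sum>v\<in>V. cnj (\<chi> v) * \<chi> v)"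
      unfolding of_real_sum
      by (intro sum.cong refl) (simp only: \<chi>V complex_norm_square mult.commute)
    also have "\<dots> = (\<Sum>v\<in>V. of_nat (card {D \<in> rcosets U. D #> v = D}))"
      using perm Vc by (intro sum.cong) (auto simp: perm_character_def)
    also have "\<dots> = of_nat (\<Sum>v\<in>V. card {D \<in> rcosets U. D #> v = D})" by simp
    also have "\<dots> = of_nat (card V)"
      by (simp only: sum_fixed_cosets_of_supplement[OF U V UV])
    finally have "complex_of_real (\<Sum>v\<in>V. (cmod (mat_trace (\<rho> v)))\<^sup>2) = complex_of_real (real (card V))" by simp
    then have "(\<Sum>v\<in>V. (cmod (mat_trace (\<rho> v)))\<^sup>2) = real (card V)" by (simp only: of_real_eq_iff)
    then show "(\<Sum>v\<in>carrier (G\<lparr>carrier := V\<rparr>). (cmod (mat_trace (\<rho> v)))\<^sup>2)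
        \<le> card (carrier (G\<lparr>carrier := V\<rparr>))" by simp
  qed
  moreover have "restrict \<chi> V = character (G\<lparr>carrier := V\<rparr>) \<rho>"
    using \<chi>V by (auto simp: character_def)
  ultimately show ?thesis by (auto simp: Irr_def)
qed

text \<open>The index of \<open>M\<close> divides that of \<open>H\<close>, so a prime divisor of the former can be used.\<close>

lemma maximal_factor_p_solvable:
  assumes M: "maximal_subgroup G M" and H: "subgroup H G" "H \<subseteq> M"
    and ps: "\<And>p. prime p \<Longrightarrow> p dvd index G H \<Longrightarrow> p_solvable G p"
  shows "p_solvable_maximal G M"
proof -
  note m = maximal_subgroupD[OF M]
  have "index G M \<noteq> 1"
  proof
    assume "index G M = 1"
    then have "card (carrier G) \<le> card M" using index_mult_card[OF m(1)] by simp
    then show False using subgroup_eqI_card[OF subgroup_self m(2)] m(3) by simp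
  qed
  then obtain p where p: "prime p" "p dvd index G M" using prime_factor_nat by blast
  obtain k where k: "card M = card H * k" using card_subgroup_dvd[OF H(1) m(1) H(2)] by blast
  have "index G H * card H = index G M * card H * k"
    using index_mult_card[OF H(1)] index_mult_card[OF m(1)] k by simp
  then have "card H * index G H = card H * (index G M * k)" by (simp add: ac_simps)
  then have "index G H = index G M * k" using card_subgroup_pos[OF H(1)] by simp
  then have "p dvd index G H" using p(2) by simp
  then show ?thesis using M p ps by (auto simp: p_solvable_maximal_def)
qed

lemma regular_intersection_dichotomy:
  assumes U: "regular_intersection G U" and M: "p_solvable_maximal G M"
  shows "(\<exists>x\<in>carrier G. \<forall>u\<in>U. x \<otimes> u \<otimes> inv x \<in> M) \<or> U <#> M = carrier G"
proof -
  obtain I F where sU: "subgroup U G" and F: "\<forall>i\<in>I. maximal_subgroup G (F i)"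
    and ps: "\<forall>p. prime p \<and> p dvd index G U \<longrightarrow> p_solvable G p"
    and UF: "U = family_inter G I F"
    and iso: "\<forall>i\<in>I. \<forall>j\<in>I. i \<noteq> j \<longrightarrow>
      \<not> module_isomorphic G (X_group G (F i)) (X_action G (F i)) (X_group G (F j)) (X_action G (F j))"
    using U unfolding regular_intersection_def by blast
  have F': "p_solvable_maximal G (F i)" if i: "i \<in> I" for i
    by (rule maximal_factor_p_solvable[OF _ sU]) (use F i ps UF in \<open>auto simp: family_inter_def\<close>)
  have unl: "\<not> chief_linked G (F i) (F j)" if "i \<in> I" "j \<in> I" "i \<noteq> j" for i j
    using chief_linked_imp_module_isomorphic[OF F'[OF that(1)] F'[OF that(2)]] iso that by blast
  have sM: "subgroup M G" using M maximal_subgroupD(1) by (simp add: p_solvable_maximal_def)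
  have sF: "subgroup (F i) G" if "i \<in> I" for i using F that maximal_subgroupD(1) by blast
  show ?thesis
    unfolding UF
    by (rule unlinked_intersection_dichotomy[OF F' unl M one_is_normal])
      (use subgroup.one_closed[OF sM] subgroup.one_closed[OF sF] in auto)
qed

lemma regular_covered_by_maximal:
  assumes U: "regular_intersection G U" and M: "p_solvable_maximal G M"
    and cov: "\<forall>u\<in>U. \<exists>x\<in>carrier G. x \<otimes> u \<otimes> inv x \<in> M"
  shows "\<exists>x\<in>carrier G. \<forall>u\<in>U. x \<otimes> u \<otimes> inv x \<in> M"
proof -
  have "maximal_subgroup G M" using M by (simp add: p_solvable_maximal_def)
  note m = maximal_subgroupD[OF this]
  have sU: "subgroup U G" using U by (simp add: regular_intersection_def)
  have "U <#> M \<noteq> carrier G"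
  proof
    assume "U <#> M = carrier G"
    from exists_derangement_of_supplement[OF sU m(1,3) this] cov show False by blast
  qed
  then show ?thesis using regular_intersection_dichotomy[OF U M] by blast
qed

text \<open>Each maximal subgroup of the family contains a conjugate of \<open>U\<close>, and the conjugating elements \<open>x i\<close>
  may be replaced by a common one since only the cosets of \<open>F i\<close> that they represent matter.\<close>

lemma regular_covered_by_complete_intersection:
  assumes U: "regular_intersection G U" and V: "complete_intersection G V"
    and cov: "\<forall>u\<in>U. \<exists>x\<in>carrier G. x \<otimes> u \<otimes> inv x \<in> V"
  shows "\<exists>g\<in>carrier G. \<forall>u\<in>U. g \<otimes> u \<otimes> inv g \<in> V"
proof -
  obtain I F where sV: "subgroup V G"
    and ps: "\<forall>p. prime p \<and> p dvd index G V \<longrightarrow> p_solvable G p"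
    and I: "finite I" and F: "\<forall>i\<in>I. maximal_subgroup G (F i)"
    and VF: "V = family_inter G I F" and ind: "index G V = (\<Prod>i\<in>I. index G (F i))"
    using V unfolding complete_intersection_def by blast
  have sU: "subgroup U G" using U by (simp add: regular_intersection_def)
  have sF: "subgroup (F i) G" if "i \<in> I" for i using F that maximal_subgroupD(1) by blast
  have VsubF: "V \<subseteq> F i" if "i \<in> I" for i using that by (auto simp: VF family_inter_def)
  have "\<exists>x\<in>carrier G. \<forall>u\<in>U. x \<otimes> u \<otimes> inv x \<in> F i" if i: "i \<in> I" for i
  proof (rule regular_covered_by_maximal[OF U])
    show "p_solvable_maximal G (F i)"
      by (rule maximal_factor_p_solvable[OF _ sV VsubF[OF i]]) (use F i ps in auto)
    show "\<forall>u\<in>U. \<exists>x\<in>carrier G. x \<otimes> u \<otimes> inv x \<in> F i" using cov VsubF[OF i] by blast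
  qed
  then obtain x where x: "\<And>i. i \<in> I \<Longrightarrow> x i \<in> carrier G"
    and xU: "\<And>i u. i \<in> I \<Longrightarrow> u \<in> U \<Longrightarrow> x i \<otimes> u \<otimes> inv (x i) \<in> F i" by metis
  have "\<exists>g\<in>carrier G. \<forall>i\<in>I. F i #> x i = F i #> g"
    by (rule complete_intersection_common_coset[OF I sF ind[unfolded VF] x])
  then obtain g where g: "g \<in> carrier G" "\<And>i. i \<in> I \<Longrightarrow> F i #> x i = F i #> g" by blast
  have "g \<otimes> u \<otimes> inv g \<in> V" if u: "u \<in> U" for u
  proof -
    have uc: "u \<in> carrier G" using subgroup.mem_carrier[OF sU u] .
    have "g \<otimes> u \<otimes> inv g \<in> F i" if i: "i \<in> I" for i
    proof -
      define a where "a = g \<otimes> inv (x i)"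
      have xc: "x i \<in> carrier G" using x[OF i] .
      have a: "a \<in> F i"
        using subgroup_r_coset_eq_iff[OF sF[OF i] g(1) xc] g(2)[OF i] by (simp add: a_def)
      have "a \<otimes> (x i \<otimes> u \<otimes> inv (x i)) \<otimes> inv a \<in> F i"
        using a xU[OF i u] sF[OF i] by (simp add: subgroup.m_closed subgroup.m_inv_closed)
      also have "a \<otimes> (x i \<otimes> u \<otimes> inv (x i)) \<otimes> inv a = g \<otimes> u \<otimes> inv g"
        using g(1) xc uc by (simp add: a_def inv_mult_group m_assoc)
      finally show ?thesis .
    qed
    then show ?thesis using g(1) uc by (simp add: VF family_inter_def)
  qed
  then show ?thesis using g(1) by blast
qed

end

theorem theoremG:
  fixes G :: "('a, 'b) monoid_scheme"
    and \<chi> :: "'a \<Rightarrow> complex"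
    and U V :: "'a set"
  assumes "group G"
    and "finite (carrier G)"
    and "\<chi> \<in> Irr G"
    and "regular_intersection G U"
    and "\<forall>g\<in>carrier G. cnj (\<chi> g) * \<chi> g = perm_character G U g"
    and "complete_intersection G V"
  shows "(vanishes_off_conjugates G \<chi> V \<longleftrightarrow> conjugate_to_subgroup_of G U V) \<and>
    (maximal_subgroup G V \<longrightarrow>
      (vanishes_off_conjugates G \<chi> V \<and> conjugate_to_subgroup_of G U V) \<or>
      restrict \<chi> V \<in> Irr (G\<lparr>carrier := V\<rparr>))"
proof -
  interpret finite_group G
    using assms(1,2) by (simp add: finite_group_def finite_group_axioms_def)
  have sU: "subgroup U G" using assms(4) by (simp add: regular_intersection_def)
  have sV: "subgroup V G" using assms(6) by (simp add: complete_intersection_def)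
  note vanishes = vanishes_off_conjugates_iff[OF sU sV assms(5)]
  note conjugate = conjugate_to_subgroup_of_iff[OF sU sV]
  have equiv: "vanishes_off_conjugates G \<chi> V \<longleftrightarrow> conjugate_to_subgroup_of G U V"
    unfolding vanishes conjugate
    using regular_covered_by_complete_intersection[OF assms(4,6)] by blast
  moreover have "conjugate_to_subgroup_of G U V \<or> restrict \<chi> V \<in> Irr (G\<lparr>carrier := V\<rparr>)"
    if max: "maximal_subgroup G V"
  proof -
    have "p_solvable_maximal G V"
      by (rule maximal_factor_p_solvable[OF max sV subset_refl])
        (use assms(6) in \<open>simp add: complete_intersection_def\<close>)
    from regular_intersection_dichotomy[OF assms(4) this] show ?thesis
      unfolding conjugate using restrict_irreducible_of_supplement[OF assms(3) sU sV assms(5)] by blast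
  qed
  ultimately show ?thesis by blast
qed

end
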